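(* Let $X$ be a strictly stationary $\mathcal C$-valued random field, suppose that $\mathsf T$ is an additive group, let $\nu=\nu_Z$ be the measure defined in the context from a stochastic representer $Z$, and write $\mu_u=\mu_u^{X,b}$. Then $X\in\mathrm{RV}_\Pi(\alpha,\nu;b)$ if and only if all of the following hold: (i) $\nu$ is shift-invariant; (ii) as $u\to\infty$, for every $\ell\in\mathsf D^{q-1}$, $$\mathbb I_{A_\ell}\mu_u\Longrightarrow\mathbb I_{A_\ell}\nu\quad\text{as finite measures on }\mathcal C;$$ (iii) when $\mathsf T=\mathbb R^m$, $\limsup_{u\to\infty}\mu_u(O_n)\le\nu(O_n)$ for every $n\ge1$.
   Context: Index set and paths. $q\in\mathbb N=\{1,2,\dots\}$; $\mathsf T$ is either a nonempty finite or countably infinite discrete additive (abelian) group, or $\mathsf T=\mathbb R^m$ with $m\in\mathbb N$. $\mathcal C=C(\mathsf T,\mathbb R^q)$ is the space of continuous functions $f=(f_1,\dots,f_q)$ with the topology of locally uniform convergence and its Borel $\sigma$-field. $(K_n)_{n\ge1}$ is a fixed increasing exhaustion of $\mathsf T$ by nonempty compact sets such that every compact subset lies in some $K_n$; for $\mathsf T=\mathbb R^m$, $K_n=[-n,n]^m$. Put $\rho_{n,i}(f)=\sup_{t\in K_n}|f_i(t)|$. Shifts: $(B^hf)(t)=f(t-h)$. $X$ is strictly stationary if $B^hX$ has the law of $X$ for all $h\in\mathsf T$; $\nu$ is shift-invariant if $\nu\circ(B^h)^{-1}=\nu$ for all $h\in\mathsf T$. Scaling. $G=(0,\infty)^q$,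 $(r\odot f)(t)=(r_1f_1(t),\dots,r_qf_q(t))$ for $r\in G$, $u^{-1}=(u_1^{-1},\dots,u_q^{-1})$. Fix $\alpha\in(0,\infty)^q$ and put $\vartheta_\alpha(dr)=\prod_{i=1}^q\alpha_ir_i^{-\alpha_i-1}dr_i$ on $G$. Localisation. $\mathcal C_\Pi^\circ=\{f\in\mathcal C:f_i\not\equiv0\text{ for all }i\}$; $O_n=\{f\in\mathcal C:\min_i\rho_{n,i}(f)>1/n\}$; product windows $U_{\boldsymbol n,\varepsilon}=\{f\in\mathcal C:\rho_{n_i,i}(f)>\varepsilon_i,\ 1\le i\le q\}$, $\boldsymbol n\in\mathbb N^q,\varepsilon\in G$. A measure on $\mathcal C_\Pi^\circ$ is boundedly finite if finite on every product window; measures on $\mathcal C_\Pi^\circ$ are identified with their zero extensions to $\mathcal C$. $C_\Pi(\mathcal C)$ is the set of bounded continuous $F:\mathcal C\to\mathbb R$ vanishing outside some product window. Target. $Z$ is a $\mathcal C_\Pi^\circ$-valued random element with $\mathbb E\{\prod_i\rho_{n_i,i}(Z)^{\alpha_i}\}<\infty$ for all $\boldsymbol n\in\mathbb N^q$, and $\nu=\nu_Z$, $\nu_Z(A)=\mathbb E\{\int_G\mathbb I_{\{r\odot Z\in A\}}\vartheta_\alpha(dr)\}$. Thresholds and rates. $u\to\infty$ ($u\in G$) means $\min_iu_i\to\infty$, with no restriction on relative rates (limits along every such sequence); $\limsup_{u\to\infty}g(u)=\inf_{M>0}\sup_{u\in G,\min_iu_i\ge M}g(u)$. $b=(b_1,\dots,b_q)$,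 $b_i:(0,\infty)\to(0,\infty)$ regularly varying at infinity with index $\alpha_i$; $a(u)=\prod_ib_i(u_i)$; $\mu_u^{X,b}(A)=a(u)\mathbb P\{u^{-1}\odot X\in A\}$ for Borel $A\subset\mathcal C_\Pi^\circ$. $X\in\mathrm{RV}_\Pi(\alpha,\nu;b)$ means that $\nu$ is nonzero and boundedly finite and $\lim_{u\to\infty}\int F\,d\mu_u^{X,b}=\int F\,d\nu$ for all $F\in C_\Pi(\mathcal C)$. Relative anchors. $\mathsf D=\mathsf T$ if $\mathsf T$ is discrete, $\mathsf D=\mathbb Q^m$ if $\mathsf T=\mathbb R^m$. For $\ell=(\ell_2,\dots,\ell_q)\in\mathsf D^{q-1}$, $A_\ell=\{f\in\mathcal C:|f_1(0)|>1,\ |f_i(\ell_i)|>1\ (2\le i\le q)\}$; for $q=1$ there is only the empty tuple and $A_\ell=\{|f_1(0)|>1\}$. $\mathbb I_A\mu$ is the restriction of $\mu$ to $A$; for finite measures $\Longrightarrow$ is convergence of integrals of all bounded continuous functions (including total masses). *)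

theory Defs
  imports "HOL-Probability.Probability"
begin

text \<open>Coordinates are indexed by a finite type \<open>'q\<close>, so that \<open>q = CARD('q) \<ge> 1\<close>.\<close>

typedef (overloaded) ('t, 'q) cfield =
  "{f :: 't::topological_space \<Rightarrow> real ^ 'q. continuous_on UNIV f}"
  morphisms fval Abs_cfield
  by (rule exI[of _ "\<lambda>_. 0"]) simp

setup_lifting type_definition_cfield

text \<open>Uniform convergence on compact sets; this is locally uniform convergence, since the
  index spaces considered here are locally compact.\<close>

instantiation cfield :: (topological_space, finite) topological_space
begin

definition open_cfield :: "('a, 'b) cfield set \<Rightarrow> bool" where
  "open_cfield U \<longleftrightarrow>
     (\<forall>f\<in>U. \<exists>C e. compact C \<and> e > 0 \<and> {g. \<forall>t\<in>C. dist (fval g t) (fval f t) < e} \<subseteq> U)"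

instance
proof
  show "open (UNIV :: ('a, 'b) cfield set)"
    unfolding open_cfield_def
    by (rule ballI, rule exI[where x = "{}"], rule exI[where x = 1]) simp
next
  fix S T :: "('a, 'b) cfield set"
  assume S: "open S" and T: "open T"
  show "open (S \<inter> T)"
    unfolding open_cfield_def
  proof
    fix f assume f: "f \<in> S \<inter> T"
    from S[unfolded open_cfield_def, rule_format, OF IntD1[OF f]]
    obtain C c where C: "compact C" "c > 0" "{g. \<forall>t\<in>C. dist (fval g t) (fval f t) < c} \<subseteq> S"
      by (elim exE conjE)
    from T[unfolded open_cfield_def, rule_format, OF IntD2[OF f]]
    obtain D d where D: "compact D" "d > 0" "{g. \<forall>t\<in>D. dist (fval g t) (fval f t) < d} \<subseteq> T"
      by (elim exE conjE)
    have "{g. \<forall>t\<in>C \<union> D. dist (fval g t) (fval f t) < min c d} \<subseteq> S \<inter> T"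
    proof
      fix g assume "g \<in> {g. \<forall>t\<in>C \<union> D. dist (fval g t) (fval f t) < min c d}"
      then have "g \<in> {g. \<forall>t\<in>C. dist (fval g t) (fval f t) < c}"
          "g \<in> {g. \<forall>t\<in>D. dist (fval g t) (fval f t) < d}"
        by simp_all
      then show "g \<in> S \<inter> T"
        using C(3) D(3) by (intro IntI) (erule (1) rev_subsetD)+
    qed
    moreover have "compact (C \<union> D)" "min c d > 0"
      using C(1,2) D(1,2) by (simp_all add: compact_Un)
    ultimately show "\<exists>C e. compact C \<and> e > 0 \<and>
        {g. \<forall>t\<in>C. dist (fval g t) (fval f t) < e} \<subseteq> S \<inter> T"
      by (intro exI conjI)
  qed
next
  fix \<U> :: "('a, 'b) cfield set set"
  assume *: "\<forall>S\<in>\<U>. open S"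
  show "open (\<Union>\<U>)"
    unfolding open_cfield_def
  proof
    fix f assume "f \<in> \<Union>\<U>"
    then obtain S where S: "S \<in> \<U>" "f \<in> S" ..
    from bspec[OF * S(1), unfolded open_cfield_def, rule_format, OF S(2)]
    obtain C e where C: "compact C" "e > 0" "{g. \<forall>t\<in>C. dist (fval g t) (fval f t) < e} \<subseteq> S"
      by (elim exE conjE)
    have "S \<subseteq> \<Union>\<U>" using S(1) by (rule Union_upper)
    with C show "\<exists>C e. compact C \<and> e > 0 \<and>
        {g. \<forall>t\<in>C. dist (fval g t) (fval f t) < e} \<subseteq> \<Union>\<U>"
      by (intro exI conjI) (assumption | erule (1) order_trans)+
  qed
qed

end

lift_definition shift :: "'t::topological_ab_group_add \<Rightarrow> ('t, 'q::finite) cfield \<Rightarrow> ('t, 'q) cfield"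
  is "\<lambda>h f t. f (t - h)"
proof -
  fix h :: 't and f :: "'t \<Rightarrow> real ^ 'q"
  assume "continuous_on UNIV f"
  moreover have "continuous_on UNIV (\<lambda>t. t - h)"
    by (intro continuous_intros)
  ultimately show "continuous_on UNIV (\<lambda>t. f (t - h))"
    by (rule continuous_on_compose2) simp
qed

lift_definition scale :: "real ^ 'q \<Rightarrow> ('t::topological_space, 'q::finite) cfield \<Rightarrow> ('t, 'q) cfield"
  is "\<lambda>r f t. \<chi> i. r $ i * f t $ i"
proof -
  fix r :: "real ^ 'q" and f :: "'t \<Rightarrow> real ^ 'q"
  assume "continuous_on UNIV f"
  then show "continuous_on UNIV (\<lambda>t. \<chi> i. r $ i * f t $ i)"
    by (intro continuous_on_vec_lambda continuous_on_mult_left continuous_on_component)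
qed

definition posG :: "(real ^ 'q) set" where
  "posG = {r. \<forall>i. r $ i > 0}"

definition vinv :: "real ^ 'q \<Rightarrow> real ^ 'q" where
  "vinv u = (\<chi> i. inverse (u $ i))"

text \<open>Sequences of compact sets are indexed from 1; the value at 0 is irrelevant.\<close>

definition exhaustion :: "(nat \<Rightarrow> 't::topological_space set) \<Rightarrow> bool" where
  "exhaustion K \<longleftrightarrow>
     (\<forall>n\<ge>1. compact (K n) \<and> K n \<noteq> {}) \<and>
     (\<forall>m n. 1 \<le> m \<longrightarrow> m \<le> n \<longrightarrow> K m \<subseteq> K n) \<and>
     (\<forall>C. compact C \<longrightarrow> (\<exists>n\<ge>1. C \<subseteq> K n))"

definition cube :: "nat \<Rightarrow> (real ^ 'm) set" where
  "cube n = {t. \<forall>j. \<bar>t $ j\<bar> \<le> real n}"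

definition rho :: "(nat \<Rightarrow> 't set) \<Rightarrow> nat \<Rightarrow> 'q \<Rightarrow> ('t::topological_space, 'q::finite) cfield \<Rightarrow> real" where
  "rho K n i f = (SUP t\<in>K n. \<bar>fval f t $ i\<bar>)"

definition CPi :: "('t::topological_space, 'q::finite) cfield set" where
  "CPi = {f. \<forall>i. \<exists>t. fval f t $ i \<noteq> 0}"

definition Owin :: "(nat \<Rightarrow> 't set) \<Rightarrow> nat \<Rightarrow> ('t::topological_space, 'q::finite) cfield set" where
  "Owin K n = {f. (MIN i. rho K n i f) > 1 / real n}"

definition Uwin :: "(nat \<Rightarrow> 't set) \<Rightarrow> ('q \<Rightarrow> nat) \<Rightarrow> real ^ 'q
    \<Rightarrow> ('t::topological_space, 'q::finite) cfield set" where
  "Uwin K n e = {f. \<forall>i. rho K (n i) i f > e $ i}"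

text \<open>Measures on \<open>CPi\<close> are represented by their zero extensions to the whole space.\<close>

definition measure_on_CPi :: "('t::topological_space, 'q::finite) cfield measure \<Rightarrow> bool" where
  "measure_on_CPi \<nu> \<longleftrightarrow> sets \<nu> = sets borel \<and> emeasure \<nu> (- CPi) = 0"

definition boundedly_finite ::
    "(nat \<Rightarrow> 't set) \<Rightarrow> ('t::topological_space, 'q::finite) cfield measure \<Rightarrow> bool" where
  "boundedly_finite K \<nu> \<longleftrightarrow>
     (\<forall>n e. (\<forall>i. n i \<ge> 1) \<longrightarrow> e \<in> posG \<longrightarrow> emeasure \<nu> (Uwin K n e) < \<infinity>)"

definition test_functions ::
    "(nat \<Rightarrow> 't set) \<Rightarrow> (('t::topological_space, 'q::finite) cfield \<Rightarrow> real) set" where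
  "test_functions K = {F. continuous_on UNIV F \<and> bounded (range F) \<and>
     (\<exists>n e. (\<forall>i. n i \<ge> 1) \<and> e \<in> posG \<and> (\<forall>f. f \<notin> Uwin K n e \<longrightarrow> F f = 0))}"

definition theta :: "real ^ 'q \<Rightarrow> (real ^ 'q::finite) measure" where
  "theta \<alpha> = density lborel
     (\<lambda>r. indicator posG r * (\<Prod>i\<in>UNIV. ennreal (\<alpha> $ i * (r $ i) powr (- \<alpha> $ i - 1))))"

definition representer :: "(nat \<Rightarrow> 't set) \<Rightarrow> real ^ 'q \<Rightarrow> 'v measure
    \<Rightarrow> ('v \<Rightarrow> ('t::topological_space, 'q::finite) cfield) \<Rightarrow> bool" where
  "representer K \<alpha> N Z \<longleftrightarrow>
     Z \<in> borel_measurable N \<and> (\<forall>w\<in>space N. Z w \<in> CPi) \<and>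
     (\<forall>n. (\<forall>i. n i \<ge> 1) \<longrightarrow>
        (\<integral>\<^sup>+w. ennreal (\<Prod>i\<in>UNIV. rho K (n i) i (Z w) powr \<alpha> $ i) \<partial>N) < \<infinity>)"

definition nuZ :: "real ^ 'q \<Rightarrow> 'v measure \<Rightarrow> ('v \<Rightarrow> ('t::topological_space, 'q::finite) cfield)
    \<Rightarrow> ('t, 'q) cfield measure" where
  "nuZ \<alpha> N Z = measure_of UNIV (sets borel)
     (\<lambda>A. \<integral>\<^sup>+w. (\<integral>\<^sup>+r. indicator A (scale r (Z w)) \<partial>theta \<alpha>) \<partial>N)"

text \<open>Pointwise regular variation; measurability is deliberately not required.\<close>

definition regularly_varying :: "real \<Rightarrow> (real \<Rightarrow> real) \<Rightarrow> bool" where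
  "regularly_varying \<beta> g \<longleftrightarrow> (\<forall>x>0. ((\<lambda>t. g (x * t) / g t) \<longlongrightarrow> x powr \<beta>) at_top)"

definition to_infty :: "(real ^ 'q::finite) filter" where
  "to_infty = filtercomap (\<lambda>u. MIN i. u $ i) at_top"

definition mu :: "('q \<Rightarrow> real \<Rightarrow> real) \<Rightarrow> 'w measure
    \<Rightarrow> ('w \<Rightarrow> ('t::topological_space, 'q::finite) cfield) \<Rightarrow> real ^ 'q \<Rightarrow> ('t, 'q) cfield measure" where
  "mu b M X u = density (distr M borel (\<lambda>w. scale (vinv u) (X w)))
     (\<lambda>f. ennreal (\<Prod>i\<in>UNIV. b i (u $ i)) * indicator CPi f)"

text \<open>The index vector \<open>\<alpha>\<close> enters only through \<open>b\<close>, and is therefore not an argument.\<close>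

definition RV_Pi :: "(nat \<Rightarrow> 't set) \<Rightarrow> ('t::topological_space, 'q::finite) cfield measure
    \<Rightarrow> ('q \<Rightarrow> real \<Rightarrow> real) \<Rightarrow> 'w measure \<Rightarrow> ('w \<Rightarrow> ('t, 'q) cfield) \<Rightarrow> bool" where
  "RV_Pi K \<nu> b M X \<longleftrightarrow>
     measure_on_CPi \<nu> \<and> emeasure \<nu> (space \<nu>) \<noteq> 0 \<and> boundedly_finite K \<nu> \<and>
     (\<forall>F\<in>test_functions K.
        ((\<lambda>u. integral\<^sup>L (mu b M X u) F) \<longlongrightarrow> integral\<^sup>L \<nu> F) to_infty)"

definition strictly_stationary ::
    "'w measure \<Rightarrow> ('w \<Rightarrow> ('t::topological_ab_group_add, 'q::finite) cfield) \<Rightarrow> bool" where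
  "strictly_stationary M X \<longleftrightarrow> (\<forall>h. distr M borel (\<lambda>w. shift h (X w)) = distr M borel X)"

definition shift_invariant ::
    "('t::topological_ab_group_add, 'q::finite) cfield measure \<Rightarrow> bool" where
  "shift_invariant \<nu> \<longleftrightarrow> (\<forall>h. distr \<nu> borel (shift h) = \<nu>)"

text \<open>The coordinate \<open>p\<close> plays the role of the first one; the value \<open>l p\<close> is irrelevant.\<close>

definition anchor :: "'q \<Rightarrow> ('q \<Rightarrow> 't) \<Rightarrow> ('t::{topological_space, zero}, 'q::finite) cfield set" where
  "anchor p l = {f. \<bar>fval f 0 $ p\<bar> > 1 \<and> (\<forall>i. i \<noteq> p \<longrightarrow> \<bar>fval f (l i) $ i\<bar> > 1)}"

definition restrict_meas :: "'a set \<Rightarrow> 'a measure \<Rightarrow> 'a measure" where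
  "restrict_meas A \<nu> = density \<nu> (indicator A)"

definition weak_limit ::
    "('u \<Rightarrow> 'a::topological_space measure) \<Rightarrow> 'a measure \<Rightarrow> 'u filter \<Rightarrow> bool" where
  "weak_limit \<mu> \<nu> U \<longleftrightarrow>
     (\<forall>\<^sub>F u in U. finite_measure (\<mu> u)) \<and> finite_measure \<nu> \<and>
     (\<forall>F::'a \<Rightarrow> real. continuous_on UNIV F \<longrightarrow> bounded (range F) \<longrightarrow>
        ((\<lambda>u. integral\<^sup>L (\<mu> u) F) \<longlongrightarrow> integral\<^sup>L \<nu> F) U)"

definition anchored_convergence :: "'q \<Rightarrow> 't set
    \<Rightarrow> (real ^ 'q \<Rightarrow> ('t::{topological_space, zero}, 'q::finite) cfield measure)
    \<Rightarrow> ('t, 'q) cfield measure \<Rightarrow> bool" where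
  "anchored_convergence p D \<mu> \<nu> \<longleftrightarrow>
     (\<forall>l. (\<forall>i. i \<noteq> p \<longrightarrow> l i \<in> D) \<longrightarrow>
        weak_limit (\<lambda>u. restrict_meas (anchor p l) (\<mu> u)) (restrict_meas (anchor p l) \<nu>) to_infty)"

end

theory Submission
  imports Defs
begin

text \<open>
  Necessity: shift-invariance passes from the stationary pre-limit to the limit because the
  integrals of test functions determine a boundedly finite measure, and the anchors and the sets
  \<open>O\<^sub>n\<close> are continuity sets of the limit, since in every coordinate the scaling measure
  gives no mass to a single level.

  Sufficiency: by stationarity, shift-invariance and the homogeneity of the scaling, convergence on
  the anchors gives convergence for test functions supported on \<open>{f. \<forall>i. \<bar>f\<^sub>i(t\<^sub>i)\<bar> > s\<^sub>i}\<close>. A partition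
  of unity extends this to sets where each coordinate exceeds its level somewhere on a
  finite set of positions. For discrete index groups these exhaust every window. In the Euclidean
  case they increase to \<open>O\<^sub>n\<close> along rational positions, and the upper bound on the mass of \<open>O\<^sub>n\<close>
  controls the remainder.
\<close>

section \<open>The space of continuous fields\<close>

text \<open>A window only says that each coordinate is large somewhere in a compact set, at places
  that may differ between coordinates, whereas a shift moves all coordinates together. Stationarity
  therefore normalises one position only, and the remaining q - 1 lags must be quantified over.
  Levels need no quantifier: the scaling acts on each coordinate separately, and regular variation
  carries any fixed vector of levels to level 1. Restriction to an anchor introduces a discontinuous
  indicator, so necessity needs null boundaries. In sufficiency the integrands are continuous and
  vanish off an anchor, so the indicator disappears and no boundary has to be examined. Over R^m
  finitely many positions see a window O only in part. With continuous 0 <= eta_k <= 1_O supported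
  on what they see, the unseen part of an integral of F is at most sup|F| * (mu_u(O) - integral of
  eta_k), and the integral of eta_k already converges. Only an upper bound for mu_u(O) is missing,
  and it suffices for O = \<open>Owin K n\<close> because every window lies in one of these.\<close>

lemma continuous_on_cfieldI:
  fixes F :: "('t::topological_space, 'q::finite) cfield \<Rightarrow> 'a::metric_space"
  assumes "\<And>f e. e > 0 \<Longrightarrow> \<exists>C d. compact C \<and> d > 0 \<and>
      (\<forall>g. (\<forall>t\<in>C. dist (fval g t) (fval f t) < d) \<longrightarrow> dist (F g) (F f) < e)"
  shows "continuous_on UNIV F"
  unfolding continuous_on_open_vimage[OF open_UNIV]
proof (intro allI impI)
  fix S :: "'a set" assume S: "open S"
  show "open (F -` S \<inter> UNIV)"
    unfolding open_cfield_def
  proof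
    fix f assume "f \<in> F -` S \<inter> UNIV"
    then have "F f \<in> S" by simp
    then obtain e where e: "e > 0" "\<And>y. dist y (F f) < e \<Longrightarrow> y \<in> S"
      using S by (meson open_dist)
    from assms[OF e(1), of f] obtain C d where C: "compact C" "d > 0"
      "\<forall>g. (\<forall>t\<in>C. dist (fval g t) (fval f t) < d) \<longrightarrow> dist (F g) (F f) < e"
      by (elim exE conjE)
    show "\<exists>C e. compact C \<and> e > 0 \<and> {g. \<forall>t\<in>C. dist (fval g t) (fval f t) < e} \<subseteq> F -` S \<inter> UNIV"
    proof (intro exI conjI subsetI)
      fix g assume "g \<in> {g. \<forall>t\<in>C. dist (fval g t) (fval f t) < d}"
      then show "g \<in> F -` S \<inter> UNIV" using C(3) e(2)[of "F g"] by simp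
    qed (fact C)+
  qed
qed

text \<open>The compact set on which the images are compared may differ from the one that controls
  the arguments; shifts need this freedom, since they translate it.\<close>

lemma continuous_on_cfield_endoI:
  fixes F :: "('t::topological_space, 'q::finite) cfield \<Rightarrow> ('s::topological_space, 'q) cfield"
  assumes "\<And>f C e. compact C \<Longrightarrow> e > 0 \<Longrightarrow> \<exists>C' d. compact C' \<and> d > 0 \<and>
      (\<forall>g. (\<forall>t\<in>C'. dist (fval g t) (fval f t) < d) \<longrightarrow>
        (\<forall>t\<in>C. dist (fval (F g) t) (fval (F f) t) < e))"
  shows "continuous_on UNIV F"
  unfolding continuous_on_open_vimage[OF open_UNIV]
proof (intro allI impI)
  fix S :: "('s, 'q) cfield set" assume S: "open S"
  show "open (F -` S \<inter> UNIV)"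
    unfolding open_cfield_def
  proof
    fix f assume "f \<in> F -` S \<inter> UNIV"
    then have "F f \<in> S" by simp
    from S[unfolded open_cfield_def, rule_format, OF this]
    obtain C e where e: "compact C" "e > 0"
      "{g. \<forall>t\<in>C. dist (fval g t) (fval (F f) t) < e} \<subseteq> S"
      by (elim exE conjE)
    from assms[OF e(1,2), of f] obtain C' d where C: "compact C'" "d > 0"
      "\<forall>g. (\<forall>t\<in>C'. dist (fval g t) (fval f t) < d) \<longrightarrow> (\<forall>t\<in>C. dist (fval (F g) t) (fval (F f) t) < e)"
      by (elim exE conjE)
    show "\<exists>C e. compact C \<and> e > 0 \<and> {g. \<forall>t\<in>C. dist (fval g t) (fval f t) < e} \<subseteq> F -` S \<inter> UNIV"
    proof (intro exI conjI subsetI)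
      fix g assume "g \<in> {g. \<forall>t\<in>C'. dist (fval g t) (fval f t) < d}"
      then have "F g \<in> {g. \<forall>t\<in>C. dist (fval g t) (fval (F f) t) < e}" using C(3) by simp
      then show "g \<in> F -` S \<inter> UNIV" using e(3) by (simp add: subset_eq)
    qed (fact C)+
  qed
qed

lemma continuous_on_fval: "continuous_on UNIV (\<lambda>f::('t::topological_space, 'q::finite) cfield. fval f t)"
proof (rule continuous_on_cfieldI)
  fix f :: "('t, 'q) cfield" and e :: real assume "e > 0"
  then show "\<exists>C d. compact C \<and> d > 0 \<and>
      (\<forall>g. (\<forall>t\<in>C. dist (fval g t) (fval f t) < d) \<longrightarrow> dist (fval g t) (fval f t) < e)"
    by (intro exI[of _ "{t}"] exI[of _ e]) auto
qed

lemma continuous_on_fval_nth [continuous_intros]: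
  "continuous_on UNIV (\<lambda>f::('t::topological_space, 'q::finite) cfield. fval f t $ i)"
  by (intro continuous_on_component continuous_on_fval)

lemma fval_scale: "fval (scale r f) t $ i = r $ i * fval f t $ i"
  by transfer simp

lemma fval_shift: "fval (shift h f) t = fval f (t - h)"
  by transfer simp

lemma cfield_eqI: "(\<And>t i. fval f t $ i = fval g t $ i) \<Longrightarrow> f = g"
  by (metis ext fval_inject vec_eq_iff)

lemma scale_scale: "scale r (scale s f) = scale (\<chi> i. r $ i * s $ i) f"
  by (rule cfield_eqI) (simp add: fval_scale mult.assoc)

lemma shift_scale: "shift h (scale r f) = scale r (shift h f)"
  by (rule cfield_eqI) (simp add: fval_scale fval_shift)

lemma continuous_on_scale:
  "continuous_on UNIV (scale r :: ('t::topological_space, 'q::finite) cfield \<Rightarrow> _)"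
proof (rule continuous_on_cfield_endoI)
  fix f :: "('t, 'q) cfield" and C :: "'t set" and e :: real assume C: "compact C" and e: "e > 0"
  \<comment> \<open>A Lipschitz constant in the sup norm over any set of positions; the summand 1
    keeps \<open>e / L\<close> meaningful when r is zero.\<close>
  define L where "L = 1 + (\<Sum>i\<in>UNIV. \<bar>r $ i\<bar>)"
  have L: "L > 0" unfolding L_def by (smt (verit) sum_nonneg abs_ge_zero)
  have "dist (fval (scale r g) t) (fval (scale r f) t) \<le> L * dist (fval g t) (fval f t)" for g t
  proof -
    have "dist (fval (scale r g) t) (fval (scale r f) t)
        = norm (\<chi> i. r $ i * (fval g t $ i - fval f t $ i))"
      unfolding dist_norm by (rule arg_cong[of _ _ norm]) (simp add: vec_eq_iff fval_scale algebra_simps)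
    also have "\<dots> \<le> (\<Sum>i\<in>UNIV. \<bar>r $ i\<bar> * \<bar>fval g t $ i - fval f t $ i\<bar>)"
      by (rule order_trans[OF norm_le_l1_cart]) (simp add: abs_mult)
    also have "\<dots> \<le> (\<Sum>i\<in>UNIV. \<bar>r $ i\<bar> * dist (fval g t) (fval f t))"
      by (intro sum_mono mult_left_mono)
        (simp_all add: dist_norm flip: vector_minus_component, metis component_le_norm_cart)
    also have "\<dots> \<le> L * dist (fval g t) (fval f t)"
      unfolding L_def by (simp add: sum_distrib_right[symmetric] distrib_right)
    finally show ?thesis .
  qed
  then show "\<exists>C' d. compact C' \<and> d > 0 \<and>
      (\<forall>g. (\<forall>t\<in>C'. dist (fval g t) (fval f t) < d) \<longrightarrow>
        (\<forall>t\<in>C. dist (fval (scale r g) t) (fval (scale r f) t) < e))"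
    using C e L
    by (intro exI[of _ C] exI[of _ "e / L"])
       (auto simp: field_simps intro: le_less_trans)
qed

lemma continuous_on_shift:
  "continuous_on UNIV (shift h :: ('t::topological_ab_group_add, 'q::finite) cfield \<Rightarrow> _)"
proof (rule continuous_on_cfield_endoI)
  fix f :: "('t, 'q) cfield" and C :: "'t set" and e :: real assume C: "compact C" and e: "e > 0"
  have "compact ((\<lambda>t. t - h) ` C)"
    using C by (intro compact_continuous_image continuous_intros)
  then show "\<exists>C' d. compact C' \<and> d > 0 \<and>
      (\<forall>g. (\<forall>t\<in>C'. dist (fval g t) (fval f t) < d) \<longrightarrow>
        (\<forall>t\<in>C. dist (fval (shift h g) t) (fval (shift h f) t) < e))"
    using e by (intro exI[of _ "(\<lambda>t. t - h) ` C"] exI[of _ e]) (auto simp: fval_shift)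
qed

text \<open>An open set \<open>U\<close> of fields is the union of those sets contained in it which are given by
  finitely many conditions \<open>dist (fval g s) v \<le> \<epsilon>\<close> for all \<open>s \<in> D \<inter> V\<close>, with \<open>V\<close> in a countable basis,
  \<open>D\<close> countable and dense, \<open>v\<close> in a countable dense set and \<open>\<epsilon>\<close> rational. There are
  only countably many of them.\<close>

lemma borel_measurable_cfieldI:
  fixes G :: "'a \<Rightarrow> ('t::topological_space, 'q::finite) cfield"
  assumes sc: "\<exists>B::'t set set. countable B \<and> topological_basis B"
    and G: "\<And>t. (\<lambda>x. fval (G x) t) \<in> borel_measurable M"
  shows "G \<in> borel_measurable M"
proof (rule borel_measurableI)
  fix U :: "('t, 'q) cfield set" assume U: "open U"
  obtain B :: "'t set set" where B: "countable B" "topological_basis B" using sc by blast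
  \<comment> \<open>One point from each basic open set gives a countable dense set. If the empty set
    is in \<open>B\<close>, its arbitrary point does no harm.\<close>
  define D where "D = (\<lambda>V. SOME x. x \<in> V) ` B"
  have cD: "countable D" unfolding D_def using B(1) by simp
  have dense: "\<exists>x\<in>D. x \<in> W" if W: "open W" "W \<noteq> {}" for W
  proof -
    obtain x where "x \<in> W" using W(2) by blast
    then obtain V where V: "V \<in> B" "x \<in> V" "V \<subseteq> W"
      using topological_basisE[OF B(2) W(1)] by metis
    then have "(SOME x. x \<in> V) \<in> V" by (metis someI)
    then show ?thesis using V unfolding D_def by blast
  qed
  obtain R :: "(real ^ 'q) set" where R: "countable R"
    "\<And>X. open X \<Longrightarrow> X \<noteq> {} \<Longrightarrow> \<exists>d\<in>R. d \<in> X"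
    by (metis countable_dense_exists)
  define Q where "Q = B \<times> R \<times> (\<rat> :: real set)"
  have Q: "countable Q" unfolding Q_def
    using B(1) R(1) countable_rat by (intro countable_SIGMA) auto
  define box where "box = (\<lambda>(V, v, \<epsilon>). {g :: ('t, 'q) cfield. \<forall>s\<in>D \<inter> V. dist (fval g s) v \<le> (\<epsilon>::real)})"
  define \<S> where "\<S> = {S. finite S \<and> S \<subseteq> Q \<and> (\<Inter>s\<in>S. box s) \<subseteq> U}"
  have cS: "countable \<S>"
    by (rule countable_subset[OF _ countable_Collect_finite_subset[OF Q]]) (auto simp: \<S>_def)
  have "U = (\<Union>S\<in>\<S>. \<Inter>s\<in>S. box s)"
  proof (intro equalityI subsetI)
    fix f assume "f \<in> U"
    from U[unfolded open_cfield_def, rule_format, OF this]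
    obtain C e where C: "compact C" "e > 0" "{g. \<forall>t\<in>C. dist (fval g t) (fval f t) < e} \<subseteq> U"
      by (elim exE conjE)
    have cf: "continuous_on UNIV (fval f)" using fval[of f] by simp
    \<comment> \<open>Half of e, because f and g are compared through the common centre
      \<open>v t'\<close>, each at distance at most \<epsilon> from it.\<close>
    obtain \<epsilon> where \<epsilon>: "\<epsilon> \<in> \<rat>" "0 < \<epsilon>" "\<epsilon> < e / 2"
      using Rats_dense_in_real[of 0 "e / 2"] C(2) by auto
    have "\<exists>V v. V \<in> B \<and> v \<in> R \<and> t \<in> V \<and> (\<forall>s\<in>V. dist (fval f s) v \<le> \<epsilon>)" for t
    proof -
      obtain v where v: "v \<in> R" "v \<in> ball (fval f t) \<epsilon>"
        using R(2)[of "ball (fval f t) \<epsilon>"] \<epsilon> by auto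
      have "open (fval f -` ball v \<epsilon>)"
        using cf by (rule open_vimage[OF open_ball])
      moreover have "t \<in> fval f -` ball v \<epsilon>" using v by (simp add: dist_commute)
      ultimately obtain V where "V \<in> B" "t \<in> V" "V \<subseteq> fval f -` ball v \<epsilon>"
        using topological_basisE[OF B(2)] by metis
      moreover from this(3) have "\<forall>s\<in>V. dist (fval f s) v \<le> \<epsilon>"
        by (force simp: dist_commute subset_eq)
      ultimately show ?thesis using v(1) by blast
    qed
    then obtain V v where V: "\<And>t. V t \<in> B" "\<And>t. v t \<in> R" "\<And>t. t \<in> V t"
      "\<And>t s. s \<in> V t \<Longrightarrow> dist (fval f s) (v t) \<le> \<epsilon>"
      by metis
    have oV: "open (V t)" for t using topological_basis_open[OF B(2) V(1)] .
    obtain T where T: "T \<subseteq> C" "finite T" "C \<subseteq> (\<Union>t\<in>T. V t)"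
      using compactE_image[OF C(1), of C V] oV V(3) by blast
    define S where "S = (\<lambda>t. (V t, v t, \<epsilon>)) ` T"
    have "f \<in> (\<Inter>s\<in>S. box s)" using V(4) unfolding S_def box_def by auto
    moreover have "(\<Inter>s\<in>S. box s) \<subseteq> U"
    proof
      fix g assume g: "g \<in> (\<Inter>s\<in>S. box s)"
      have cg: "continuous_on UNIV (fval g)" using fval[of g] by simp
      have "dist (fval g t) (fval f t) < e" if t: "t \<in> C" for t
      proof -
        obtain t' where t': "t' \<in> T" "t \<in> V t'" using T(3) t by blast
        have gD: "dist (fval g s) (v t') \<le> \<epsilon>" if "s \<in> D \<inter> V t'" for s
          using g t'(1) that unfolding S_def box_def by auto
        \<comment> \<open>The conditions defining \<open>box\<close> are imposed on \<open>D\<close>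
          only. Continuity extends them to all of \<open>V t'\<close>: the points violating the
          closed condition form an open set, which would meet \<open>D\<close>.\<close>
        have "dist (fval g t) (v t') \<le> \<epsilon>"
        proof (rule ccontr)
          assume "\<not> ?thesis"
          then have "t \<in> V t' \<inter> fval g -` (- cball (v t') \<epsilon>)"
            using t'(2) by (simp add: dist_commute)
          moreover have "open (V t' \<inter> fval g -` (- cball (v t') \<epsilon>))"
            by (intro open_Int oV open_vimage[OF _ cg]) (simp add: open_Compl)
          ultimately obtain s where "s \<in> D" "s \<in> V t' \<inter> fval g -` (- cball (v t') \<epsilon>)"
            using dense by blast
          then show False using gD[of s] by (auto simp: dist_commute)
        qed
        moreover have "dist (fval f t) (v t') \<le> \<epsilon>" by (rule V(4)[OF t'(2)])
        ultimately show ?thesis using \<epsilon>(3) dist_triangle2[of "fval g t" "fval f t" "v t'"] by linarith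
      qed
      then show "g \<in> U" using C(3) by blast
    qed
    moreover have "finite S" "S \<subseteq> Q" using T(2) V(1,2) \<epsilon>(1) unfolding S_def Q_def by auto
    ultimately show "f \<in> (\<Union>S\<in>\<S>. \<Inter>s\<in>S. box s)" unfolding \<S>_def by blast
  qed (auto simp: \<S>_def)
  then have eq: "G -` U \<inter> space M = (\<Union>S\<in>\<S>. {x\<in>space M. \<forall>s\<in>S. G x \<in> box s})" by auto
  have "{x\<in>space M. G x \<in> box s} \<in> sets M" for s
  proof (cases s)
    case (fields V v \<epsilon>)
    have "{x\<in>space M. dist (fval (G x) t) v \<le> \<epsilon>} \<in> sets M" for t
      using G[of t] by measurable
    then have "{x\<in>space M. \<forall>t\<in>D \<inter> V. dist (fval (G x) t) v \<le> \<epsilon>} \<in> sets M"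
      using cD by (intro sets.sets_Collect_countable_All') simp_all
    then show ?thesis unfolding box_def fields by simp
  qed
  then have "{x\<in>space M. \<forall>s\<in>S. G x \<in> box s} \<in> sets M" if "S \<in> \<S>" for S
    using that unfolding \<S>_def by (intro sets.sets_Collect_countable_All') (simp_all add: countable_finite)
  then show "G -` U \<inter> space M \<in> sets M"
    unfolding eq using cS by (intro sets.countable_UN'') simp_all
qed

lemma borel_measurable_fval [measurable]:
  "(\<lambda>f. fval f t) \<in> borel_measurable borel"
  by (rule borel_measurable_continuous_onI[OF continuous_on_fval])

lemma borel_measurable_scale [measurable]:
  "scale r \<in> borel_measurable borel"
  by (rule borel_measurable_continuous_onI[OF continuous_on_scale])

lemma borel_measurable_shift [measurable]:
  "shift h \<in> borel_measurable borel"
  by (rule borel_measurable_continuous_onI[OF continuous_on_shift])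

section \<open>The scaling measure\<close>

lemma Basis_vec_real: "(Basis :: (real ^ 'q::finite) set) = range (\<lambda>i. axis i 1)"
  by (auto simp: Basis_vec_def)

lemma prod_Basis_vec:
  "(\<Prod>b\<in>(Basis :: (real ^ 'q::finite) set). f b) = (\<Prod>i\<in>UNIV. f (axis i 1))"
  unfolding Basis_vec_real by (subst prod.reindex) (auto simp: inj_on_def axis_eq_axis)

lemma sum_Basis_vec:
  "(\<Sum>b\<in>(Basis :: (real ^ 'q::finite) set). f b) = (\<Sum>i\<in>UNIV. f (axis i 1))"
  unfolding Basis_vec_real by (subst sum.reindex) (auto simp: inj_on_def axis_eq_axis)

lemma borel_measurable_nth [measurable]: "(\<lambda>r::real ^ 'q::finite. r $ i) \<in> borel_measurable borel"
  by (intro borel_measurable_continuous_onI continuous_intros)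

lemma posG_borel [measurable]: "(posG :: (real ^ 'q::finite) set) \<in> sets borel"
proof -
  have "posG = (\<Inter>i. {r :: real ^ 'q. 0 < r $ i})" by (auto simp: posG_def)
  also have "\<dots> \<in> sets borel" by (intro sets.finite_INT) auto
  finally show ?thesis .
qed

definition theta_density :: "real ^ 'q \<Rightarrow> real ^ 'q::finite \<Rightarrow> ennreal" where
  "theta_density \<alpha> r = indicator posG r * (\<Prod>i\<in>UNIV. ennreal (\<alpha> $ i * (r $ i) powr (- \<alpha> $ i - 1)))"

lemma theta_density_borel [measurable]: "theta_density \<alpha> \<in> borel_measurable borel"
  unfolding theta_density_def by measurable

lemma theta_eq: "theta \<alpha> = density lborel (theta_density \<alpha>)"
  unfolding theta_def theta_density_def ..

lemma sets_theta [measurable_cong, simp]: "sets (theta \<alpha>) = sets borel"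
  unfolding theta_eq by simp

lemma space_theta [simp]: "space (theta \<alpha>) = UNIV"
  unfolding theta_eq by simp

lemma theta_density_finite: "theta_density \<alpha> r \<noteq> \<infinity>"
  unfolding theta_density_def by (auto simp: ennreal_mult_eq_top_iff ennreal_prod_eq_top indicator_def)

text \<open>A density with finite values relative to Lebesgue measure is enough. This is what
  permits Fubini in the representation of \<open>nuZ\<close>.\<close>

lemma sigma_finite_theta: "sigma_finite_measure (theta \<alpha>)"
  unfolding theta_eq
  by (subst sigma_finite_measure.sigma_finite_iff_density_finite[OF sigma_finite_lborel])
    (auto simp: theta_density_finite[simplified])

lemma AE_theta_posG: "AE r in theta \<alpha>. r \<in> posG"
  unfolding theta_eq by (subst AE_density) (auto simp: theta_density_def indicator_def)

text \<open>For nonzero c the exceptional set is a hyperplane, null for Lebesgue measure and hence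
  for \<open>theta\<close>; for c = 0 it is empty because s is nonzero. Applied with c the size of a
  fixed field, it makes level sets null under \<open>nuZ\<close>.\<close>

lemma AE_theta_hyperplane:
  fixes \<alpha> :: "real ^ 'q::finite"
  assumes "s \<noteq> 0"
  shows "AE r in theta \<alpha>. r $ i * c \<noteq> s"
proof -
  have "AE r in lborel. r $ i * c \<noteq> s"
  proof (cases "c = 0")
    case False
    have "AE r in lborel. r \<notin> {x :: real ^ 'q. axis i 1 \<bullet> x = s / c}"
      using negligible_hyperplane[of "axis i 1 :: real ^ 'q" "s / c"]
      by (intro AE_not_in)
        (simp add: negligible_iff_null_sets axis_eq_0_iff null_sets_completion_iff closed_hyperplane[THEN borel_closed])
    then show ?thesis
      by eventually_elim (use False in \<open>auto simp: inner_axis' field_simps\<close>)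
  qed (use assms in auto)
  then show ?thesis unfolding theta_eq by (subst AE_density) auto
qed

text \<open>Change of variables under a diagonal linear map: the Jacobian supplies s_i and the
  density s_i^(-\<alpha>_i - 1), which leaves the factor s_i^(-\<alpha>_i) to be compensated in each
  coordinate.\<close>

lemma nn_integral_theta_scale:
  fixes s \<alpha> :: "real ^ 'q::finite"
  assumes s: "s \<in> posG" and [measurable]: "h \<in> borel_measurable borel"
  shows "(\<integral>\<^sup>+r. h (\<chi> i. s $ i * r $ i) \<partial>theta \<alpha>)
    = ennreal (\<Prod>i\<in>UNIV. s $ i powr \<alpha> $ i) * (\<integral>\<^sup>+r. h r \<partial>theta \<alpha>)"
proof -
  define T :: "real ^ 'q \<Rightarrow> real ^ 'q" where "T r = (\<chi> i. s $ i * r $ i)" for r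
  have pos: "s $ i > 0" for i using s by (simp add: posG_def)
  have [measurable]: "T \<in> borel_measurable borel"
    unfolding T_def by (intro borel_measurable_continuous_onI continuous_intros)
  have Teq: "T = (\<lambda>x. 0 + (\<Sum>j\<in>Basis. ((s \<bullet> j) * (x \<bullet> j)) *\<^sub>R j))"
    by (rule ext, simp add: T_def sum_Basis_vec inner_axis vec_eq_iff)
      (simp add: axis_def if_distrib cong: if_cong)
  \<comment> \<open>Lebesgue measure written as the Jacobian times its own image under
    \<open>T\<close>, so that one substitution performs the change of variables.\<close>
  have lb: "lborel = density (distr lborel borel T) (\<lambda>_. ennreal (\<Prod>i\<in>UNIV. s $ i))"
  proof -
    have "s \<bullet> j \<noteq> 0" if "j \<in> Basis" for j
      using that by (auto simp: Basis_vec_real inner_axis pos[THEN less_imp_neq, symmetric])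
    from lborel_affine_euclidean[of "\<lambda>j. s \<bullet> j" 0, OF this] show ?thesis
      using pos unfolding Teq prod_Basis_vec by (simp add: inner_axis abs_of_pos)
  qed
  define C where "C = (\<Prod>i\<in>UNIV. s $ i powr \<alpha> $ i)"
  have dens: "theta_density \<alpha> (T r) * ennreal (\<Prod>i\<in>UNIV. s $ i) * ennreal C = theta_density \<alpha> r" for r
  proof (cases "r \<in> posG")
    case False
    then have "T r \<notin> posG" using pos by (auto simp: posG_def T_def zero_less_mult_iff not_less_iff_gr_or_eq less_asym)
    then show ?thesis using False by (simp add: theta_density_def)
  next
    case True
    then have r: "r $ i > 0" for i by (simp add: posG_def)
    then have "T r \<in> posG" using pos by (auto simp: posG_def T_def)
    then have "theta_density \<alpha> (T r) * ennreal (\<Prod>i\<in>UNIV. s $ i) * ennreal C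
        = (\<Prod>i\<in>UNIV. ennreal (\<alpha> $ i * (s $ i * r $ i) powr (- \<alpha> $ i - 1)) * ennreal (s $ i) * ennreal (s $ i powr \<alpha> $ i))"
      unfolding theta_density_def C_def T_def using pos
      by (simp add: prod.distrib prod_ennreal less_imp_le)
    also have "\<dots> = (\<Prod>i\<in>UNIV. ennreal (\<alpha> $ i * (r $ i) powr (- \<alpha> $ i - 1)))"
    proof (rule prod.cong[OF refl])
      fix i
      have "\<alpha> $ i * (s $ i * r $ i) powr (- \<alpha> $ i - 1) * s $ i * s $ i powr \<alpha> $ i
          = \<alpha> $ i * (r $ i) powr (- \<alpha> $ i - 1) * (s $ i powr (- \<alpha> $ i - 1) * s $ i powr 1 * s $ i powr \<alpha> $ i)"
        using pos[of i] r[of i] by (simp add: powr_mult)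
      also have "s $ i powr (- \<alpha> $ i - 1) * s $ i powr 1 * s $ i powr \<alpha> $ i = 1"
        unfolding powr_add[symmetric] using pos[of i] by simp
      finally have eq: "\<alpha> $ i * (s $ i * r $ i) powr (- \<alpha> $ i - 1) * s $ i * s $ i powr \<alpha> $ i
          = \<alpha> $ i * (r $ i) powr (- \<alpha> $ i - 1)"
        by (simp only: mult_1_right)
      show "ennreal (\<alpha> $ i * (s $ i * r $ i) powr (- \<alpha> $ i - 1)) * ennreal (s $ i) * ennreal (s $ i powr \<alpha> $ i)
          = ennreal (\<alpha> $ i * (r $ i) powr (- \<alpha> $ i - 1))"
        unfolding eq[symmetric] using pos[of i] by (simp add: ennreal_mult'')
    qed
    finally show ?thesis using True by (simp add: theta_density_def)
  qed
  have "(\<integral>\<^sup>+r. h r \<partial>theta \<alpha>) = (\<integral>\<^sup>+r. theta_density \<alpha> r * h r \<partial>lborel)"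
    unfolding theta_eq by (subst nn_integral_density) auto
  also have "\<dots> = (\<integral>\<^sup>+r. ennreal (\<Prod>i\<in>UNIV. s $ i) * (theta_density \<alpha> (T r) * h (T r)) \<partial>lborel)"
    by (subst lb) (simp add: nn_integral_density nn_integral_distr)
  finally have "ennreal C * (\<integral>\<^sup>+r. h r \<partial>theta \<alpha>)
     = (\<integral>\<^sup>+r. ennreal C * (ennreal (\<Prod>i\<in>UNIV. s $ i) * (theta_density \<alpha> (T r) * h (T r))) \<partial>lborel)"
    by (simp add: nn_integral_cmult)
  also have "\<dots> = (\<integral>\<^sup>+r. theta_density \<alpha> r * h (T r) \<partial>lborel)"
  proof (rule nn_integral_cong)
    fix r
    have "ennreal C * (ennreal (\<Prod>i\<in>UNIV. s $ i) * (theta_density \<alpha> (T r) * h (T r)))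
        = theta_density \<alpha> (T r) * ennreal (\<Prod>i\<in>UNIV. s $ i) * ennreal C * h (T r)"
      by (simp only: mult_ac)
    then show "ennreal C * (ennreal (\<Prod>i\<in>UNIV. s $ i) * (theta_density \<alpha> (T r) * h (T r)))
        = theta_density \<alpha> r * h (T r)"
      unfolding dens .
  qed
  also have "\<dots> = (\<integral>\<^sup>+r. h (T r) \<partial>theta \<alpha>)"
    unfolding theta_eq by (subst nn_integral_density) auto
  finally show ?thesis unfolding T_def C_def by simp
qed

lemma nn_integral_pareto:
  fixes a c :: real
  assumes "a > 0" "c > 0"
  shows "(\<integral>\<^sup>+x. ennreal (a * x powr (- a - 1)) * indicator {c..} x \<partial>lborel) = ennreal (c powr - a)"
proof -
  have "(\<integral>\<^sup>+x. ennreal (a * x powr (- a - 1)) * indicator {c..} x \<partial>lborel) = ennreal (0 - (- (c powr - a)))"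
  proof (rule nn_integral_FTC_atLeast)
    fix x assume "c \<le> x"
    then show "((\<lambda>x. - (x powr - a)) has_real_derivative a * x powr (- a - 1)) (at x)"
      using assms by (auto intro!: derivative_eq_intros)
    show "0 \<le> a * x powr (- a - 1)" using assms by simp
  next
    show "((\<lambda>x. - (x powr - a)) \<longlongrightarrow> 0) at_top"
      using tendsto_minus[OF tendsto_neg_powr[OF _ filterlim_ident, of "- a"]] assms by simp
  qed measurable
  then show ?thesis by simp
qed

text \<open>An orthant with positive corner is a product set, so its mass is a product of
  one-dimensional Pareto tails.\<close>

lemma emeasure_theta_tail:
  fixes \<alpha> c :: "real ^ 'q::finite"
  assumes a: "\<And>i. \<alpha> $ i > 0" and c: "c \<in> posG"
  shows "emeasure (theta \<alpha>) {r. \<forall>i. c $ i \<le> r $ i} = ennreal (\<Prod>i\<in>UNIV. c $ i powr - \<alpha> $ i)"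
proof -
  have c: "c $ i > 0" for i using c by (simp add: posG_def)
  have [measurable]: "{r :: real ^ 'q. \<forall>i. c $ i \<le> r $ i} \<in> sets borel"
  proof -
    have "{r :: real ^ 'q. \<forall>i. c $ i \<le> r $ i} = (\<Inter>i. {r. c $ i \<le> r $ i})" by auto
    also have "\<dots> \<in> sets borel" by (intro sets.finite_INT) auto
    finally show ?thesis .
  qed
  \<comment> \<open>The indicator of the orthant is distributed over the factors. Since c is
    positive, these indicators also account for the one of \<open>posG\<close>.\<close>
  define f :: "real ^ 'q \<Rightarrow> real \<Rightarrow> real" where
    "f b x = (\<alpha> \<bullet> b) * x powr (- (\<alpha> \<bullet> b) - 1) * indicator {c \<bullet> b..} x" for b x
  have a': "\<alpha> \<bullet> b > 0" and c': "c \<bullet> b > 0" if "b \<in> Basis" for b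
    using that a c by (auto simp: Basis_vec_real inner_axis)
  have "emeasure (theta \<alpha>) {r. \<forall>i. c $ i \<le> r $ i}
      = (\<integral>\<^sup>+r. theta_density \<alpha> r * indicator {r. \<forall>i. c $ i \<le> r $ i} r \<partial>lborel)"
    unfolding theta_eq by (subst emeasure_density) auto
  also have "\<dots> = (\<integral>\<^sup>+r. (\<Prod>b\<in>Basis. ennreal (f b (r \<bullet> b))) \<partial>lborel)"
  proof (rule nn_integral_cong)
    fix r :: "real ^ 'q"
    show "theta_density \<alpha> r * indicator {r. \<forall>i. c $ i \<le> r $ i} r = (\<Prod>b\<in>Basis. ennreal (f b (r \<bullet> b)))"
    proof (cases "\<forall>i. c $ i \<le> r $ i")
      case True
      then have "r \<in> posG" using c by (auto simp: posG_def intro: less_le_trans)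
      then show ?thesis using True
        by (simp add: theta_density_def f_def prod_Basis_vec inner_axis)
    next
      case False
      then obtain i where "\<not> c $ i \<le> r $ i" by blast
      then have "ennreal (f (axis i 1) (r \<bullet> axis i 1)) = 0" by (simp add: f_def inner_axis)
      then have "(\<Prod>b\<in>Basis. ennreal (f b (r \<bullet> b))) = 0"
        unfolding prod_Basis_vec by (intro prod_zero) auto
      then show ?thesis using False by simp
    qed
  qed
  also have "\<dots> = (\<Prod>b\<in>Basis. \<integral>\<^sup>+x. ennreal (f b x) \<partial>lborel)"
    by (rule nn_integral_lborel_prod) (auto simp: f_def)
  also have "\<dots> = (\<Prod>b\<in>Basis. ennreal ((c \<bullet> b) powr - (\<alpha> \<bullet> b)))"
  proof (rule prod.cong[OF refl])
    fix b :: "real ^ 'q" assume "b \<in> Basis"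
    then have "(\<integral>\<^sup>+x. ennreal (f b x) \<partial>lborel)
        = (\<integral>\<^sup>+x. ennreal ((\<alpha> \<bullet> b) * x powr (- (\<alpha> \<bullet> b) - 1)) * indicator {c \<bullet> b..} x \<partial>lborel)"
      by (intro nn_integral_cong) (simp add: f_def indicator_def)
    then show "(\<integral>\<^sup>+x. ennreal (f b x) \<partial>lborel) = ennreal ((c \<bullet> b) powr - (\<alpha> \<bullet> b))"
      using nn_integral_pareto[OF a' c'] \<open>b \<in> Basis\<close> by simp
  qed
  also have "\<dots> = ennreal (\<Prod>i\<in>UNIV. c $ i powr - \<alpha> $ i)"
    by (simp add: prod_Basis_vec inner_axis prod_ennreal)
  finally show ?thesis .
qed

section \<open>Windows and test functions\<close>

text \<open>The common ground of the two kinds of index group. A countable basis is what reduces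
  measurability of a field to measurability of its evaluations.\<close>

locale index_space =
  fixes K :: "nat \<Rightarrow> 't::topological_ab_group_add set"
  assumes exhaustion: "exhaustion K"
    and second_countable: "\<exists>B::'t set set. countable B \<and> topological_basis B"
begin

lemma K_compact: "n \<ge> 1 \<Longrightarrow> compact (K n)"
  and K_nonempty: "n \<ge> 1 \<Longrightarrow> K n \<noteq> {}"
  and K_mono: "1 \<le> m \<Longrightarrow> m \<le> n \<Longrightarrow> K m \<subseteq> K n"
  and K_absorbs: "compact C \<Longrightarrow> \<exists>n\<ge>1. C \<subseteq> K n"
  using exhaustion unfolding exhaustion_def by simp_all

lemma bdd_above_K:
  fixes f :: "('t, 'q::finite) cfield"
  assumes "n \<ge> 1"
  shows "bdd_above ((\<lambda>t. \<bar>fval f t $ i\<bar>) ` K n)"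
proof -
  have "continuous_on (K n) (fval f)" using fval[of f] by (auto intro: continuous_on_subset)
  then have "compact ((\<lambda>t. \<bar>fval f t $ i\<bar>) ` K n)"
    using K_compact[OF assms] by (intro compact_continuous_image continuous_intros)
  then show ?thesis by (intro bounded_imp_bdd_above compact_imp_bounded)
qed

lemma rho_ge: "n \<ge> 1 \<Longrightarrow> t \<in> K n \<Longrightarrow> \<bar>fval f t $ i\<bar> \<le> rho K n i f"
  unfolding rho_def by (rule cSUP_upper[OF _ bdd_above_K])

lemma rho_le: "n \<ge> 1 \<Longrightarrow> (\<And>t. t \<in> K n \<Longrightarrow> \<bar>fval f t $ i\<bar> \<le> c) \<Longrightarrow> rho K n i f \<le> c"
  unfolding rho_def by (rule cSUP_least[OF K_nonempty])

text \<open>Strictness makes this an equivalence without any appeal to attainment of the supremum.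
  It translates windows into the existence of positions with large values, the form in which anchors
  can act.\<close>

lemma less_rho_iff: "n \<ge> 1 \<Longrightarrow> c < rho K n i f \<longleftrightarrow> (\<exists>t\<in>K n. c < \<bar>fval f t $ i\<bar>)"
  using rho_le[of n f i c] rho_ge[of n _ f i] by (force simp: not_le[symmetric])

lemma rho_nonneg: "n \<ge> 1 \<Longrightarrow> 0 \<le> rho K n i f"
  using K_nonempty[of n] rho_ge[of n _ f i] by (force intro: order_trans[OF abs_ge_zero])

lemma rho_mono: "1 \<le> m \<Longrightarrow> m \<le> n \<Longrightarrow> rho K m i f \<le> rho K n i f"
  using K_mono[of m n] by (intro rho_le) (auto intro!: rho_ge)

lemma rho_scale:
  assumes "n \<ge> 1" "r $ i > 0"
  shows "rho K n i (scale r f) = r $ i * rho K n i f"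
proof (rule antisym)
  show "rho K n i (scale r f) \<le> r $ i * rho K n i f"
    using assms by (intro rho_le) (simp_all add: fval_scale abs_mult rho_ge)
  have "rho K n i f \<le> rho K n i (scale r f) / r $ i"
    using assms rho_ge[OF assms(1), of _ "scale r f" i]
    by (intro rho_le) (auto simp: fval_scale abs_mult field_simps)
  then show "r $ i * rho K n i f \<le> rho K n i (scale r f)"
    using assms by (simp add: field_simps)
qed

lemma continuous_on_rho [continuous_intros]:
  fixes i :: "'q::finite"
  assumes n: "n \<ge> 1"
  shows "continuous_on UNIV (rho K n i)"
proof (rule continuous_on_cfieldI)
  fix f :: "('t, 'q) cfield" and e :: real assume e: "e > 0"
  \<comment> \<open>The supremum yields only a weak inequality, so half of e is used to end with a
    strict one.\<close>
  have *: "rho K n i g \<le> rho K n i h + e / 2" if "\<forall>t\<in>K n. dist (fval g t) (fval h t) < e / 2"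
    for g h :: "('t, 'q) cfield"
  proof (rule rho_le[OF n])
    fix t assume t: "t \<in> K n"
    have "\<bar>fval g t $ i - fval h t $ i\<bar> \<le> dist (fval g t) (fval h t)"
      unfolding dist_norm by (metis component_le_norm_cart vector_minus_component)
    then show "\<bar>fval g t $ i\<bar> \<le> rho K n i h + e / 2"
      using that t rho_ge[OF n t, of h i] by fastforce
  qed
  show "\<exists>C d. compact C \<and> d > 0 \<and>
      (\<forall>g. (\<forall>t\<in>C. dist (fval g t) (fval f t) < d) \<longrightarrow> dist (rho K n i g) (rho K n i f) < e)"
  proof (intro exI conjI allI impI)
    fix g assume "\<forall>t\<in>K n. dist (fval g t) (fval f t) < e / 2"
    then have "rho K n i g \<le> rho K n i f + e / 2" "rho K n i f \<le> rho K n i g + e / 2"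
      by (auto intro!: * simp: dist_commute)
    then show "dist (rho K n i g) (rho K n i f) < e" using e by (auto simp: dist_real_def)
  qed (use e K_compact[OF n] in auto)
qed

lemma borel_measurable_rho [measurable]: "n \<ge> 1 \<Longrightarrow> rho K n i \<in> borel_measurable borel"
  by (rule borel_measurable_continuous_onI[OF continuous_on_rho])

text \<open>The translate of \<open>K n\<close> by -h is compact and therefore inside some
  \<open>K m\<close>. Hence shifting a field can only enlarge the windows that contain it, and test
  functions stay test functions under shifts.\<close>

lemma ex_rho_shift_le:
  assumes n: "n \<ge> 1"
  shows "\<exists>m\<ge>1. \<forall>i (f :: ('t, 'q::finite) cfield). rho K n i (shift h f) \<le> rho K m i f"
proof -
  have "compact ((\<lambda>t. t - h) ` K n)"
    using K_compact[OF n] by (intro compact_continuous_image continuous_intros)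
  then obtain m where m: "m \<ge> 1" "(\<lambda>t. t - h) ` K n \<subseteq> K m" using K_absorbs by blast
  then have "rho K n i (shift h f) \<le> rho K m i f" for i :: 'q and f
    by (intro rho_le[OF n]) (auto simp: fval_shift intro!: rho_ge)
  then show ?thesis using m(1) by blast
qed

lemma CPi_iff: "f \<in> CPi \<longleftrightarrow> (\<forall>i. \<exists>n\<ge>1. 0 < rho K n i f)"
proof -
  have "(\<exists>t. fval f t $ i \<noteq> 0) \<longleftrightarrow> (\<exists>n\<ge>1. 0 < rho K n i f)" for i
  proof
    assume "\<exists>t. fval f t $ i \<noteq> 0"
    then obtain t where t: "fval f t $ i \<noteq> 0" ..
    obtain n where n: "n \<ge> 1" "{t} \<subseteq> K n" using K_absorbs[OF compact_sing] by blast
    then have "0 < rho K n i f" using t unfolding less_rho_iff[OF n(1)] by (intro bexI[of _ t]) auto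
    then show "\<exists>n\<ge>1. 0 < rho K n i f" using n(1) by blast
  next
    assume "\<exists>n\<ge>1. 0 < rho K n i f"
    then obtain n where n: "n \<ge> 1" "0 < rho K n i f" by blast
    then show "\<exists>t. fval f t $ i \<noteq> 0" unfolding less_rho_iff[OF n(1)] by auto
  qed
  then show ?thesis by (simp add: CPi_def)
qed

lemma CPi_borel [measurable]: "(CPi :: ('t, 'q::finite) cfield set) \<in> sets borel"
proof -
  have "CPi = (\<Inter>i. \<Union>n\<in>{1..}. {f :: ('t, 'q) cfield. 0 < rho K n i f})"
    unfolding set_eq_iff by (simp add: CPi_iff Bex_def)
  also have "\<dots> \<in> sets borel"
    by (intro sets.finite_INT sets.countable_UN'') simp_all
  finally show ?thesis .
qed

lemma CPi_scale: "r \<in> posG \<Longrightarrow> scale r f \<in> CPi \<longleftrightarrow> f \<in> CPi"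
  by (auto simp: CPi_def fval_scale posG_def less_imp_neq[symmetric])

lemma CPi_shift: "shift h f \<in> CPi \<longleftrightarrow> f \<in> (CPi :: ('t, 'q::finite) cfield set)"
  proof -
  have "(\<exists>t. fval f (t - h) $ i \<noteq> 0) \<longleftrightarrow> (\<exists>t. fval f t $ i \<noteq> 0)" for i
    by (rule iffI; elim exE) (blast, rule_tac x = "t + h" in exI, simp)
  then show ?thesis by (simp add: CPi_def fval_shift)
qed

lemma Uwin_borel [measurable]:
  assumes "\<forall>i. n i \<ge> 1"
  shows "(Uwin K n e :: ('t, 'q::finite) cfield set) \<in> sets borel"
proof -
  have "Uwin K n e = (\<Inter>i. {f :: ('t, 'q) cfield. e $ i < rho K (n i) i f})"
    by (auto simp: Uwin_def)
  also have "\<dots> \<in> sets borel" using assms by (intro sets.finite_INT) auto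
  finally show ?thesis .
qed

lemma Uwin_subset_CPi:
  fixes n :: "'q::finite \<Rightarrow> nat"
  shows "\<forall>i. n i \<ge> 1 \<Longrightarrow> e \<in> posG \<Longrightarrow> Uwin K n e \<subseteq> CPi"
  unfolding Uwin_def posG_def
proof (safe, unfold CPi_iff, safe)
  fix f :: "('t, 'q) cfield" and i
  assume "\<forall>i. 1 \<le> n i" "\<forall>i. 0 < e $ i" "\<forall>i. e $ i < rho K (n i) i f"
  then have "1 \<le> n i" "0 < rho K (n i) i f" using less_trans[of 0 "e $ i" "rho K (n i) i f"] by simp_all
  then show "\<exists>n\<ge>1. 0 < rho K n i f" by blast
qed

lemma Owin_eq: "n \<ge> 1 \<Longrightarrow> Owin K n = Uwin K (\<lambda>_. n) (\<chi> i. 1 / real n)"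
  by (auto simp: Owin_def Uwin_def)

text \<open>The sets \<open>Owin K N\<close> are cofinal among the windows, so control of their
  masses is control of all windows.\<close>

lemma ex_Uwin_subset_Owin:
  fixes n :: "'q::finite \<Rightarrow> nat"
  assumes "\<forall>i. n i \<ge> 1" "e \<in> posG"
  shows "\<exists>N\<ge>1. Uwin K n e \<subseteq> Owin K N"
proof -
  have pos: "e $ i > 0" for i using assms(2) by (simp add: posG_def)
  \<comment> \<open>Large enough to dominate every index \<open>n i\<close> and every reciprocal
    level \<open>1 / e $ i\<close>.\<close>
  define N where "N = Max (range n) + nat \<lceil>Max (range (\<lambda>i. 1 / e $ i))\<rceil>"
  have N: "n i \<le> N" for i
    unfolding N_def by (rule order_trans[of _ "Max (range n)"]) (auto intro: Max_ge)
  have eN: "1 / e $ i \<le> real N" for i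
  proof -
    have "1 / e $ i \<le> Max (range (\<lambda>i. 1 / e $ i))" by (rule Max_ge) auto
    also have "\<dots> \<le> real (nat \<lceil>Max (range (\<lambda>i. 1 / e $ i))\<rceil>)" by (rule real_nat_ceiling_ge)
    also have "\<dots> \<le> real N" unfolding N_def by simp
    finally show ?thesis .
  qed
  have "N \<ge> 1" using N assms(1) by (metis order_trans)
  have e: "1 / real N \<le> e $ i" for i
  proof -
    have "1 \<le> real N * e $ i"
      using eN[of i] pos[of i] by (simp add: divide_le_eq)
    then show ?thesis using \<open>N \<ge> 1\<close> by (simp add: divide_le_eq mult.commute)
  qed
  have "f \<in> Owin K N" if "f \<in> Uwin K n e" for f
    unfolding Owin_eq[OF \<open>N \<ge> 1\<close>] Uwin_def
  proof (safe)
    fix i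
    have "1 / real N \<le> e $ i" by (rule e)
    also have "\<dots> < rho K (n i) i f" using that by (simp add: Uwin_def)
    also have "\<dots> \<le> rho K N i f" using N assms(1) by (intro rho_mono) auto
    finally show "(\<chi> i. 1 / real N) $ i < rho K N i f" by simp
  qed
  then show ?thesis using \<open>N \<ge> 1\<close> by blast
qed

lemma one_over_posG: "n \<ge> 1 \<Longrightarrow> (\<chi> i. 1 / real n) \<in> posG"
  by (simp add: posG_def)

lemma test_functionsI:
  assumes "continuous_on UNIV F" "\<And>f. \<bar>F f\<bar> \<le> B" "\<forall>i. n i \<ge> 1" "e \<in> posG"
    and "\<And>f. F f \<noteq> 0 \<Longrightarrow> f \<in> Uwin K n e"
  shows "F \<in> test_functions K"
  unfolding test_functions_def mem_Collect_eq
proof (intro conjI exI allI impI)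
  show "bounded (range F)" using assms(2) by (auto simp: bounded_iff)
  show "continuous_on UNIV F" "1 \<le> n i" "e \<in> posG" for i using assms by auto
  show "f \<notin> Uwin K n e \<Longrightarrow> F f = 0" for f using assms(5)[of f] by blast
qed

lemma test_functionsE:
  assumes "F \<in> test_functions K"
  obtains B n e where "continuous_on UNIV F" "\<And>f. \<bar>F f\<bar> \<le> B" "B > 0" "\<forall>i. n i \<ge> 1" "e \<in> posG"
    "\<And>f. F f \<noteq> 0 \<Longrightarrow> f \<in> Uwin K n e"
proof -
  obtain B where B: "\<forall>f. \<bar>F f\<bar> \<le> B"
    using assms unfolding test_functions_def bounded_iff mem_Collect_eq by (elim exE conjE) auto
  have "\<bar>F f\<bar> \<le> \<bar>B\<bar> + 1" for f using B[rule_format, of f] by linarith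
  moreover have "\<bar>B\<bar> + 1 > 0" by linarith
  moreover obtain n e where "continuous_on UNIV F" "\<forall>i. n i \<ge> 1" "e \<in> posG"
      "\<forall>f. f \<notin> Uwin K n e \<longrightarrow> F f = 0"
    using assms unfolding test_functions_def mem_Collect_eq by (elim exE conjE)
  ultimately show ?thesis by (intro that[of "\<bar>B\<bar> + 1" n e]) auto
qed

end

section \<open>Continuous truncation to the unit interval\<close>

definition clamp :: "real \<Rightarrow> real" where "clamp x = max 0 (min 1 x)"

lemma clamp_bounds: "0 \<le> clamp x" "clamp x \<le> 1"
  by (auto simp: clamp_def)

lemma clamp_nonzero_iff: "clamp x \<noteq> 0 \<longleftrightarrow> x > 0"
  by (auto simp: clamp_def)

lemma clamp_eq_1: "x \<ge> 1 \<Longrightarrow> clamp x = 1"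
  by (auto simp: clamp_def)

lemma continuous_on_clamp [continuous_intros]:
  "continuous_on A f \<Longrightarrow> continuous_on A (\<lambda>x. clamp (f x))"
  unfolding clamp_def by (intro continuous_intros)

lemma prod_clamp_bounds: "0 \<le> (\<Prod>i\<in>A. clamp (x i))" "(\<Prod>i\<in>A. clamp (x i)) \<le> 1"
  by (auto intro!: prod_nonneg prod_le_1 simp: clamp_bounds)

text \<open>Products of clamps are continuous, bounded by 1 and nonzero exactly where finitely many
  quantities are all strictly positive. All bump functions below have this form, one factor for each
  coordinate.\<close>

lemma prod_clamp_nonzero_iff:
  "finite A \<Longrightarrow> (\<Prod>i\<in>A. clamp (x i)) \<noteq> 0 \<longleftrightarrow> (\<forall>i\<in>A. x i > 0)"
  by (simp add: clamp_nonzero_iff)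

section \<open>The filter of thresholds diverging without restriction on relative rates\<close>

lemma eventually_all_finite_iff:
  "(\<forall>\<^sub>F x in F. \<forall>i. P x i) \<longleftrightarrow> (\<forall>i::'a::finite. \<forall>\<^sub>F x in F. P x i)"
  by (auto intro: eventually_all_finite elim: eventually_mono)

lemma filterlim_to_infty_iff:
  fixes g :: "'a \<Rightarrow> real ^ 'q::finite"
  shows "filterlim g to_infty F \<longleftrightarrow> (\<forall>i. filterlim (\<lambda>x. g x $ i) at_top F)"
proof -
  have "filterlim g to_infty F \<longleftrightarrow> (\<forall>Z. \<forall>\<^sub>F x in F. \<forall>i. Z \<le> g x $ i)"
    unfolding to_infty_def filterlim_filtercomap_iff comp_def filterlim_at_top by simp
  also have "\<dots> \<longleftrightarrow> (\<forall>i. filterlim (\<lambda>x. g x $ i) at_top F)"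
    unfolding filterlim_at_top eventually_all_finite_iff by blast
  finally show ?thesis .
qed

lemma filterlim_nth_to_infty: "filterlim (\<lambda>u. u $ i) at_top to_infty"
  using filterlim_ident[of to_infty] unfolding filterlim_to_infty_iff ..

text \<open>The diagonal provides diverging thresholds. Nontriviality of the filter is needed for
  uniqueness of limits and for identifying a limit with its \<open>Limsup\<close>.\<close>

lemma to_infty_neq_bot: "(to_infty :: (real ^ 'q::finite) filter) \<noteq> bot"
proof
  assume "(to_infty :: (real ^ 'q) filter) = bot"
  moreover have "filterlim (\<lambda>x. \<chi> i. x) (to_infty :: (real ^ 'q) filter) at_top"
    unfolding filterlim_to_infty_iff by (simp add: filterlim_ident)
  ultimately have "eventually (\<lambda>_. False) (at_top :: real filter)"
    by (auto simp: filterlim_iff dest: spec[of _ "\<lambda>_. False"])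
  then show False by simp
qed

lemma eventually_posG: "eventually (\<lambda>u. u \<in> posG) to_infty"
  unfolding posG_def mem_Collect_eq
  by (intro eventually_all_finite allI eventually_compose_filterlim[OF eventually_gt_at_top filterlim_nth_to_infty])

lemma filterlim_scale_to_infty:
  assumes "s \<in> posG"
  shows "filterlim (\<lambda>u. \<chi> i. s $ i * u $ i) to_infty to_infty"
  unfolding filterlim_to_infty_iff
  using assms
  by (simp add: posG_def filterlim_tendsto_pos_mult_at_top[OF tendsto_const _ filterlim_nth_to_infty])

text \<open>Each factor depends on one coordinate of u, and each coordinate diverges, so the
  one-dimensional limits multiply whatever the relative rates. The quotient is inverted because the
  rate at u will be expressed through the rate at the rescaled threshold.\<close>

lemma regularly_varying_prod:
  fixes s \<alpha> :: "real ^ 'q::finite"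
  assumes s: "s \<in> posG"
    and b: "\<And>i. regularly_varying (\<alpha> $ i) (b i)"
  shows "((\<lambda>u. (\<Prod>i\<in>UNIV. b i (u $ i)) / (\<Prod>i\<in>UNIV. b i (s $ i * u $ i)))
    \<longlongrightarrow> inverse (\<Prod>i\<in>UNIV. s $ i powr \<alpha> $ i)) to_infty"
proof -
  have pos: "s $ i > 0" for i using s by (simp add: posG_def)
  have "((\<lambda>u. inverse (b i (s $ i * u $ i) / b i (u $ i))) \<longlongrightarrow> inverse (s $ i powr \<alpha> $ i)) to_infty" for i
  proof (intro tendsto_inverse)
    show "((\<lambda>u. b i (s $ i * u $ i) / b i (u $ i)) \<longlongrightarrow> s $ i powr \<alpha> $ i) to_infty"
      using b[of i] pos[of i] unfolding regularly_varying_def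
      by (intro filterlim_compose[OF _ filterlim_nth_to_infty, of "\<lambda>t. b i (s $ i * t) / b i t"]) simp
    show "s $ i powr \<alpha> $ i \<noteq> 0" using pos[of i] by simp
  qed
  then have "((\<lambda>u. \<Prod>i\<in>UNIV. inverse (b i (s $ i * u $ i) / b i (u $ i)))
      \<longlongrightarrow> (\<Prod>i\<in>UNIV. inverse (s $ i powr \<alpha> $ i))) to_infty"
    by (intro tendsto_prod)
  moreover have "(\<Prod>i\<in>UNIV. inverse (s $ i powr \<alpha> $ i)) = inverse (\<Prod>i\<in>UNIV. s $ i powr \<alpha> $ i)"
    using prod_inversef[of "\<lambda>i. s $ i powr \<alpha> $ i" UNIV] by (simp add: comp_def)
  ultimately show ?thesis by (simp add: prod_dividef)
qed

text \<open>Interchange of two limits with an error that itself depends on u: it suffices that the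
  limit of the error in u, not the error uniformly in u, vanishes as k grows. Both directions of the
  theorem end with this argument.\<close>

lemma tendsto_approx:
  fixes h :: "'a \<Rightarrow> real"
  assumes "\<And>k. \<forall>\<^sub>F u in U. \<bar>h u - g k u\<bar> \<le> c k u"
    and "\<And>k. ((\<lambda>u. g k u) \<longlongrightarrow> g' k) U" "\<And>k. ((\<lambda>u. c k u) \<longlongrightarrow> c' k) U"
    and "g' \<longlonglongrightarrow> L" "c' \<longlonglongrightarrow> 0"
  shows "(h \<longlongrightarrow> L) U"
proof (rule tendstoI)
  fix e :: real assume "e > 0"
  \<comment> \<open>Four pieces: \<open>g k u\<close> against \<open>g' k\<close>,
    \<open>g' k\<close> against L, and the error bounded by its limit \<open>c' k\<close> plus its
    distance to that limit.\<close>
  then have e: "e / 4 > 0" by simp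
  have "\<forall>\<^sub>F k in sequentially. dist (g' k) L < e / 4 \<and> dist (c' k) 0 < e / 4"
    using tendstoD[OF assms(4) e] tendstoD[OF assms(5) e] by eventually_elim simp
  then obtain k where k: "dist (g' k) L < e / 4" "dist (c' k) 0 < e / 4"
    by (auto simp: eventually_sequentially)
  show "\<forall>\<^sub>F u in U. dist (h u) L < e"
    using assms(1)[of k] tendstoD[OF assms(2)[of k] e] tendstoD[OF assms(3)[of k] e]
  proof eventually_elim
    case (elim u)
    then show ?case using k unfolding dist_real_def by linarith
  qed
qed

section \<open>Measures on the field space\<close>

context index_space
begin

lemma sets_mu [simp]: "sets (mu b M X u) = sets (borel :: ('t, 'q::finite) cfield measure)"
  unfolding mu_def by simp

lemma mu_eq_density:
  fixes u :: "real ^ 'q::finite"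
  assumes "0 \<le> (\<Prod>i\<in>UNIV. b i (u $ i))"
  shows "mu b M X u = density (distr M borel (\<lambda>w. scale (vinv u) (X w :: ('t, 'q) cfield)))
     (\<lambda>f. ennreal ((\<Prod>i\<in>UNIV. b i (u $ i)) * indicator CPi f))"
  unfolding mu_def using assms by (simp add: ennreal_mult ennreal_indicator)

lemma finite_measure_mu:
  fixes X :: "'w \<Rightarrow> ('t, 'q::finite) cfield"
  assumes "prob_space M" and [measurable]: "X \<in> borel_measurable M"
  shows "finite_measure (mu b M X u)"
proof (rule finite_measureI)
  interpret prob_space M by fact
  interpret D: prob_space "distr M borel (\<lambda>w. scale (vinv u) (X w))"
    by (rule prob_space_distr) measurable
  have "emeasure (mu b M X u) (space (mu b M X u))
      = (\<integral>\<^sup>+f. ennreal (\<Prod>i\<in>UNIV. b i (u $ i)) * indicator CPi f \<partial>distr M borel (\<lambda>w. scale (vinv u) (X w)))"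
    unfolding mu_def by (subst emeasure_density) (auto intro!: nn_integral_cong)
  also have "\<dots> \<le> (\<integral>\<^sup>+f. ennreal (\<Prod>i\<in>UNIV. b i (u $ i)) \<partial>distr M borel (\<lambda>w. scale (vinv u) (X w)))"
    by (intro nn_integral_mono) (simp add: indicator_def)
  also have "\<dots> < \<infinity>" using D.emeasure_space_1 by (simp add: ennreal_mult_less_top)
  finally show "emeasure (mu b M X u) (space (mu b M X u)) \<noteq> \<infinity>" by simp
qed

lemma integral_mu:
  fixes X :: "'w \<Rightarrow> ('t, 'q::finite) cfield" and F :: "_ \<Rightarrow> real"
  assumes [measurable]: "X \<in> borel_measurable M" "F \<in> borel_measurable borel"
    and "\<And>f. F f \<noteq> 0 \<Longrightarrow> f \<in> CPi" and nn: "0 \<le> (\<Prod>i\<in>UNIV. b i (u $ i))"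
  shows "integral\<^sup>L (mu b M X u) F = (\<Prod>i\<in>UNIV. b i (u $ i)) * (\<integral>w. F (scale (vinv u) (X w)) \<partial>M)"
proof -
  have "integral\<^sup>L (mu b M X u) F
      = (\<integral>f. ((\<Prod>i\<in>UNIV. b i (u $ i)) * indicator CPi f) *\<^sub>R F f \<partial>distr M borel (\<lambda>w. scale (vinv u) (X w)))"
    unfolding mu_eq_density[where b = b and u = u, OF nn] by (subst integral_density) (use nn in auto)
  also have "\<dots> = (\<integral>f. (\<Prod>i\<in>UNIV. b i (u $ i)) * F f \<partial>distr M borel (\<lambda>w. scale (vinv u) (X w)))"
    using assms(3) by (intro Bochner_Integration.integral_cong) (auto simp: indicator_def)
  also have "\<dots> = (\<Prod>i\<in>UNIV. b i (u $ i)) * (\<integral>w. F (scale (vinv u) (X w)) \<partial>M)"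
    by (subst integral_distr) auto
  finally show ?thesis .
qed

text \<open>It suffices that every evaluation is measurable for the right-hand side; the distance to a
  closed set supplies the functions \<open>F\<close>.\<close>

lemma sets_borel_cfield:
  "sets (borel :: ('t, 'q::finite) cfield measure)
    = sigma_sets UNIV {{f. 0 < F f} | F. continuous_on UNIV F \<and> (\<forall>f. 0 \<le> F f \<and> F f \<le> (1::real))}"
    (is "_ = sigma_sets UNIV ?E")
proof
  have "{f :: ('t, 'q) cfield. 0 < F f} \<in> sets borel" if "continuous_on UNIV F" for F :: "_ \<Rightarrow> real"
    using borel_measurable_continuous_onI[OF that] by measurable
  then have "?E \<subseteq> sets borel" by (auto simp del: space_borel)
  then show "sigma_sets UNIV ?E \<subseteq> sets (borel :: ('t, 'q) cfield measure)"
    using sets.sigma_sets_subset[of ?E "borel :: ('t, 'q) cfield measure"] by simp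
  have "(\<lambda>f :: ('t, 'q) cfield. f) \<in> borel_measurable (sigma UNIV ?E)"
  proof (rule borel_measurable_cfieldI[OF second_countable])
    fix t :: 't
    show "(\<lambda>f :: ('t, 'q) cfield. fval f t) \<in> borel_measurable (sigma UNIV ?E)"
    proof (rule borel_measurableI)
      fix S :: "(real ^ 'q) set" assume S: "open S"
      \<comment> \<open>The case of an empty complement is separate because \<open>infdist\<close>
        to the empty set is 0, which would give the wrong set of positivity.\<close>
      define F :: "('t, 'q) cfield \<Rightarrow> real" where
        "F f = (if - S = {} then 1 else min 1 (infdist (fval f t) (- S)))" for f
      have "continuous_on UNIV F"
        unfolding F_def by (cases "- S = {}") (auto intro!: continuous_intros continuous_on_fval)
      moreover have "0 \<le> F f \<and> F f \<le> 1" for f by (auto simp: F_def infdist_nonneg)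
      moreover have "(\<lambda>f. fval f t) -` S = {f. 0 < F f}"
      proof -
        have "fval f t \<in> S \<longleftrightarrow> 0 < infdist (fval f t) (- S)" if "- S \<noteq> {}" for f :: "('t, 'q) cfield"
          using in_closed_iff_infdist_zero[of "- S" "fval f t"] S that infdist_nonneg[of "fval f t" "- S"]
          by (auto simp: less_le)
        then show ?thesis by (auto simp: F_def)
      qed
      ultimately have "(\<lambda>f. fval f t) -` S \<in> ?E" by blast
      then show "(\<lambda>f :: ('t, 'q) cfield. fval f t) -` S \<inter> space (sigma UNIV ?E) \<in> sets (sigma UNIV ?E)"
        by simp
    qed
  qed
  then show "sets (borel :: ('t, 'q) cfield measure) \<subseteq> sigma_sets UNIV ?E"
    using measurable_sets[of "\<lambda>f. f" "sigma UNIV ?E" borel] by auto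
qed

text \<open>The functions \<open>min 1 (k * F)\<close> increase to the indicator of {F > 0}, so the
  two measures agree on these sets. They generate the Borel sets and are stable under intersection
  through the minimum of two functions.\<close>

lemma cfield_measure_eqI:
  fixes \<mu> \<nu> :: "('t, 'q::finite) cfield measure"
  assumes fin: "finite_measure \<mu>" "finite_measure \<nu>"
    and sets: "sets \<mu> = sets borel" "sets \<nu> = sets borel"
    and eq: "\<And>F. continuous_on UNIV F \<Longrightarrow> (\<And>f. 0 \<le> F f) \<Longrightarrow> (\<And>f. F f \<le> (1::real)) \<Longrightarrow> integral\<^sup>L \<mu> F = integral\<^sup>L \<nu> F"
  shows "\<mu> = \<nu>"
proof -
  let ?E = "{{f :: ('t, 'q) cfield. 0 < F f} | F. continuous_on UNIV F \<and> (\<forall>f. 0 \<le> F f \<and> F f \<le> (1::real))}"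
  have lim: "(\<lambda>k. \<integral>f. min 1 (real k * F f) \<partial>\<kappa>) \<longlonglongrightarrow> measure \<kappa> {f. 0 < F f}"
    if F: "continuous_on UNIV F" "\<forall>f. 0 \<le> F f \<and> F f \<le> (1::real)"
      and \<kappa>: "finite_measure \<kappa>" "sets \<kappa> = sets borel" for F and \<kappa> :: "('t, 'q) cfield measure"
  proof -
    interpret finite_measure \<kappa> by fact
    have [measurable]: "F \<in> borel_measurable \<kappa>"
      using borel_measurable_continuous_onI[OF F(1)] measurable_cong_sets[OF \<kappa>(2) refl] by blast
    have sp: "space \<kappa> = UNIV" using sets_eq_imp_space_eq[OF \<kappa>(2)] by simp
    have "{f. 0 < F f} \<in> sets borel"
      using borel_measurable_continuous_onI[OF F(1)] by measurable
    then have [measurable]: "{f. 0 < F f} \<in> sets \<kappa>" using \<kappa>(2) by simp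
    have "(\<lambda>k. \<integral>f. min 1 (real k * F f) \<partial>\<kappa>) \<longlonglongrightarrow> (\<integral>f. indicator {f. 0 < F f} f \<partial>\<kappa>)"
    proof (rule integral_dominated_convergence)
      show "AE f in \<kappa>. (\<lambda>k. min 1 (real k * F f)) \<longlonglongrightarrow> indicator {f. 0 < F f} f"
      proof (rule AE_I2)
        fix f
        show "(\<lambda>k. min 1 (real k * F f)) \<longlonglongrightarrow> indicator {f. 0 < F f} f"
        proof (cases "0 < F f")
          case True
          then obtain k0 :: nat where k0: "1 / F f \<le> real k0" using real_arch_simple by blast
          have "min 1 (real k * F f) = 1" if "k \<ge> k0" for k
          proof -
            have "1 / F f \<le> real k" using k0 that by (meson of_nat_le_iff order_trans)
            then show ?thesis using True by (simp add: divide_le_eq)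
          qed
          then show ?thesis using True by (intro tendsto_eventually) (auto simp: eventually_sequentially)
        next
          case False
          then have "F f = 0" using F(2) by (simp add: order_antisym)
          then show ?thesis by simp
        qed
      qed
      show "integrable \<kappa> (\<lambda>_. 1 :: real)" by simp
      show "AE f in \<kappa>. norm (min 1 (real k * F f)) \<le> 1" for k
        using F(2) by (intro AE_I2) (simp add: min_def)
    qed auto
    then show ?thesis by (simp add: sp)
  qed
  show ?thesis
  proof (rule measure_eqI_generator_eq[where E = ?E and \<Omega> = UNIV and A = "\<lambda>_. UNIV"])
    show "Int_stable ?E"
    proof (rule Int_stableI)
      fix A B assume A: "A \<in> ?E" and B: "B \<in> ?E"
      from A obtain F :: "('t, 'q) cfield \<Rightarrow> real" where
        F: "A = {f. 0 < F f}" "continuous_on UNIV F" "\<forall>f. 0 \<le> F f \<and> F f \<le> 1"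
        unfolding mem_Collect_eq by (elim exE conjE)
      from B obtain G :: "('t, 'q) cfield \<Rightarrow> real" where
        G: "B = {f. 0 < G f}" "continuous_on UNIV G" "\<forall>f. 0 \<le> G f \<and> G f \<le> 1"
        unfolding mem_Collect_eq by (elim exE conjE)
      have "A \<inter> B = {f. 0 < min (F f) (G f)}" using F(1) G(1) by auto
      moreover have "continuous_on UNIV (\<lambda>f. min (F f) (G f))" using F G by (intro continuous_intros)
      moreover have "\<forall>f. 0 \<le> min (F f) (G f) \<and> min (F f) (G f) \<le> 1" using F(3) G(3)
        by (simp add: min_le_iff_disj)
      ultimately show "A \<inter> B \<in> ?E"
        unfolding mem_Collect_eq by (intro exI[of _ "\<lambda>f. min (F f) (G f)"] conjI)
    qed
    show "emeasure \<mu> A = emeasure \<nu> A" if AE: "A \<in> ?E" for A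
    proof -
      from AE obtain F :: "('t, 'q) cfield \<Rightarrow> real" where
        F: "A = {f. 0 < F f}" "continuous_on UNIV F" "\<forall>f. 0 \<le> F f \<and> F f \<le> 1"
        unfolding mem_Collect_eq by (elim exE conjE)
      have e: "(\<integral>f. min 1 (real k * F f) \<partial>\<mu>) = (\<integral>f. min 1 (real k * F f) \<partial>\<nu>)" for k
        using F by (intro eq continuous_intros) auto
      have "measure \<mu> A = measure \<nu> A"
        using lim[OF F(2,3) fin(1) sets(1), unfolded e] lim[OF F(2,3) fin(2) sets(2)]
        unfolding F(1) by (rule LIMSEQ_unique)
      then show ?thesis using fin by (simp add: finite_measure.emeasure_eq_measure)
    qed
    show "sets \<mu> = sigma_sets UNIV ?E" "sets \<nu> = sigma_sets UNIV ?E"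
      unfolding sets by (rule sets_borel_cfield)+
    have "UNIV = {f :: ('t, 'q) cfield. 0 < (1::real)}" by simp
    then show "range (\<lambda>_::nat. UNIV :: ('t, 'q) cfield set) \<subseteq> ?E"
      by (auto intro!: exI[of _ "\<lambda>_. 1"])
    show "emeasure \<mu> UNIV \<noteq> \<infinity>"
      using finite_measure.emeasure_finite[OF fin(1), of UNIV] by simp
  qed auto
qed

text \<open>A continuous approximation, from below, to the indicator of \<open>CPi\<close> by
  functions supported in windows. A factor is positive once rho exceeds 1/(n + 1) and equals 1 from
  2/(n + 1) on; the successor avoids the irrelevant index 0.\<close>

definition cutoff :: "nat \<Rightarrow> ('t, 'q::finite) cfield \<Rightarrow> real" where
  "cutoff n f = (\<Prod>i\<in>UNIV. clamp (real (Suc n) * rho K (Suc n) i f - 1))"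

lemma continuous_on_cutoff: "continuous_on UNIV (cutoff n)"
  unfolding cutoff_def by (intro continuous_intros) simp

lemma borel_measurable_cutoff [measurable]: "cutoff n \<in> borel_measurable borel"
  by (rule borel_measurable_continuous_onI[OF continuous_on_cutoff])

lemma cutoff_bounds: "0 \<le> cutoff n f" "cutoff n f \<le> 1"
  unfolding cutoff_def by (rule prod_clamp_bounds)+

lemma cutoff_nonzeroD: "cutoff n f \<noteq> 0 \<Longrightarrow> f \<in> Uwin K (\<lambda>_. Suc n) (\<chi> i. 1 / real (Suc n))"
proof -
  assume "cutoff n f \<noteq> 0"
  then have "\<forall>i\<in>UNIV. 0 < real (Suc n) * rho K (Suc n) i f - 1"
    unfolding cutoff_def by (subst (asm) prod_clamp_nonzero_iff) simp_all
  then show ?thesis by (simp add: Uwin_def field_simps)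
qed

lemma incseq_cutoff: "incseq (\<lambda>n. cutoff n f)"
proof (rule incseq_SucI)
  fix n
  show "cutoff n f \<le> cutoff (Suc n) f"
    unfolding cutoff_def
  proof (intro prod_mono conjI)
    fix i
    have "real (Suc n) * rho K (Suc n) i f \<le> real (Suc (Suc n)) * rho K (Suc (Suc n)) i f"
      by (intro mult_mono rho_mono rho_nonneg) auto
    then show "clamp (real (Suc n) * rho K (Suc n) i f - 1) \<le> clamp (real (Suc (Suc n)) * rho K (Suc (Suc n)) i f - 1)"
      by (auto simp: clamp_def)
  qed (rule clamp_bounds)
qed

lemma cutoff_tendsto:
  fixes f :: "('t, 'q::finite) cfield"
  assumes "f \<in> CPi"
  shows "(\<lambda>n. cutoff n f) \<longlonglongrightarrow> 1"
proof -
  have "\<forall>\<^sub>F n in sequentially. clamp (real (Suc n) * rho K (Suc n) i f - 1) = 1" for i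
  proof -
    obtain m where m: "m \<ge> 1" "0 < rho K m i f" using assms unfolding CPi_iff by blast
    obtain k :: nat where k: "2 / rho K m i f \<le> real k" using real_arch_simple by blast
    have "clamp (real (Suc n) * rho K (Suc n) i f - 1) = 1" if n: "n \<ge> m + k" for n
    proof (rule clamp_eq_1)
      have "2 \<le> real k * rho K m i f" using k m(2) by (simp add: divide_le_eq)
      also have "\<dots> \<le> real (Suc n) * rho K (Suc n) i f"
        using n m(1) by (intro mult_mono rho_mono rho_nonneg) auto
      finally show "1 \<le> real (Suc n) * rho K (Suc n) i f - 1" by simp
    qed
    then show ?thesis by (auto simp: eventually_sequentially)
  qed
  then have "\<forall>\<^sub>F n in sequentially. \<forall>i. clamp (real (Suc n) * rho K (Suc n) i f - 1) = 1"
    by (rule eventually_all_finite)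
  then have "\<forall>\<^sub>F n in sequentially. cutoff n f = 1"
    by eventually_elim (simp add: cutoff_def)
  then show ?thesis by (rule tendsto_eventually)
qed

lemma test_function_integrable:
  fixes F :: "('t, 'q::finite) cfield \<Rightarrow> real"
  assumes [measurable_cong]: "sets \<nu> = sets borel" and "boundedly_finite K \<nu>"
    and [measurable]: "F \<in> borel_measurable borel" and "\<And>f. \<bar>F f\<bar> \<le> B"
    and "\<forall>i. n i \<ge> 1" "e \<in> posG" "\<And>f. F f \<noteq> 0 \<Longrightarrow> f \<in> Uwin K n e"
  shows "integrable \<nu> F"
proof (rule integrableI_bounded_set)
  show "Uwin K n e \<in> sets \<nu>" using assms(1,5) by simp
  show "emeasure \<nu> (Uwin K n e) < \<infinity>" using assms unfolding boundedly_finite_def by simp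
  show "AE f in \<nu>. f \<notin> Uwin K n e \<longrightarrow> F f = 0" using assms(7) by (intro AE_I2) blast
qed (use assms(3,4) in auto)

text \<open>Weighting with a cutoff makes both measures finite and turns every bounded continuous
  function into a test function, so the uniqueness result for finite measures applies. Monotone
  convergence then removes the cutoff, since no mass lies off \<open>CPi\<close>.\<close>

lemma measure_on_CPi_eqI:
  fixes \<mu> \<nu> :: "('t, 'q::finite) cfield measure"
  assumes on: "measure_on_CPi \<mu>" "measure_on_CPi \<nu>"
    and bf: "boundedly_finite K \<mu>" "boundedly_finite K \<nu>"
    and eq: "\<And>F. F \<in> test_functions K \<Longrightarrow> integral\<^sup>L \<mu> F = integral\<^sup>L \<nu> F"
  shows "\<mu> = \<nu>"
proof -
  have dens: "density \<mu> (\<lambda>f. ennreal (cutoff n f)) = density \<nu> (\<lambda>f. ennreal (cutoff n f))" for n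
  proof (rule cfield_measure_eqI)
    have fin: "finite_measure (density \<kappa> (\<lambda>f. ennreal (cutoff n f)))"
      if k: "measure_on_CPi \<kappa>" "boundedly_finite K \<kappa>" for \<kappa> :: "('t, 'q) cfield measure"
    proof (rule finite_measureI)
      have s [measurable_cong]: "sets \<kappa> = sets borel" using k by (simp add: measure_on_CPi_def)
      have "emeasure (density \<kappa> (\<lambda>f. ennreal (cutoff n f))) UNIV = (\<integral>\<^sup>+f. ennreal (cutoff n f) \<partial>\<kappa>)"
        using sets.top[of \<kappa>] sets_eq_imp_space_eq[OF s] by (subst emeasure_density) auto
      also have "\<dots> \<le> (\<integral>\<^sup>+f. indicator (Uwin K (\<lambda>_. Suc n) (\<chi> i. 1 / real (Suc n))) f \<partial>\<kappa>)"
      proof (rule nn_integral_mono)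
        fix f
        show "ennreal (cutoff n f) \<le> indicator (Uwin K (\<lambda>_. Suc n) (\<chi> i. 1 / real (Suc n))) f"
          using cutoff_nonzeroD[of n f] cutoff_bounds[of n f] by (cases "cutoff n f = 0") (auto simp: indicator_def)
      qed
      also have "\<dots> = emeasure \<kappa> (Uwin K (\<lambda>_. Suc n) (\<chi> i. 1 / real (Suc n)))"
        by (rule nn_integral_indicator) (simp add: s Uwin_borel)
      also have "\<dots> < \<infinity>"
        using k(2)[unfolded boundedly_finite_def, rule_format, OF _ one_over_posG[of "Suc n"], of "\<lambda>_. Suc n"] by simp
      finally show "emeasure (density \<kappa> (\<lambda>f. ennreal (cutoff n f))) (space (density \<kappa> (\<lambda>f. ennreal (cutoff n f)))) \<noteq> \<infinity>"
        using sets_eq_imp_space_eq[OF s] by simp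
    qed
    show "finite_measure (density \<mu> (\<lambda>f. ennreal (cutoff n f)))" "finite_measure (density \<nu> (\<lambda>f. ennreal (cutoff n f)))"
      by (intro fin on bf)+
    show "sets (density \<mu> (\<lambda>f. ennreal (cutoff n f))) = sets borel" "sets (density \<nu> (\<lambda>f. ennreal (cutoff n f))) = sets borel"
      using on by (simp_all add: measure_on_CPi_def)
    fix F :: "('t, 'q) cfield \<Rightarrow> real" assume F: "continuous_on UNIV F" "\<And>f. 0 \<le> F f" "\<And>f. F f \<le> 1"
    have int: "integral\<^sup>L (density \<kappa> (\<lambda>f. ennreal (cutoff n f))) F = (\<integral>f. cutoff n f * F f \<partial>\<kappa>)"
      if k: "measure_on_CPi \<kappa>" for \<kappa> :: "('t, 'q) cfield measure"
    proof -
      have s [measurable_cong]: "sets \<kappa> = sets borel" using k by (simp add: measure_on_CPi_def)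
      have [measurable]: "F \<in> borel_measurable borel" by (rule borel_measurable_continuous_onI[OF F(1)])
      show ?thesis by (subst integral_density) (auto simp: cutoff_bounds)
    qed
    have "(\<lambda>f. cutoff n f * F f) \<in> test_functions K"
    proof (rule test_functionsI[where B = 1 and n = "\<lambda>_. Suc n" and e = "\<chi> i. 1 / real (Suc n)"])
      show "continuous_on UNIV (\<lambda>f. cutoff n f * F f)" by (intro continuous_intros continuous_on_cutoff F)
      show "\<bar>cutoff n f * F f\<bar> \<le> 1" for f
        using F(2,3)[of f] cutoff_bounds[of n f] by (simp add: abs_mult mult_le_one)
    qed (use one_over_posG[of "Suc n"] cutoff_nonzeroD[of n] in auto)
    then show "integral\<^sup>L (density \<mu> (\<lambda>f. ennreal (cutoff n f))) F = integral\<^sup>L (density \<nu> (\<lambda>f. ennreal (cutoff n f))) F"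
      unfolding int[OF on(1)] int[OF on(2)] by (rule eq)
  qed
  have lim: "(\<lambda>n. emeasure (density \<kappa> (\<lambda>f. ennreal (cutoff n f))) A) \<longlonglongrightarrow> emeasure \<kappa> A"
    if k: "measure_on_CPi \<kappa>" and A: "A \<in> sets borel" for \<kappa> :: "('t, 'q) cfield measure" and A
  proof -
    have s [measurable_cong]: "sets \<kappa> = sets borel" using k by (simp add: measure_on_CPi_def)
    note A [measurable]
    have "AE f in \<kappa>. f \<in> CPi"
      using k by (intro AE_I[of _ _ "- CPi"]) (auto simp: measure_on_CPi_def)
    then have "(\<integral>\<^sup>+f. indicator CPi f * indicator A f \<partial>\<kappa>) = (\<integral>\<^sup>+f. indicator A f \<partial>\<kappa>)"
      by (intro nn_integral_cong_AE) (auto elim!: eventually_mono)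
    also have "\<dots> = emeasure \<kappa> A" by (rule nn_integral_indicator) (simp add: s A)
    finally have "(\<integral>\<^sup>+f. indicator CPi f * indicator A f \<partial>\<kappa>) = emeasure \<kappa> A" .
    moreover have "(\<lambda>n. \<integral>\<^sup>+f. ennreal (cutoff n f) * indicator A f \<partial>\<kappa>) \<longlonglongrightarrow> (\<integral>\<^sup>+f. indicator CPi f * indicator A f \<partial>\<kappa>)"
    proof (rule nn_integral_LIMSEQ)
      show "incseq (\<lambda>n f. ennreal (cutoff n f) * indicator A f)"
        using incseq_cutoff by (auto simp: incseq_def le_fun_def intro!: mult_right_mono ennreal_leI)
      show "(\<lambda>n. ennreal (cutoff n f) * indicator A f) \<longlonglongrightarrow> indicator CPi f * indicator A f" for f
      proof (cases "f \<in> CPi")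
        case True
        then have "(\<lambda>n. ennreal (cutoff n f)) \<longlonglongrightarrow> ennreal 1" by (intro tendsto_ennrealI cutoff_tendsto)
        then show ?thesis using True by (auto simp: indicator_def)
      next
        case False
        have "cutoff n f = 0" for n
          using cutoff_nonzeroD[of n f] Uwin_subset_CPi[of "\<lambda>_. Suc n" "\<chi> i. 1 / real (Suc n)"]
            one_over_posG[of "Suc n"] False by auto
        then show ?thesis using False by simp
      qed
    qed measurable
    ultimately show ?thesis using A s by (simp add: emeasure_density)
  qed
  have s: "sets \<mu> = sets borel" "sets \<nu> = sets borel" using on by (simp_all add: measure_on_CPi_def)
  show ?thesis
  proof (rule measure_eqI)
    show "sets \<mu> = sets \<nu>" by (simp add: s)
    fix A assume "A \<in> sets \<mu>"
    then have A: "A \<in> sets borel" by (simp add: s)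
    show "emeasure \<mu> A = emeasure \<nu> A"
      using lim[OF on(1) A] lim[OF on(2) A] unfolding dens by (rule LIMSEQ_unique)
  qed
qed

end

section \<open>The limit measure\<close>

lemma borel_measurable_vecI:
  fixes f :: "'a \<Rightarrow> real ^ 'q::finite"
  assumes "\<And>i. (\<lambda>x. f x $ i) \<in> borel_measurable M"
  shows "f \<in> borel_measurable M"
  by (subst borel_measurable_euclidean_space) (use assms in \<open>auto simp: Basis_vec_real inner_axis\<close>)

locale representer_measure = index_space K
  for K :: "nat \<Rightarrow> 't::topological_ab_group_add set" +
  fixes \<alpha> :: "real ^ 'q::finite" and N :: "'v measure" and Z :: "'v \<Rightarrow> ('t, 'q) cfield"
  assumes prob_N: "prob_space N" and alpha_pos: "\<And>i. \<alpha> $ i > 0"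
    and representer: "representer K \<alpha> N Z"
begin

abbreviation \<nu> :: "('t, 'q) cfield measure" where "\<nu> \<equiv> nuZ \<alpha> N Z"

lemma measurable_Z [measurable]: "Z \<in> borel_measurable N"
  and Z_CPi: "w \<in> space N \<Longrightarrow> Z w \<in> CPi"
  and Z_moment: "\<forall>i. n i \<ge> 1 \<Longrightarrow> (\<integral>\<^sup>+w. ennreal (\<Prod>i\<in>UNIV. rho K (n i) i (Z w) powr \<alpha> $ i) \<partial>N) < \<infinity>"
  using representer unfolding representer_def by simp_all

text \<open>Joint measurability in r and the sample point is checked on evaluations, where scaling
  is a product of two real measurable functions.\<close>

lemma measurable_scale_Z [measurable]:
  "(\<lambda>x. scale (snd x) (Z (fst x))) \<in> borel_measurable (N \<Otimes>\<^sub>M theta \<alpha>)"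
proof (rule borel_measurable_cfieldI[OF second_countable], rule borel_measurable_vecI)
  fix t i
  have [measurable]: "(\<lambda>f :: ('t, 'q) cfield. fval f t $ i) \<in> borel_measurable borel"
    by (rule borel_measurable_continuous_onI[OF continuous_on_fval_nth])
  show "(\<lambda>x. fval (scale (snd x) (Z (fst x))) t $ i) \<in> borel_measurable (N \<Otimes>\<^sub>M theta \<alpha>)"
    unfolding fval_scale by measurable
qed

text \<open>\<open>measure_of\<close> yields the given set function only if that function is a
  measure. Recognising it, by Fubini, as the image of a product measure settles countable additivity
  once and for all.\<close>

lemma nuZ_eq_distr: "\<nu> = distr (N \<Otimes>\<^sub>M theta \<alpha>) borel (\<lambda>x. scale (snd x) (Z (fst x)))"
  unfolding nuZ_def distr_def space_borel
proof (rule measure_of_eq)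
  interpret theta: sigma_finite_measure "theta \<alpha>" by (rule sigma_finite_theta)
  fix A :: "('t, 'q) cfield set"
  assume "A \<in> sigma_sets UNIV (sets borel)"
  then have [measurable]: "A \<in> sets borel" by (metis sets.sigma_sets_eq space_borel)
  let ?P = "N \<Otimes>\<^sub>M theta \<alpha>" and ?\<Phi> = "\<lambda>x. scale (snd x) (Z (fst x))"
  have m: "(\<lambda>x. indicator A (?\<Phi> x) :: ennreal) \<in> borel_measurable ?P" by measurable
  have "emeasure ?P (?\<Phi> -` A \<inter> space ?P) = (\<integral>\<^sup>+x. indicator (?\<Phi> -` A \<inter> space ?P) x \<partial>?P)"
    by (rule nn_integral_indicator[symmetric]) (rule measurable_sets[OF measurable_scale_Z \<open>A \<in> sets borel\<close>])
  also have "\<dots> = (\<integral>\<^sup>+x. indicator A (?\<Phi> x) \<partial>?P)"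
    by (rule nn_integral_cong) (simp add: indicator_def)
  also have "\<dots> = (\<integral>\<^sup>+w. \<integral>\<^sup>+r. indicator A (scale r (Z w)) \<partial>theta \<alpha> \<partial>N)"
    using theta.nn_integral_fst[OF m] by simp
  finally show "(\<integral>\<^sup>+w. \<integral>\<^sup>+r. indicator A (scale r (Z w)) \<partial>theta \<alpha> \<partial>N) = emeasure ?P (?\<Phi> -` A \<inter> space ?P)" ..
qed simp

lemma sets_nuZ [measurable_cong, simp]: "sets \<nu> = sets borel"
  unfolding nuZ_eq_distr by simp

lemma space_nuZ [simp]: "space \<nu> = UNIV"
  unfolding nuZ_eq_distr by simp

lemma nn_integral_nuZ:
  assumes [measurable]: "h \<in> borel_measurable borel"
  shows "(\<integral>\<^sup>+f. h f \<partial>\<nu>) = (\<integral>\<^sup>+w. \<integral>\<^sup>+r. h (scale r (Z w)) \<partial>theta \<alpha> \<partial>N)"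
proof -
  interpret theta: sigma_finite_measure "theta \<alpha>" by (rule sigma_finite_theta)
  have "(\<integral>\<^sup>+f. h f \<partial>\<nu>) = (\<integral>\<^sup>+x. h (scale (snd x) (Z (fst x))) \<partial>(N \<Otimes>\<^sub>M theta \<alpha>))"
    unfolding nuZ_eq_distr by (rule nn_integral_distr) measurable
  also have "\<dots> = (\<integral>\<^sup>+w. \<integral>\<^sup>+r. h (scale r (Z w)) \<partial>theta \<alpha> \<partial>N)"
    using theta.nn_integral_fst[of "\<lambda>x. h (scale (snd x) (Z (fst x)))" N] by simp
  finally show ?thesis .
qed

lemma emeasure_nuZ:
  assumes [measurable]: "A \<in> sets borel"
  shows "emeasure \<nu> A = (\<integral>\<^sup>+w. \<integral>\<^sup>+r. indicator A (scale r (Z w)) \<partial>theta \<alpha> \<partial>N)"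
  using nn_integral_nuZ[of "indicator A"] by simp

lemma emeasure_nuZ_eq_0I:
  assumes A: "A \<in> sets borel"
    and "\<And>w. w \<in> space N \<Longrightarrow> AE r in theta \<alpha>. scale r (Z w) \<notin> A"
  shows "emeasure \<nu> A = 0"
proof -
  have "(\<integral>\<^sup>+r. indicator A (scale r (Z w)) \<partial>theta \<alpha>) = 0" if "w \<in> space N" for w
  proof -
    have "(\<integral>\<^sup>+r. indicator A (scale r (Z w)) \<partial>theta \<alpha>) = (\<integral>\<^sup>+r. 0 \<partial>theta \<alpha>)"
      by (rule nn_integral_cong_AE) (use assms(2)[OF that] in \<open>auto elim!: eventually_mono\<close>)
    then show ?thesis by simp
  qed
  then have "emeasure \<nu> A = (\<integral>\<^sup>+w. 0 \<partial>N)"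
    unfolding emeasure_nuZ[OF A] by (intro nn_integral_cong)
  then show ?thesis by simp
qed

lemma measure_on_CPi_nuZ: "measure_on_CPi \<nu>"
  unfolding measure_on_CPi_def
proof
  show "emeasure \<nu> (- CPi) = 0"
  proof (rule emeasure_nuZ_eq_0I)
    fix w assume "w \<in> space N"
    then have "Z w \<in> CPi" by (rule Z_CPi)
    show "AE r in theta \<alpha>. scale r (Z w) \<notin> - CPi"
      using AE_theta_posG[of \<alpha>] by eventually_elim (simp add: CPi_scale \<open>Z w \<in> CPi\<close>)
  qed auto
qed simp

text \<open>The total mass equals that of \<open>theta\<close>, which gives mass 1 to the orthant
  with corner (1, ..., 1).\<close>

lemma nuZ_nonzero: "emeasure \<nu> (space \<nu>) \<noteq> 0"
proof -
  interpret N: prob_space N by (rule prob_N)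
  have "emeasure \<nu> (space \<nu>) = (\<integral>\<^sup>+w. emeasure (theta \<alpha>) UNIV \<partial>N)"
    using emeasure_nuZ[of UNIV] by simp
  also have "\<dots> = emeasure (theta \<alpha>) UNIV" using N.emeasure_space_1 by simp
  finally have "emeasure (theta \<alpha>) {r. \<forall>i. (\<chi> i. 1) $ i \<le> r $ i} \<le> emeasure \<nu> (space \<nu>)"
    by (simp add: emeasure_mono)
  moreover have "emeasure (theta \<alpha>) {r. \<forall>i. (\<chi> i. 1) $ i \<le> r $ i} = 1"
    by (subst emeasure_theta_tail) (auto simp: alpha_pos posG_def)
  ultimately show ?thesis by auto
qed

text \<open>For fixed Z the scalings that reach the window lie in an orthant with corner e_i /
  rho_i(Z). The tail formula makes its mass a constant times the product of rho_i(Z)^\<alpha>_i,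
  which is integrable by the moment condition on the representer.\<close>

lemma boundedly_finite_nuZ: "boundedly_finite K \<nu>"
  unfolding boundedly_finite_def
proof (intro allI impI)
  fix n :: "'q \<Rightarrow> nat" and e :: "real ^ 'q"
  assume n: "\<forall>i. 1 \<le> n i" and "e \<in> posG"
  then have e: "e $ i > 0" for i by (simp add: posG_def)
  have n': "1 \<le> n i" for i using n by simp
  define C where "C = (\<Prod>i\<in>UNIV. e $ i powr - \<alpha> $ i)"
  have C: "C \<ge> 0" unfolding C_def by (intro prod_nonneg) simp
  have [measurable]: "Uwin K n e \<in> sets (borel :: ('t, 'q) cfield measure)" by (rule Uwin_borel[OF n])
  have "(\<integral>\<^sup>+r. indicator (Uwin K n e) (scale r (Z w)) \<partial>theta \<alpha>)
      \<le> ennreal C * ennreal (\<Prod>i\<in>UNIV. rho K (n i) i (Z w) powr \<alpha> $ i)" (is "?I \<le> ?R") for w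
  proof (cases "\<forall>i. rho K (n i) i (Z w) > 0")
    case True
    define c :: "real ^ 'q" where "c = (\<chi> i. e $ i / rho K (n i) i (Z w))"
    have c: "c \<in> posG" using True e by (simp add: c_def posG_def)
    have "?I \<le> (\<integral>\<^sup>+r. indicator {r. \<forall>i. c $ i \<le> r $ i} r \<partial>theta \<alpha>)"
    proof (rule nn_integral_mono_AE)
      show "AE r in theta \<alpha>. indicator (Uwin K n e) (scale r (Z w)) \<le> (indicator {r. \<forall>i. c $ i \<le> r $ i} r :: ennreal)"
        using AE_theta_posG[of \<alpha>]
      proof eventually_elim
        case (elim r)
        have "c $ i \<le> r $ i" if "scale r (Z w) \<in> Uwin K n e" for i
        proof -
          have "e $ i < rho K (n i) i (scale r (Z w))" using that by (simp add: Uwin_def)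
          also have "\<dots> = r $ i * rho K (n i) i (Z w)" using elim by (intro rho_scale n') (simp add: posG_def)
          finally show ?thesis using True by (simp add: c_def divide_le_eq)
        qed
        then show ?case by (auto simp: indicator_def)
      qed
    qed
    also have "\<dots> = emeasure (theta \<alpha>) {r. \<forall>i. c $ i \<le> r $ i}"
    proof (rule nn_integral_indicator)
      have "{r. \<forall>i. c $ i \<le> r $ i} = (\<Inter>i. {r. c $ i \<le> r $ i})" by auto
      also have "\<dots> \<in> sets (theta \<alpha>)" by (intro sets.finite_INT) auto
      finally show "{r. \<forall>i. c $ i \<le> r $ i} \<in> sets (theta \<alpha>)" .
    qed
    also have "\<dots> = ennreal (\<Prod>i\<in>UNIV. c $ i powr - \<alpha> $ i)"
      by (rule emeasure_theta_tail[OF alpha_pos c])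
    also have "(\<Prod>i\<in>UNIV. c $ i powr - \<alpha> $ i) = C * (\<Prod>i\<in>UNIV. rho K (n i) i (Z w) powr \<alpha> $ i)"
      unfolding C_def prod.distrib[symmetric] c_def using True e
      by (intro prod.cong) (auto simp: powr_divide powr_minus field_simps less_imp_le)
    finally show ?thesis using C by (simp add: ennreal_mult')
  next
    case False
    \<comment> \<open>If some rho vanishes, no positive scaling reaches the level, so the fibre is
      null; the corner c would involve a division by zero here.\<close>
    then obtain i where "\<not> rho K (n i) i (Z w) > 0" by blast
    then have z: "rho K (n i) i (Z w) = 0" using rho_nonneg[OF n'[of i], of i "Z w"] by linarith
    have "?I = (\<integral>\<^sup>+r. 0 \<partial>theta \<alpha>)"
    proof (rule nn_integral_cong_AE)
      show "AE r in theta \<alpha>. indicator (Uwin K n e) (scale r (Z w)) = (0 :: ennreal)"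
        using AE_theta_posG[of \<alpha>]
      proof eventually_elim
        case (elim r)
        then have "rho K (n i) i (scale r (Z w)) = 0"
          using rho_scale[OF n'[of i], where r = r and i = i and f = "Z w"] by (simp add: posG_def z)
        then have "scale r (Z w) \<notin> Uwin K n e" using e[of i] by (auto simp: Uwin_def intro!: exI[of _ i])
        then show ?case by simp
      qed
    qed
    then show ?thesis by simp
  qed
  then have "emeasure \<nu> (Uwin K n e)
      \<le> (\<integral>\<^sup>+w. ennreal C * ennreal (\<Prod>i\<in>UNIV. rho K (n i) i (Z w) powr \<alpha> $ i) \<partial>N)"
    by (subst emeasure_nuZ) (auto intro: nn_integral_mono)
  also have "\<dots> = ennreal C * (\<integral>\<^sup>+w. ennreal (\<Prod>i\<in>UNIV. rho K (n i) i (Z w) powr \<alpha> $ i) \<partial>N)"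
  proof (rule nn_integral_cmult)
    have "(\<lambda>w. rho K (n i) i (Z w)) \<in> borel_measurable N" for i
      using measurable_compose[OF measurable_Z borel_measurable_rho[OF n']] .
    then show "(\<lambda>w. ennreal (\<Prod>i\<in>UNIV. rho K (n i) i (Z w) powr \<alpha> $ i)) \<in> borel_measurable N"
      by measurable
  qed
  also have "\<dots> < \<infinity>" using Z_moment[OF n] by (simp add: ennreal_mult_less_top)
  finally show "emeasure \<nu> (Uwin K n e) < \<infinity>" .
qed

text \<open>Along each fibre the level set is {r. r_i * g(Z) = s}, which is null for
  \<open>theta\<close>. Homogeneity in a single coordinate suffices, and it covers both point
  evaluations and suprema over \<open>K n\<close>.\<close>

lemma AE_nuZ_level:
  assumes [measurable]: "g \<in> borel_measurable borel"
    and hom: "\<And>r f. r \<in> posG \<Longrightarrow> g (scale r f) = r $ i * g f" and s: "s \<noteq> 0"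
  shows "AE f in \<nu>. g f \<noteq> s"
proof (rule AE_I)
  show "{f \<in> space \<nu>. \<not> g f \<noteq> s} \<subseteq> {f. g f = s}" by simp
  show "emeasure \<nu> {f. g f = s} = 0"
  proof (rule emeasure_nuZ_eq_0I)
    fix w
    show "AE r in theta \<alpha>. scale r (Z w) \<notin> {f. g f = s}"
      using AE_theta_posG[of \<alpha>] AE_theta_hyperplane[OF s, where \<alpha> = \<alpha> and i = i and c = "g (Z w)"]
      by eventually_elim (simp add: hom)
  qed measurable
  show "{f. g f = s} \<in> sets \<nu>" by simp
qed

text \<open>Homogeneity of the limit measure, inherited fibrewise from the behaviour of
  \<open>theta\<close> under diagonal maps.\<close>

lemma distr_nuZ_scale:
  assumes s: "s \<in> posG"
  shows "distr \<nu> borel (scale s) = density \<nu> (\<lambda>_. ennreal (\<Prod>i\<in>UNIV. s $ i powr \<alpha> $ i))"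
proof (rule measure_eqI)
  fix A assume "A \<in> sets (distr \<nu> borel (scale s))"
  then have [measurable]: "A \<in> sets borel" by simp
  have "emeasure (distr \<nu> borel (scale s)) A = (\<integral>\<^sup>+f. indicator A f \<partial>distr \<nu> borel (scale s))"
    by simp
  also have "\<dots> = (\<integral>\<^sup>+f. indicator A (scale s f) \<partial>\<nu>)" by (rule nn_integral_distr) measurable
  also have "\<dots> = (\<integral>\<^sup>+w. \<integral>\<^sup>+r. indicator A (scale s (scale r (Z w))) \<partial>theta \<alpha> \<partial>N)"
    by (rule nn_integral_nuZ) measurable
  also have "\<dots> = (\<integral>\<^sup>+w. ennreal (\<Prod>i\<in>UNIV. s $ i powr \<alpha> $ i) * (\<integral>\<^sup>+r. indicator A (scale r (Z w)) \<partial>theta \<alpha>) \<partial>N)"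
  proof (rule nn_integral_cong)
    fix w assume w: "w \<in> space N"
    \<comment> \<open>For a fixed sample point, measurability in r is a section of the joint
      measurability.\<close>
    have "(\<lambda>r. scale r (Z w)) \<in> borel_measurable borel"
      using measurable_compose[OF measurable_Pair1'[OF w] measurable_scale_Z]
      by (simp cong: measurable_cong_sets)
    then have "(\<lambda>r. indicator A (scale r (Z w)) :: ennreal) \<in> borel_measurable borel" by measurable
    from nn_integral_theta_scale[OF s this]
    show "(\<integral>\<^sup>+r. indicator A (scale s (scale r (Z w))) \<partial>theta \<alpha>)
      = ennreal (\<Prod>i\<in>UNIV. s $ i powr \<alpha> $ i) * (\<integral>\<^sup>+r. indicator A (scale r (Z w)) \<partial>theta \<alpha>)"
      by (simp add: scale_scale)
  qed
  also have "\<dots> = ennreal (\<Prod>i\<in>UNIV. s $ i powr \<alpha> $ i) * emeasure \<nu> A"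
  proof -
    interpret theta: sigma_finite_measure "theta \<alpha>" by (rule sigma_finite_theta)
    have "(\<lambda>w. \<integral>\<^sup>+r. indicator A (scale r (Z w)) \<partial>theta \<alpha>) \<in> borel_measurable N"
      by (rule theta.borel_measurable_nn_integral) (simp add: split_beta')
    then show ?thesis by (simp add: nn_integral_cmult emeasure_nuZ)
  qed
  also have "\<dots> = emeasure (density \<nu> (\<lambda>_. ennreal (\<Prod>i\<in>UNIV. s $ i powr \<alpha> $ i))) A"
    by (subst emeasure_density) (auto simp: nn_integral_cmult)
  finally show "emeasure (distr \<nu> borel (scale s)) A = emeasure (density \<nu> (\<lambda>_. ennreal (\<Prod>i\<in>UNIV. s $ i powr \<alpha> $ i))) A" .
qed simp

lemma integral_nuZ_scale:
  fixes G :: "('t, 'q) cfield \<Rightarrow> real"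
  assumes s: "s \<in> posG" and [measurable]: "G \<in> borel_measurable borel"
  shows "(\<integral>f. G (scale s f) \<partial>\<nu>) = (\<Prod>i\<in>UNIV. s $ i powr \<alpha> $ i) * (\<integral>f. G f \<partial>\<nu>)"
proof -
  have "(\<integral>f. G (scale s f) \<partial>\<nu>) = integral\<^sup>L (distr \<nu> borel (scale s)) G"
    by (rule integral_distr[symmetric]) measurable
  also have "\<dots> = (\<integral>f. (\<Prod>i\<in>UNIV. s $ i powr \<alpha> $ i) *\<^sub>R G f \<partial>\<nu>)"
    unfolding distr_nuZ_scale[OF s] by (rule integral_density) (auto intro!: prod_nonneg)
  finally show ?thesis by simp
qed

end

section \<open>The rescaled laws\<close>

locale stationary_field = representer_measure K \<alpha> N Z
  for K :: "nat \<Rightarrow> 't::topological_ab_group_add set"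
    and \<alpha> :: "real ^ 'q::finite" and N :: "'v measure" and Z :: "'v \<Rightarrow> ('t, 'q) cfield" +
  fixes b :: "'q \<Rightarrow> real \<Rightarrow> real" and M :: "'w measure" and X :: "'w \<Rightarrow> ('t, 'q) cfield"
  assumes prob_M: "prob_space M" and measurable_X [measurable]: "X \<in> borel_measurable M"
    and stationary: "strictly_stationary M X"
    and b_pos: "\<And>i x. x > 0 \<Longrightarrow> b i x > 0"
    and b_rv: "\<And>i. regularly_varying (\<alpha> $ i) (b i)"
begin

abbreviation \<mu> :: "real ^ 'q \<Rightarrow> ('t, 'q) cfield measure" where "\<mu> \<equiv> mu b M X"

definition a :: "real ^ 'q \<Rightarrow> real" where "a u = (\<Prod>i\<in>UNIV. b i (u $ i))"

lemma a_pos: "u \<in> posG \<Longrightarrow> a u > 0"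
  unfolding a_def posG_def by (intro prod_pos) (simp add: b_pos)

lemma space_mu [simp]: "space (\<mu> u) = UNIV"
  by (simp add: mu_def)

lemma finite_measure_mu': "finite_measure (\<mu> u)"
  by (rule finite_measure_mu[OF prob_M measurable_X])

lemma integrable_mu:
  fixes G :: "('t, 'q) cfield \<Rightarrow> real"
  assumes [measurable]: "G \<in> borel_measurable borel" and "\<And>f. \<bar>G f\<bar> \<le> B"
  shows "integrable (\<mu> u) G"
proof (rule finite_measure.integrable_const_bound[OF finite_measure_mu'])
  show "AE f in \<mu> u. norm (G f) \<le> B" using assms(2) by simp
qed (simp add: measurable_cong_sets[OF sets_mu refl])

lemmas integrable_nu = test_function_integrable[OF sets_nuZ boundedly_finite_nuZ]

lemma integral_mu':
  fixes F :: "('t, 'q) cfield \<Rightarrow> real"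
  assumes "F \<in> borel_measurable borel" "\<And>f. F f \<noteq> 0 \<Longrightarrow> f \<in> CPi" "u \<in> posG"
  shows "integral\<^sup>L (\<mu> u) F = a u * (\<integral>w. F (scale (vinv u) (X w)) \<partial>M)"
  unfolding a_def
  by (rule integral_mu[OF measurable_X assms(1,2)]) (use a_pos[OF assms(3)] in \<open>simp_all add: a_def\<close>)

text \<open>Shifts commute with scalings and preserve \<open>CPi\<close>, so invariance of the law
  of X passes to every rescaled law exactly, before any limit is taken.\<close>

lemma integral_mu_shift:
  fixes F :: "('t, 'q) cfield \<Rightarrow> real"
  assumes F [measurable]: "F \<in> borel_measurable borel" and "\<And>f. F f \<noteq> 0 \<Longrightarrow> f \<in> CPi" "u \<in> posG"
  shows "(\<integral>f. F (shift h f) \<partial>\<mu> u) = integral\<^sup>L (\<mu> u) F"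
proof -
  have "(\<integral>f. F (shift h f) \<partial>\<mu> u) = a u * (\<integral>w. F (shift h (scale (vinv u) (X w))) \<partial>M)"
    using assms(2)[of "shift h _"] by (intro integral_mu' assms(3)) (auto simp: CPi_shift)
  also have "(\<integral>w. F (shift h (scale (vinv u) (X w))) \<partial>M)
      = integral\<^sup>L (distr M borel (\<lambda>w. shift h (X w))) (\<lambda>f. F (scale (vinv u) f))"
    by (subst integral_distr) (auto simp: shift_scale)
  also have "distr M borel (\<lambda>w. shift h (X w)) = distr M borel X"
    using stationary unfolding strictly_stationary_def by blast
  also have "integral\<^sup>L (distr M borel X) (\<lambda>f. F (scale (vinv u) f)) = (\<integral>w. F (scale (vinv u) (X w)) \<partial>M)"
    by (rule integral_distr) auto
  finally show ?thesis using integral_mu'[OF assms] by simp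
qed

text \<open>Dividing X by u is the same as dividing by s * u and then scaling by s. Changing the
  threshold therefore costs only the ratio of the two rates.\<close>

lemma integral_mu_scale:
  fixes F :: "('t, 'q) cfield \<Rightarrow> real"
  assumes F [measurable]: "F \<in> borel_measurable borel" and "\<And>f. F f \<noteq> 0 \<Longrightarrow> f \<in> CPi"
    and s: "s \<in> posG" and u: "u \<in> posG"
  shows "integral\<^sup>L (\<mu> u) F = a u / a (\<chi> i. s $ i * u $ i) * (\<integral>f. F (scale s f) \<partial>\<mu> (\<chi> i. s $ i * u $ i))"
proof -
  let ?v = "\<chi> i. s $ i * u $ i"
  have v: "?v \<in> posG" using s u by (simp add: posG_def)
  have sv: "scale s (scale (vinv ?v) f) = scale (vinv u) f" for f :: "('t, 'q) cfield"
  proof -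
    have "s $ i * inverse (s $ i * u $ i) = inverse (u $ i)" for i
      using s by (simp add: posG_def less_imp_neq[symmetric])
    then have "(\<chi> i. s $ i * vinv ?v $ i) = vinv u"
      by (simp only: vinv_def vec_lambda_beta)
    then show ?thesis by (simp only: scale_scale)
  qed
  have "(\<integral>f. F (scale s f) \<partial>\<mu> ?v) = a ?v * (\<integral>w. F (scale (vinv u) (X w)) \<partial>M)"
    using assms(2)[of "scale s _"]
    by (subst integral_mu'[OF _ _ v]) (auto simp: CPi_scale[OF s] sv)
  then show ?thesis using integral_mu'[OF assms(1,2) u] a_pos[OF v] by simp
qed

lemma restrict_meas_eq: "restrict_meas A \<kappa> = density \<kappa> (\<lambda>f. ennreal (indicator A f))"
  unfolding restrict_meas_def by (simp add: ennreal_indicator)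

lemma integral_restrict_meas:
  fixes F :: "('t, 'q) cfield \<Rightarrow> real"
  assumes [measurable_cong]: "sets \<kappa> = sets borel" and [measurable]: "A \<in> sets borel" "F \<in> borel_measurable borel"
  shows "integral\<^sup>L (restrict_meas A \<kappa>) F = (\<integral>f. indicator A f * F f \<partial>\<kappa>)"
  unfolding restrict_meas_eq by (subst integral_density) auto

lemma emeasure_restrict_meas_space:
  fixes \<kappa> :: "('t, 'q) cfield measure"
  assumes "sets \<kappa> = sets borel" "A \<in> sets borel"
  shows "emeasure (restrict_meas A \<kappa>) (space (restrict_meas A \<kappa>)) = emeasure \<kappa> A"
proof -
  have "A \<in> sets \<kappa>" using assms by simp
  then show ?thesis unfolding restrict_meas_def
    using sets.sets_into_space[OF \<open>A \<in> sets \<kappa>\<close>]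
    by (subst emeasure_density) (auto intro!: nn_integral_cong simp: indicator_def nn_integral_indicator[symmetric] simp del: nn_integral_indicator)
qed

section \<open>Necessity\<close>

lemma RV_imp_shift_invariant:
  assumes conv: "\<And>F. F \<in> test_functions K \<Longrightarrow> ((\<lambda>u. integral\<^sup>L (\<mu> u) F) \<longlongrightarrow> integral\<^sup>L \<nu> F) to_infty"
  shows "shift_invariant \<nu>"
  unfolding shift_invariant_def
proof
  fix h
  \<comment> \<open>Needed twice: for bounded finiteness of the shifted measure and to see that a
    shifted test function is again a test function.\<close>
  have windows: "\<exists>n'. (\<forall>i. n' i \<ge> 1) \<and> (\<forall>f :: ('t, 'q) cfield. shift h f \<in> Uwin K n e \<longrightarrow> f \<in> Uwin K n' e)"
    if n: "\<forall>i. n i \<ge> 1" for n :: "'q \<Rightarrow> nat" and e :: "real ^ 'q"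
  proof -
    have "\<exists>m. m \<ge> 1 \<and> (\<forall>f :: ('t, 'q) cfield. rho K (n i) i (shift h f) \<le> rho K m i f)" for i
      using ex_rho_shift_le[of "n i" h] n by blast
    then obtain n' where n': "\<And>i. n' i \<ge> 1"
        "\<And>i (f :: ('t, 'q) cfield). rho K (n i) i (shift h f) \<le> rho K (n' i) i f"
      by metis
    then show ?thesis unfolding Uwin_def by (intro exI[of _ n']) (auto intro: less_le_trans)
  qed
  show "distr \<nu> borel (shift h) = \<nu>"
  proof (rule measure_on_CPi_eqI)
    show "measure_on_CPi (distr \<nu> borel (shift h))"
      unfolding measure_on_CPi_def
    proof
      have "emeasure (distr \<nu> borel (shift h)) (- CPi) = emeasure \<nu> (shift h -` (- CPi) \<inter> space \<nu>)"
        by (rule emeasure_distr) auto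
      also have "shift h -` (- CPi) \<inter> space \<nu> = - CPi" by (auto simp: CPi_shift)
      also have "emeasure \<nu> (- CPi) = 0" using measure_on_CPi_nuZ unfolding measure_on_CPi_def by blast
      finally show "emeasure (distr \<nu> borel (shift h)) (- CPi) = 0" .
    qed simp
    show "boundedly_finite K (distr \<nu> borel (shift h))"
      unfolding boundedly_finite_def
    proof (intro allI impI)
      fix n :: "'q \<Rightarrow> nat" and e :: "real ^ 'q" assume n: "\<forall>i. 1 \<le> n i" and e: "e \<in> posG"
      from windows[OF n, of e] obtain n' where n': "\<forall>i. n' i \<ge> 1"
        "\<forall>f :: ('t, 'q) cfield. shift h f \<in> Uwin K n e \<longrightarrow> f \<in> Uwin K n' e" by blast
      have "emeasure (distr \<nu> borel (shift h)) (Uwin K n e) = emeasure \<nu> (shift h -` Uwin K n e \<inter> space \<nu>)"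
        by (rule emeasure_distr) (auto simp: Uwin_borel[OF n])
      also have "\<dots> \<le> emeasure \<nu> (Uwin K n' e)"
        using n'(2) by (intro emeasure_mono) (auto simp: Uwin_borel[OF n'(1)])
      also have "\<dots> < \<infinity>"
        using boundedly_finite_nuZ n'(1) e unfolding boundedly_finite_def by blast
      finally show "emeasure (distr \<nu> borel (shift h)) (Uwin K n e) < \<infinity>" .
    qed
    fix F :: "('t, 'q) cfield \<Rightarrow> real" assume F: "F \<in> test_functions K"
    then obtain B n e where *: "continuous_on UNIV F" "\<And>f. \<bar>F f\<bar> \<le> B" "\<forall>i. n i \<ge> 1" "e \<in> posG"
      "\<And>f. F f \<noteq> 0 \<Longrightarrow> f \<in> Uwin K n e" by (elim test_functionsE) blast
    have F_meas [measurable]: "F \<in> borel_measurable borel" by (rule borel_measurable_continuous_onI[OF *(1)])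
    from windows[OF *(3), of e] obtain n' where n': "\<forall>i. n' i \<ge> 1"
        "\<forall>f :: ('t, 'q) cfield. shift h f \<in> Uwin K n e \<longrightarrow> f \<in> Uwin K n' e" by blast
    have "(\<lambda>f. F (shift h f)) \<in> test_functions K"
    proof (rule test_functionsI[OF _ *(2) n'(1) *(4)])
      show "continuous_on UNIV (\<lambda>f. F (shift h f))"
        by (rule continuous_on_compose2[OF *(1) continuous_on_shift]) simp
    qed (use n'(2) *(5) in blast)
    from conv[OF this] have "((\<lambda>u. \<integral>f. F (shift h f) \<partial>\<mu> u) \<longlongrightarrow> (\<integral>f. F (shift h f) \<partial>\<nu>)) to_infty" .
    moreover have "\<forall>\<^sub>F u in to_infty. (\<integral>f. F (shift h f) \<partial>\<mu> u) = integral\<^sup>L (\<mu> u) F"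
      using eventually_posG
    proof eventually_elim
      case (elim u)
      show ?case
        using *(5) Uwin_subset_CPi[OF *(3,4)] by (intro integral_mu_shift F_meas elim) blast
    qed
    ultimately have "((\<lambda>u. integral\<^sup>L (\<mu> u) F) \<longlongrightarrow> (\<integral>f. F (shift h f) \<partial>\<nu>)) to_infty"
      by (rule Lim_transform_eventually)
    then have "(\<integral>f. F (shift h f) \<partial>\<nu>) = integral\<^sup>L \<nu> F"
      using tendsto_unique[OF to_infty_neq_bot] conv[OF F] by blast
    then show "integral\<^sup>L (distr \<nu> borel (shift h)) F = integral\<^sup>L \<nu> F"
      by (subst integral_distr) auto
  qed (rule measure_on_CPi_nuZ boundedly_finite_nuZ)+
qed

text \<open>One statement for anchors, with g an absolute point evaluation, and for the sets
  \<open>Owin K n\<close>, with g a supremum. The boundary of A lies where some g_i equals s_i, a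
  null set by homogeneity; A is squeezed between the continuous functions \<phi> and \<psi>, whose
  integrals under the limit measure become arbitrarily close.\<close>

lemma RV_imp_continuity_set_limit:
  fixes g :: "'q \<Rightarrow> ('t, 'q) cfield \<Rightarrow> real" and F :: "('t, 'q) cfield \<Rightarrow> real"
  assumes conv: "\<And>F. F \<in> test_functions K \<Longrightarrow> ((\<lambda>u. integral\<^sup>L (\<mu> u) F) \<longlongrightarrow> integral\<^sup>L \<nu> F) to_infty"
    and g: "\<And>i. continuous_on UNIV (g i)"
    and hom: "\<And>i r f. r \<in> posG \<Longrightarrow> g i (scale r f) = r $ i * g i f"
    and n: "\<forall>i. n i \<ge> 1" and g_le: "\<And>i f. g i f \<le> rho K (n i) i f"
    and s: "s \<in> posG"
    and F: "continuous_on UNIV F" "\<And>f. \<bar>F f\<bar> \<le> B"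
  defines "A \<equiv> {f. \<forall>i. s $ i < g i f}"
  shows "((\<lambda>u. \<integral>f. indicator A f * F f \<partial>\<mu> u) \<longlongrightarrow> (\<integral>f. indicator A f * F f \<partial>\<nu>)) to_infty"
proof -
  have s_pos: "s $ i > 0" for i using s by (simp add: posG_def)
  \<comment> \<open>Half the levels leave room for \<psi>, which is positive slightly below s; a
    single window then supports all approximants.\<close>
  define e :: "real ^ 'q" where "e = (\<chi> i. s $ i / 2)"
  have e: "e \<in> posG" using s_pos by (simp add: e_def posG_def)
  define \<phi> where "\<phi> k f = (\<Prod>i\<in>UNIV. clamp (real k * (g i f / s $ i - 1)))" for k f
  \<comment> \<open>Positivity needs g_i / s_i > 1 - 1/(k + 2). The offset 2 keeps this bound at
    least 1/2 even for k = 0, so the support stays above the levels e.\<close>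
  define \<psi> where "\<psi> k f = (\<Prod>i\<in>UNIV. clamp (1 + (real k + 2) * (g i f / s $ i - 1)))" for k f
  have cont: "continuous_on UNIV (\<phi> k)" "continuous_on UNIV (\<psi> k)" for k
    unfolding \<phi>_def \<psi>_def using s_pos g by (auto intro!: continuous_intros simp: less_imp_neq[symmetric])
  have g_meas [measurable]: "g i \<in> borel_measurable borel" for i by (rule borel_measurable_continuous_onI[OF g])
  have [measurable]: "\<phi> k \<in> borel_measurable borel" "\<psi> k \<in> borel_measurable borel" "F \<in> borel_measurable borel" for k
    by (rule borel_measurable_continuous_onI, rule cont F)+
  have [measurable]: "A \<in> sets borel"
  proof -
    have "A = (\<Inter>i. {f. s $ i < g i f})" by (auto simp: A_def)
    also have "\<dots> \<in> sets borel" by (intro sets.finite_INT) auto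
    finally show ?thesis .
  qed
  have bounds: "0 \<le> \<phi> k f" "\<phi> k f \<le> 1" "0 \<le> \<psi> k f" "\<psi> k f \<le> 1" for k f
    unfolding \<phi>_def \<psi>_def by (rule prod_clamp_bounds)+
  have B: "0 \<le> B" using F(2)[of undefined] by linarith
  have \<phi>_A: "\<phi> k f = 0" if fA: "f \<notin> A" for k f
  proof -
    obtain i where "\<not> s $ i < g i f" using fA by (auto simp: A_def)
    then have "real k * (g i f / s $ i - 1) \<le> 0"
      using s_pos[of i] by (intro mult_nonneg_nonpos) (auto simp: divide_le_eq)
    then have "clamp (real k * (g i f / s $ i - 1)) = 0" by (simp add: clamp_def)
    then show ?thesis unfolding \<phi>_def by (intro prod_zero) auto
  qed
  have \<psi>_A: "\<psi> k f = 1" if "f \<in> A" for k f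
    unfolding \<psi>_def
  proof (intro prod.neutral ballI clamp_eq_1)
    fix i
    have "0 \<le> g i f / s $ i - 1" using that s_pos[of i] by (simp add: A_def le_divide_eq less_imp_le)
    then have "0 \<le> (real k + 2) * (g i f / s $ i - 1)" by (intro mult_nonneg_nonneg) auto
    then show "1 \<le> 1 + (real k + 2) * (g i f / s $ i - 1)" by linarith
  qed
  have A_win: "f \<in> Uwin K n e" if "f \<in> A" for f
    unfolding Uwin_def
  proof (intro CollectI allI)
    fix i
    have "e $ i < s $ i" using s_pos[of i] by (simp add: e_def)
    also have "\<dots> < g i f" using that by (simp add: A_def)
    also have "\<dots> \<le> rho K (n i) i f" by (rule g_le)
    finally show "e $ i < rho K (n i) i f" .
  qed
  have \<phi>_win: "f \<in> Uwin K n e" if "\<phi> k f \<noteq> 0" for k f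
    using A_win \<phi>_A that by blast
  have \<psi>_win: "f \<in> Uwin K n e" if "\<psi> k f \<noteq> 0" for k f
    unfolding Uwin_def
  proof (intro CollectI allI)
    fix i
    have "1 + (real k + 2) * (g i f / s $ i - 1) > 0"
      using that unfolding \<psi>_def prod_clamp_nonzero_iff[OF finite_class.finite_UNIV] by blast
    have "1 / 2 < g i f / s $ i"
    proof (rule ccontr)
      assume "\<not> ?thesis"
      then have "(real k + 2) * (g i f / s $ i - 1) \<le> (real k + 2) * (- (1 / 2))"
        by (intro mult_left_mono; linarith)
      also have "\<dots> \<le> -1" by simp
      finally show False using \<open>1 + (real k + 2) * (g i f / s $ i - 1) > 0\<close> by linarith
    qed
    then have "e $ i < g i f" using s_pos[of i] by (simp add: e_def field_simps)
    also have "\<dots> \<le> rho K (n i) i f" by (rule g_le)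
    finally show "e $ i < rho K (n i) i f" .
  qed
  have test_\<phi>: "(\<lambda>f. \<phi> k f * F f) \<in> test_functions K" for k
  proof (rule test_functionsI[OF _ _ n e, where B = B])
    show "continuous_on UNIV (\<lambda>f. \<phi> k f * F f)" by (intro continuous_intros cont F)
    show "\<bar>\<phi> k f * F f\<bar> \<le> B" for f
      using mult_mono[OF bounds(2)[of k f] F(2)[of f]] bounds(1)[of k f] by (simp add: abs_mult)
  qed (use \<phi>_win in auto)
  have test_d: "(\<lambda>f. B * (\<psi> k f - \<phi> k f)) \<in> test_functions K" for k
  proof (rule test_functionsI[OF _ _ n e, where B = B])
    show "continuous_on UNIV (\<lambda>f. B * (\<psi> k f - \<phi> k f))" by (intro continuous_intros cont)
    show "\<bar>B * (\<psi> k f - \<phi> k f)\<bar> \<le> B" for f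
    proof -
      have "\<bar>\<psi> k f - \<phi> k f\<bar> \<le> 1" using bounds[of k f] by linarith
      then show ?thesis using B mult_left_mono[of "\<bar>\<psi> k f - \<phi> k f\<bar>" 1 B] by (simp add: abs_mult)
    qed
    show "f \<in> Uwin K n e" if "B * (\<psi> k f - \<phi> k f) \<noteq> 0" for f
      using that \<phi>_win[of k f] \<psi>_win[of k f] by (cases "\<phi> k f = 0") auto
  qed
  have dom: "integrable \<nu> (\<lambda>f. B * indicator (Uwin K n e) f)"
  proof (rule integrable_nu[OF _ _ n e, where B = B])
    show "(\<lambda>f. B * indicator (Uwin K n e) f) \<in> borel_measurable borel"
      using Uwin_borel[OF n] by measurable
  qed (use B in \<open>auto simp: indicator_def\<close>)
  have \<phi>_lim: "(\<lambda>k. \<phi> k f) \<longlonglongrightarrow> indicator A f" for f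
  proof (cases "f \<in> A")
    case True
    have "\<forall>\<^sub>F k in sequentially. clamp (real k * (g i f / s $ i - 1)) = 1" for i
    proof -
      have d: "g i f / s $ i - 1 > 0" using True s_pos[of i] by (simp add: A_def)
      have "filterlim (\<lambda>k. (g i f / s $ i - 1) * real k) at_top sequentially"
        by (rule filterlim_tendsto_pos_mult_at_top[OF tendsto_const d filterlim_real_sequentially])
      then have "\<forall>\<^sub>F k in sequentially. 1 \<le> (g i f / s $ i - 1) * real k"
        unfolding filterlim_at_top by blast
      then show ?thesis by eventually_elim (simp add: clamp_eq_1 mult.commute)
    qed
    then have "\<forall>\<^sub>F k in sequentially. \<forall>i. clamp (real k * (g i f / s $ i - 1)) = 1"
      by (rule eventually_all_finite)
    then have "\<forall>\<^sub>F k in sequentially. \<phi> k f = indicator A f"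
      by eventually_elim (simp add: \<phi>_def True)
    then show ?thesis by (rule tendsto_eventually)
  qed (simp add: \<phi>_A)
  have \<psi>_lim: "(\<lambda>k. \<psi> k f) \<longlonglongrightarrow> indicator A f" if ne: "\<forall>i. g i f \<noteq> s $ i" for f
  proof (cases "f \<in> A")
    case False
    then obtain i where "\<not> s $ i < g i f" by (auto simp: A_def)
    then have d: "1 - g i f / s $ i > 0" using ne[rule_format, of i] s_pos[of i] by simp
    have "filterlim (\<lambda>k. (1 - g i f / s $ i) * real k) at_top sequentially"
      by (rule filterlim_tendsto_pos_mult_at_top[OF tendsto_const d filterlim_real_sequentially])
    then have "\<forall>\<^sub>F k in sequentially. 1 \<le> (1 - g i f / s $ i) * real k"
      unfolding filterlim_at_top by blast
    then have "\<forall>\<^sub>F k in sequentially. \<psi> k f = indicator A f"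
    proof eventually_elim
      case (elim k)
      define c where "c = 1 - g i f / s $ i"
      have "0 < c" "1 \<le> c * real k" using elim d by (simp_all add: c_def)
      then have "1 + (real k + 2) * (- c) \<le> 0" by (simp add: algebra_simps)
      also have "- c = g i f / s $ i - 1" by (simp add: c_def)
      finally have "1 + (real k + 2) * (g i f / s $ i - 1) \<le> 0" .
      then have "clamp (1 + (real k + 2) * (g i f / s $ i - 1)) = 0" by (simp add: clamp_def)
      then have "\<psi> k f = 0" unfolding \<psi>_def by (intro prod_zero) auto
      then show ?case using False by simp
    qed
    then show ?thesis by (rule tendsto_eventually)
  qed (simp add: \<psi>_A)
  \<comment> \<open>On a field with g_i(f) = s_i for some i, \<psi> need not tend to the indicator;
    such fields are negligible because the levels are nonzero.\<close>
  have ne: "AE f in \<nu>. \<forall>i. g i f \<noteq> s $ i"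
    using AE_nuZ_level[OF g_meas hom] s_pos by (intro AE_finite_allI[of UNIV, simplified]) (auto simp: less_imp_neq[symmetric])
  show ?thesis
  proof (rule tendsto_approx)
    fix k
    show "((\<lambda>u. \<integral>f. \<phi> k f * F f \<partial>\<mu> u) \<longlongrightarrow> (\<integral>f. \<phi> k f * F f \<partial>\<nu>)) to_infty"
      by (rule conv[OF test_\<phi>])
    show "((\<lambda>u. \<integral>f. B * (\<psi> k f - \<phi> k f) \<partial>\<mu> u) \<longlongrightarrow> (\<integral>f. B * (\<psi> k f - \<phi> k f) \<partial>\<nu>)) to_infty"
      by (rule conv[OF test_d])
    \<comment> \<open>As \<phi> <= 1_A <= \<psi> and |F| <= B, the error is dominated by the
      integral of a test function, whose limit in u is known.\<close>
    show "\<forall>\<^sub>F u in to_infty. \<bar>(\<integral>f. indicator A f * F f \<partial>\<mu> u) - (\<integral>f. \<phi> k f * F f \<partial>\<mu> u)\<bar>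
        \<le> (\<integral>f. B * (\<psi> k f - \<phi> k f) \<partial>\<mu> u)"
    proof (rule always_eventually, rule allI)
      fix u
      have i1: "integrable (\<mu> u) (\<lambda>f. indicator A f * F f)"
        by (rule integrable_mu[where B = B]) (use F(2) B in \<open>auto simp: indicator_def\<close>)
      have i2: "integrable (\<mu> u) (\<lambda>f. \<phi> k f * F f)"
        by (rule integrable_mu[where B = B])
          (use mult_mono[OF bounds(2)[of k] F(2)] bounds(1)[of k] in \<open>auto simp: abs_mult\<close>)
      have i3: "integrable (\<mu> u) (\<lambda>f. B * (\<psi> k f - \<phi> k f))"
      proof -
        have "integrable (\<mu> u) (\<psi> k)" "integrable (\<mu> u) (\<phi> k)"
          by (rule integrable_mu[where B = 1]; use bounds[of k] in simp)+
        then show ?thesis by (intro integrable_mult_right Bochner_Integration.integrable_diff)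
      qed
      have "\<bar>(\<integral>f. indicator A f * F f \<partial>\<mu> u) - (\<integral>f. \<phi> k f * F f \<partial>\<mu> u)\<bar>
          = \<bar>\<integral>f. indicator A f * F f - \<phi> k f * F f \<partial>\<mu> u\<bar>"
        by (simp add: Bochner_Integration.integral_diff[OF i1 i2])
      also have "\<dots> \<le> (\<integral>f. \<bar>indicator A f * F f - \<phi> k f * F f\<bar> \<partial>\<mu> u)"
        by (rule integral_abs_bound)
      also have "\<dots> \<le> (\<integral>f. B * (\<psi> k f - \<phi> k f) \<partial>\<mu> u)"
      proof (rule integral_mono)
        show "integrable (\<mu> u) (\<lambda>f. \<bar>indicator A f * F f - \<phi> k f * F f\<bar>)"
          by (intro integrable_abs Bochner_Integration.integrable_diff i1 i2)
        show "\<bar>indicator A f * F f - \<phi> k f * F f\<bar> \<le> B * (\<psi> k f - \<phi> k f)" for f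
        proof (cases "f \<in> A")
          case True
          have "indicator A f * F f - \<phi> k f * F f = F f * (1 - \<phi> k f)"
            using True by (simp add: algebra_simps)
          then have "\<bar>indicator A f * F f - \<phi> k f * F f\<bar> = \<bar>F f\<bar> * (1 - \<phi> k f)"
            using bounds(2)[of k f] by (simp add: abs_mult)
          also have "\<dots> \<le> B * (1 - \<phi> k f)" using bounds(2)[of k f] F(2) by (intro mult_right_mono) auto
          finally show ?thesis using \<psi>_A[OF True] by simp
        next
          case False
          then show ?thesis using \<phi>_A[OF False] bounds(3)[of k f] B by simp
        qed
      qed (rule i3)
      finally show "\<bar>(\<integral>f. indicator A f * F f \<partial>\<mu> u) - (\<integral>f. \<phi> k f * F f \<partial>\<mu> u)\<bar>
        \<le> (\<integral>f. B * (\<psi> k f - \<phi> k f) \<partial>\<mu> u)" .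
    qed
  next
    show "(\<lambda>k. \<integral>f. \<phi> k f * F f \<partial>\<nu>) \<longlonglongrightarrow> (\<integral>f. indicator A f * F f \<partial>\<nu>)"
    proof (rule integral_dominated_convergence[OF _ _ dom])
      show "AE f in \<nu>. (\<lambda>k. \<phi> k f * F f) \<longlonglongrightarrow> indicator A f * F f"
        by (intro AE_I2 tendsto_intros \<phi>_lim)
      show "AE f in \<nu>. norm (\<phi> k f * F f) \<le> B * indicator (Uwin K n e) f" for k
      proof (rule AE_I2)
        fix f
        show "norm (\<phi> k f * F f) \<le> B * indicator (Uwin K n e) f"
          using mult_mono[OF bounds(2)[of k f] F(2)[of f]] bounds(1)[of k f] \<phi>_win[of k f]
          by (cases "\<phi> k f = 0") (auto simp: abs_mult indicator_def B)
      qed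
    qed measurable
    have "(\<lambda>k. \<integral>f. B * (\<psi> k f - \<phi> k f) \<partial>\<nu>) \<longlonglongrightarrow> (\<integral>f. 0 \<partial>\<nu>)"
    proof (rule integral_dominated_convergence[OF _ _ dom])
      show "AE f in \<nu>. (\<lambda>k. B * (\<psi> k f - \<phi> k f)) \<longlonglongrightarrow> 0"
        using ne
      proof eventually_elim
        case (elim f)
        have "(\<lambda>k. B * (\<psi> k f - \<phi> k f)) \<longlonglongrightarrow> B * (indicator A f - indicator A f)"
          by (intro tendsto_intros \<phi>_lim \<psi>_lim elim)
        then show ?case by simp
      qed
      show "AE f in \<nu>. norm (B * (\<psi> k f - \<phi> k f)) \<le> B * indicator (Uwin K n e) f" for k
      proof (rule AE_I2)
        fix f
        have "\<bar>\<psi> k f - \<phi> k f\<bar> \<le> indicator (Uwin K n e) f"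
        proof (cases "f \<in> Uwin K n e")
          case True
          then show ?thesis using bounds[of k f] by (simp add: abs_le_iff)
        next
          case False
          then have "\<phi> k f = 0" "\<psi> k f = 0" using \<phi>_win \<psi>_win by blast+
          then show ?thesis by simp
        qed
        then show "norm (B * (\<psi> k f - \<phi> k f)) \<le> B * indicator (Uwin K n e) f"
          using B by (simp add: abs_mult mult_left_mono)
      qed
    qed measurable
    then show "(\<lambda>k. \<integral>f. B * (\<psi> k f - \<phi> k f) \<partial>\<nu>) \<longlonglongrightarrow> 0" by simp
  qed
qed

section \<open>Anchors as continuity sets of the limit\<close>

lemma weak_limit_restrict_iff:
  fixes A :: "('t, 'q) cfield set"
  assumes A: "A \<in> sets borel" and fin: "emeasure \<nu> A < \<infinity>"
  shows "weak_limit (\<lambda>u. restrict_meas A (\<mu> u)) (restrict_meas A \<nu>) to_infty \<longleftrightarrow>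
    (\<forall>F :: ('t, 'q) cfield \<Rightarrow> real. continuous_on UNIV F \<longrightarrow> bounded (range F) \<longrightarrow>
      ((\<lambda>u. \<integral>f. indicator A f * F f \<partial>\<mu> u) \<longlongrightarrow> (\<integral>f. indicator A f * F f \<partial>\<nu>)) to_infty)"
proof -
  have "finite_measure (restrict_meas A (\<mu> u))" for u
    using emeasure_restrict_meas_space[OF sets_mu A, of b M X u] finite_measure.emeasure_finite[OF finite_measure_mu', of u A]
    by (intro finite_measureI) simp
  moreover have "finite_measure (restrict_meas A \<nu>)"
    using emeasure_restrict_meas_space[OF sets_nuZ A] fin by (intro finite_measureI) simp
  ultimately show ?thesis
    unfolding weak_limit_def
    using integral_restrict_meas[OF sets_mu A borel_measurable_continuous_onI, of _ b M X]
      integral_restrict_meas[OF sets_nuZ A borel_measurable_continuous_onI]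
    by simp
qed

text \<open>Overwrites the irrelevant value at \<open>p\<close> by the origin, so that all
  coordinates of an anchor are described by the same formula.\<close>

definition anchor_point :: "'q \<Rightarrow> ('q \<Rightarrow> 't) \<Rightarrow> 'q \<Rightarrow> 't" where
  "anchor_point p l i = (if i = p then 0 else l i)"

lemma anchor_eq: "anchor p l = {f :: ('t, 'q) cfield. \<forall>i. 1 < \<bar>fval f (anchor_point p l i) $ i\<bar>}"
  unfolding anchor_def anchor_point_def by auto

text \<open>A point lies in some \<open>K n\<close>, so its evaluation is dominated by the
  corresponding supremum. Sets defined by finitely many evaluations, one in each coordinate, are
  thereby placed inside windows.\<close>

lemma ex_window_index:
  "\<exists>n. (\<forall>i. n i \<ge> 1) \<and> (\<forall>i (f :: ('t, 'q) cfield). \<bar>fval f (t i) $ i\<bar> \<le> rho K (n i) i f)"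
proof -
  have "\<exists>n\<ge>1. t i \<in> K n" for i using K_absorbs[OF compact_sing, of "t i"] by simp
  then obtain n where n: "\<And>i. n i \<ge> 1" "\<And>i. t i \<in> K (n i)" by metis
  then show ?thesis by (intro exI[of _ n]) (simp add: rho_ge)
qed

lemma anchor_borel: "(anchor p l :: ('t, 'q) cfield set) \<in> sets borel"
proof -
  have m: "(\<lambda>f :: ('t, 'q) cfield. \<bar>fval f t $ i\<bar>) \<in> borel_measurable borel" for t i
    by (intro borel_measurable_continuous_onI continuous_intros)
  have "anchor p l = (\<Inter>i. {f :: ('t, 'q) cfield. 1 < \<bar>fval f (anchor_point p l i) $ i\<bar>})"
    unfolding anchor_eq by auto
  also have "\<dots> \<in> sets borel" using m by (intro sets.finite_INT) auto
  finally show ?thesis .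
qed

lemma emeasure_anchor_finite: "emeasure \<nu> (anchor p l) < \<infinity>"
proof -
  obtain n where n: "\<forall>i. n i \<ge> 1"
    "\<And>i (f :: ('t, 'q) cfield). \<bar>fval f (anchor_point p l i) $ i\<bar> \<le> rho K (n i) i f"
    using ex_window_index[of "anchor_point p l"] by blast
  have one: "(\<chi> i. 1) \<in> (posG :: (real ^ 'q) set)" by (simp add: posG_def)
  have "emeasure \<nu> (anchor p l) \<le> emeasure \<nu> (Uwin K n (\<chi> i. 1))"
  proof (rule emeasure_mono)
    show "anchor p l \<subseteq> Uwin K n (\<chi> i. 1)"
      using n(2) by (auto simp: anchor_eq Uwin_def intro: less_le_trans)
  qed (simp add: Uwin_borel[OF n(1)])
  also have "\<dots> < \<infinity>" using boundedly_finite_nuZ n(1) one unfolding boundedly_finite_def by blast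
  finally show ?thesis .
qed

lemma RV_imp_anchored_convergence:
  assumes conv: "\<And>F. F \<in> test_functions K \<Longrightarrow> ((\<lambda>u. integral\<^sup>L (\<mu> u) F) \<longlongrightarrow> integral\<^sup>L \<nu> F) to_infty"
  shows "anchored_convergence p D \<mu> \<nu>"
  unfolding anchored_convergence_def weak_limit_restrict_iff[OF anchor_borel emeasure_anchor_finite]
proof (intro allI impI)
  fix l :: "'q \<Rightarrow> 't" and F :: "('t, 'q) cfield \<Rightarrow> real"
  assume F: "continuous_on UNIV F" "bounded (range F)"
  obtain B where B: "\<And>f. \<bar>F f\<bar> \<le> B" using F(2) unfolding bounded_iff by auto
  obtain n where n: "\<forall>i. n i \<ge> 1"
    "\<And>i (f :: ('t, 'q) cfield). \<bar>fval f (anchor_point p l i) $ i\<bar> \<le> rho K (n i) i f"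
    using ex_window_index[of "anchor_point p l"] by blast
  have one: "(\<chi> i. 1) \<in> (posG :: (real ^ 'q) set)" by (simp add: posG_def)
  have cont: "continuous_on UNIV (\<lambda>f :: ('t, 'q) cfield. \<bar>fval f (anchor_point p l i) $ i\<bar>)" for i
    by (intro continuous_intros)
  have hom: "\<bar>fval (scale r f) (anchor_point p l i) $ i\<bar> = r $ i * \<bar>fval f (anchor_point p l i) $ i\<bar>"
    if "r \<in> posG" for i r and f :: "('t, 'q) cfield"
    using that by (simp add: fval_scale abs_mult posG_def less_imp_le)
  show "((\<lambda>u. \<integral>f. indicator (anchor p l) f * F f \<partial>\<mu> u) \<longlongrightarrow> (\<integral>f. indicator (anchor p l) f * F f \<partial>\<nu>)) to_infty"
    using RV_imp_continuity_set_limit[OF conv cont hom n one F(1) B]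
    unfolding anchor_eq by simp
qed

lemma Owin_borel [measurable]: "n \<ge> 1 \<Longrightarrow> (Owin K n :: ('t, 'q) cfield set) \<in> sets borel"
  unfolding Owin_eq by (rule Uwin_borel) simp

lemma emeasure_Owin_finite: "n \<ge> 1 \<Longrightarrow> emeasure \<nu> (Owin K n) < \<infinity>"
  using boundedly_finite_nuZ one_over_posG[of n] unfolding Owin_eq boundedly_finite_def by auto

text \<open>The suprema \<open>rho K n i\<close> are continuous and homogeneous in their own
  coordinate, so \<open>Owin K n\<close> is a continuity set and its masses actually converge; the
  stated inequality is the part required.\<close>

lemma RV_imp_Limsup_Owin:
  assumes conv: "\<And>F. F \<in> test_functions K \<Longrightarrow> ((\<lambda>u. integral\<^sup>L (\<mu> u) F) \<longlongrightarrow> integral\<^sup>L \<nu> F) to_infty"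
    and n: "n \<ge> 1"
  shows "Limsup to_infty (\<lambda>u. emeasure (\<mu> u) (Owin K n)) \<le> emeasure \<nu> (Owin K n)"
proof -
  have "((\<lambda>u. \<integral>f. indicator {f. \<forall>i. (\<chi> i. 1 / real n) $ i < rho K n i f} f * (1::real) \<partial>\<mu> u)
      \<longlongrightarrow> (\<integral>f. indicator {f. \<forall>i. (\<chi> i. 1 / real n) $ i < rho K n i f} f * (1::real) \<partial>\<nu>)) to_infty"
  proof (rule RV_imp_continuity_set_limit[OF conv, where n = "\<lambda>_. n" and B = 1])
    show "rho K n i (scale r f) = r $ i * rho K n i f" if "r \<in> posG" for i r and f :: "('t, 'q) cfield"
      using that n by (intro rho_scale) (simp_all add: posG_def)
  qed (use n one_over_posG[OF n] in \<open>auto intro!: continuous_intros\<close>)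
  moreover have "{f. \<forall>i. (\<chi> i. 1 / real n) $ i < rho K n i f} = (Owin K n :: ('t, 'q) cfield set)"
    unfolding Owin_eq[OF n] Uwin_def ..
  ultimately have "((\<lambda>u. measure (\<mu> u) (Owin K n)) \<longlongrightarrow> measure \<nu> (Owin K n)) to_infty"
    by simp
  then have "((\<lambda>u. ennreal (measure (\<mu> u) (Owin K n))) \<longlongrightarrow> ennreal (measure \<nu> (Owin K n))) to_infty"
    by (rule tendsto_ennrealI)
  then have "((\<lambda>u. emeasure (\<mu> u) (Owin K n)) \<longlongrightarrow> emeasure \<nu> (Owin K n)) to_infty"
    using emeasure_Owin_finite[OF n]
    by (simp add: finite_measure.emeasure_eq_measure[OF finite_measure_mu'] emeasure_eq_ennreal_measure)
  then show ?thesis using lim_imp_Limsup[OF to_infty_neq_bot] by fastforce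
qed

section \<open>Sufficiency\<close>

text \<open>Closure of \<open>D\<close> under differences keeps lags between positions of
  \<open>D\<close> inside \<open>D\<close>. It holds for the whole group and for the rational
  points.\<close>

context
  fixes D :: "'t set" and p :: 'q
  assumes shift_inv: "shift_invariant \<nu>"
    and anchored: "anchored_convergence p D \<mu> \<nu>"
    and D_diff: "\<And>x y. x \<in> D \<Longrightarrow> y \<in> D \<Longrightarrow> x - y \<in> D"
begin

text \<open>A tuple of positions and levels is moved to an anchor by a common shift, under which
  both sides are invariant, and by a scaling, which multiplies both sides by the same
  limiting factor.\<close>

lemma anchored_tuple_limit:
  fixes G :: "('t, 'q) cfield \<Rightarrow> real"
  assumes t: "\<And>i. t i \<in> D" and s: "s \<in> posG"
    and G: "continuous_on UNIV G" "\<And>f. \<bar>G f\<bar> \<le> B"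
    and supp: "\<And>f i. G f \<noteq> 0 \<Longrightarrow> s $ i < \<bar>fval f (t i) $ i\<bar>"
  shows "((\<lambda>u. integral\<^sup>L (\<mu> u) G) \<longlongrightarrow> integral\<^sup>L \<nu> G) to_infty"
proof -
  have s_pos: "s $ i > 0" for i using s by (simp add: posG_def)
  \<comment> \<open>The lags relative to the position of coordinate \<open>p\<close>; a shift by
    \<open>t p\<close> sends the origin to \<open>t p\<close> and the lags to the given
    positions.\<close>
  define l where "l i = t i - t p" for i
  define G' where "G' f = G (scale s (shift (t p) f))" for f
  define A where "A = (anchor p l :: ('t, 'q) cfield set)"
  have G_meas [measurable]: "G \<in> borel_measurable borel" by (rule borel_measurable_continuous_onI[OF G(1)])
  have G'_cont: "continuous_on UNIV G'"
    unfolding G'_def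
    by (rule continuous_on_compose2[OF G(1)], rule continuous_on_compose2[OF continuous_on_scale continuous_on_shift]) auto
  have G'_A: "f \<in> A" if "G' f \<noteq> 0" for f
  proof -
    have "1 < \<bar>fval f (t i - t p) $ i\<bar>" for i
    proof -
      have "s $ i * 1 < s $ i * \<bar>fval f (t i - t p) $ i\<bar>"
        using supp[of "scale s (shift (t p) f)" i] that s_pos[of i]
        by (simp add: G'_def fval_scale fval_shift abs_mult)
      then show ?thesis using s_pos[of i] by (simp only: mult_less_cancel_left_pos)
    qed
    then show ?thesis unfolding A_def anchor_eq anchor_point_def l_def
      by (auto dest: spec[of _ p] simp: all_conj_distrib) (metis cancel_comm_monoid_add_class.diff_cancel)
  qed
  \<comment> \<open>The transformed function already vanishes off the anchor, so the restricted
    integrals in the hypothesis are full integrals.\<close>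
  have ind: "indicator A f * G' f = G' f" for f using G'_A[of f] by (auto simp: indicator_def)
  have "((\<lambda>u. integral\<^sup>L (\<mu> u) G') \<longlongrightarrow> integral\<^sup>L \<nu> G') to_infty"
  proof -
    have "bounded (range G')" using G(2) by (auto simp: bounded_iff G'_def)
    moreover have "\<forall>i. i \<noteq> p \<longrightarrow> l i \<in> D" using D_diff t by (simp add: l_def)
    ultimately show ?thesis
      using anchored G'_cont
      unfolding anchored_convergence_def weak_limit_restrict_iff[OF anchor_borel emeasure_anchor_finite]
      by (auto simp: ind[unfolded A_def] dest!: spec[of _ l] spec[of _ G'])
  qed
  then have lim1: "((\<lambda>u. integral\<^sup>L (\<mu> (\<chi> i. s $ i * u $ i)) G') \<longlongrightarrow> integral\<^sup>L \<nu> G') to_infty"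
    by (rule filterlim_compose[OF _ filterlim_scale_to_infty[OF s]])
  have G_CPi: "f \<in> CPi" if "G f \<noteq> 0" for f
  proof -
    have "fval f (t i) $ i \<noteq> 0" for i using supp[OF that, of i] s_pos[of i] by auto
    then show ?thesis unfolding CPi_def by blast
  qed
  have lim2: "((\<lambda>u. a u / a (\<chi> i. s $ i * u $ i)) \<longlongrightarrow> inverse (\<Prod>i\<in>UNIV. s $ i powr \<alpha> $ i)) to_infty"
    using regularly_varying_prod[OF s b_rv] unfolding a_def by simp
  have lim3: "((\<lambda>u. a u / a (\<chi> i. s $ i * u $ i) * integral\<^sup>L (\<mu> (\<chi> i. s $ i * u $ i)) G')
      \<longlongrightarrow> inverse (\<Prod>i\<in>UNIV. s $ i powr \<alpha> $ i) * integral\<^sup>L \<nu> G') to_infty"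
    by (rule tendsto_mult[OF lim2 lim1])
  \<comment> \<open>An exact identity for positive u: stationarity removes the shift and the change
    of threshold removes the scaling.\<close>
  have ev: "\<forall>\<^sub>F u in to_infty.
      a u / a (\<chi> i. s $ i * u $ i) * integral\<^sup>L (\<mu> (\<chi> i. s $ i * u $ i)) G' = integral\<^sup>L (\<mu> u) G"
    using eventually_posG
  proof eventually_elim
    case (elim u)
    then have v: "(\<chi> i. s $ i * u $ i) \<in> posG" using s_pos by (simp add: posG_def)
    have "integral\<^sup>L (\<mu> (\<chi> i. s $ i * u $ i)) G' = (\<integral>f. G (scale s f) \<partial>\<mu> (\<chi> i. s $ i * u $ i))"
      unfolding G'_def
      by (rule integral_mu_shift[where F = "\<lambda>f. G (scale s f)", OF _ _ v])
        (use G_CPi CPi_scale[OF s] in auto)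
    then show ?case using integral_mu_scale[OF G_meas G_CPi s elim] by simp
  qed
  \<comment> \<open>Shift-invariance and homogeneity of the limit produce exactly the reciprocal of
    the factor that regular variation produces before the limit.\<close>
  have eq: "inverse (\<Prod>i\<in>UNIV. s $ i powr \<alpha> $ i) * integral\<^sup>L \<nu> G' = integral\<^sup>L \<nu> G"
  proof -
    have "integral\<^sup>L \<nu> G' = integral\<^sup>L (distr \<nu> borel (shift (t p))) (\<lambda>f. G (scale s f))"
      unfolding G'_def by (rule integral_distr[symmetric]) measurable
    also have "distr \<nu> borel (shift (t p)) = \<nu>"
      using shift_inv unfolding shift_invariant_def by blast
    also have "(\<integral>f. G (scale s f) \<partial>\<nu>) = (\<Prod>i\<in>UNIV. s $ i powr \<alpha> $ i) * integral\<^sup>L \<nu> G"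
      by (rule integral_nuZ_scale[OF s G_meas])
    finally show ?thesis using s_pos by (simp add: less_imp_neq[symmetric])
  qed
  show ?thesis using Lim_transform_eventually[OF lim3 ev] unfolding eq .
qed

text \<open>Different coordinates may be large at different positions of \<open>E\<close>, so the
  partition of unity is indexed by all maps from coordinates to \<open>E\<close>, not by
  \<open>E\<close> itself. Each piece has fixed positions and converges by the result for
  tuples.\<close>

lemma finite_positions_limit:
  fixes G :: "('t, 'q) cfield \<Rightarrow> real"
  assumes E: "finite E" "E \<subseteq> D" and s: "s \<in> posG"
    and G: "continuous_on UNIV G" "\<And>f. \<bar>G f\<bar> \<le> B"
    and supp: "\<And>f i. G f \<noteq> 0 \<Longrightarrow> \<exists>t\<in>E. s $ i < \<bar>fval f t $ i\<bar>"
  shows "((\<lambda>u. integral\<^sup>L (\<mu> u) G) \<longlongrightarrow> integral\<^sup>L \<nu> G) to_infty"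
proof -
  have s_pos: "s $ i > 0" for i using s by (simp add: posG_def)
  \<comment> \<open>The bumps equal 1 above level s and vanish below s/2, so the pieces are
    supported at the halved levels.\<close>
  define s' :: "real ^ 'q" where "s' = (\<chi> i. s $ i / 2)"
  have s': "s' \<in> posG" using s_pos by (simp add: s'_def posG_def)
  define T where "T = PiE (UNIV :: 'q set) (\<lambda>_. E)"
  have T: "finite T" unfolding T_def using E(1) by (intro finite_PiE) auto
  have T_D: "t i \<in> D" if "t \<in> T" for t i using that E(2) unfolding T_def by auto
  define \<psi> where "\<psi> t f = (\<Prod>i\<in>UNIV. clamp (\<bar>fval f (t i) $ i\<bar> * 2 / s $ i - 1))"
    for t and f :: "('t, 'q) cfield"
  have \<psi>_cont: "continuous_on UNIV (\<psi> t)" for t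
    unfolding \<psi>_def using s_pos by (auto intro!: continuous_intros simp: less_imp_neq[symmetric])
  have \<psi>_bounds: "0 \<le> \<psi> t f" "\<psi> t f \<le> 1" for t f unfolding \<psi>_def by (rule prod_clamp_bounds)+
  \<comment> \<open>The maximum with 1 makes the denominator positive and continuous everywhere.
    Where G is nonzero some bump equals 1, so there the denominator is the sum itself and the
    weights add up to 1.\<close>
  define H where "H t f = G f * (\<psi> t f / max 1 (\<Sum>t\<in>T. \<psi> t f))" for t f
  have H_cont: "continuous_on UNIV (H t)" for t
    unfolding H_def by (intro continuous_intros G \<psi>_cont) (auto simp: max_def)
  have H_bound: "\<bar>H t f\<bar> \<le> B" for t f
  proof -
    have "\<psi> t f / max 1 (\<Sum>t\<in>T. \<psi> t f) \<le> 1" "0 \<le> \<psi> t f / max 1 (\<Sum>t\<in>T. \<psi> t f)"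
      using \<psi>_bounds[of t f] by (auto simp: divide_le_eq le_max_iff_disj)
    then have "\<bar>\<psi> t f / max 1 (\<Sum>t\<in>T. \<psi> t f)\<bar> \<le> 1" by linarith
    then have "\<bar>G f\<bar> * \<bar>\<psi> t f / max 1 (\<Sum>t\<in>T. \<psi> t f)\<bar> \<le> \<bar>G f\<bar> * 1"
      by (rule mult_left_mono) simp
    then show ?thesis using G(2)[of f] unfolding H_def abs_mult by linarith
  qed
  have H_supp: "s' $ i < \<bar>fval f (t i) $ i\<bar>" if "H t f \<noteq> 0" for t f i
  proof -
    have "\<psi> t f \<noteq> 0" using that by (auto simp: H_def)
    then have "0 < \<bar>fval f (t i) $ i\<bar> * 2 / s $ i - 1"
      unfolding \<psi>_def prod_clamp_nonzero_iff[OF finite_class.finite_UNIV] by blast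
    then show ?thesis using s_pos[of i] by (simp add: s'_def field_simps)
  qed
  have G_eq: "G f = (\<Sum>t\<in>T. H t f)" for f
  proof (cases "G f = 0")
    case False
    have "\<forall>i. \<exists>x. x \<in> E \<and> s $ i < \<bar>fval f x $ i\<bar>" using supp[OF False] by blast
    then obtain t where t: "\<And>i. t i \<in> E" "\<And>i. s $ i < \<bar>fval f (t i) $ i\<bar>" by metis
    have "t \<in> T" using t(1) by (simp add: T_def PiE_iff)
    have "\<psi> t f = 1"
      unfolding \<psi>_def
    proof (intro prod.neutral ballI clamp_eq_1)
      fix i show "1 \<le> \<bar>fval f (t i) $ i\<bar> * 2 / s $ i - 1"
        using t(2)[of i] s_pos[of i] by (simp add: field_simps)
    qed
    then have "1 \<le> (\<Sum>t\<in>T. \<psi> t f)"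
      using member_le_sum[OF \<open>t \<in> T\<close>, of "\<lambda>t. \<psi> t f"] \<psi>_bounds T by simp
    then have "(\<Sum>t\<in>T. \<psi> t f / max 1 (\<Sum>t\<in>T. \<psi> t f)) = 1"
      by (simp add: sum_divide_distrib[symmetric] max_def)
    then show ?thesis unfolding H_def sum_distrib_left[symmetric] by simp
  qed (simp add: H_def)
  have H_meas: "H t \<in> borel_measurable borel" for t by (rule borel_measurable_continuous_onI[OF H_cont])
  have int_mu: "integral\<^sup>L (\<mu> u) G = (\<Sum>t\<in>T. integral\<^sup>L (\<mu> u) (H t))" for u
    unfolding G_eq[abs_def] using integrable_mu[OF H_meas H_bound] by (intro Bochner_Integration.integral_sum)
  have int_nu: "integral\<^sup>L \<nu> G = (\<Sum>t\<in>T. integral\<^sup>L \<nu> (H t))"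
    unfolding G_eq[abs_def]
  proof (rule Bochner_Integration.integral_sum)
    fix t
    obtain n where n: "\<forall>i. n i \<ge> 1"
      "\<And>i (f :: ('t, 'q) cfield). \<bar>fval f (t i) $ i\<bar> \<le> rho K (n i) i f"
      using ex_window_index[of t] by blast
    show "integrable \<nu> (\<lambda>f. H t f)"
    proof (rule integrable_nu[OF H_meas H_bound n(1) s'])
      show "f \<in> Uwin K n s'" if "H t f \<noteq> 0" for f
        using H_supp[OF that] n(2) by (auto simp: Uwin_def intro: less_le_trans)
    qed
  qed
  show ?thesis
    unfolding int_mu int_nu
    by (intro tendsto_sum anchored_tuple_limit[OF T_D s' H_cont H_bound H_supp])
qed

text \<open>Compact sets being finite, a window involves only finitely many positions, and no bound
  on escaping mass is called for.\<close>

lemma discrete_RV_limit: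
  assumes "D = UNIV" and fin: "\<And>C :: 't set. compact C \<Longrightarrow> finite C" and F: "F \<in> test_functions K"
  shows "((\<lambda>u. integral\<^sup>L (\<mu> u) F) \<longlongrightarrow> integral\<^sup>L \<nu> F) to_infty"
proof -
  obtain B n e where *: "continuous_on UNIV F" "\<And>f. \<bar>F f\<bar> \<le> B" "\<forall>i. n i \<ge> 1" "e \<in> posG"
    "\<And>f. F f \<noteq> 0 \<Longrightarrow> f \<in> Uwin K n e" using F by (elim test_functionsE) blast
  show ?thesis
  proof (rule finite_positions_limit[of "\<Union>i. K (n i)", OF _ _ *(4,1,2)])
    show "finite (\<Union>i. K (n i))" using *(3) fin K_compact by auto
    show "\<exists>t\<in>\<Union>i. K (n i). e $ i < \<bar>fval f t $ i\<bar>" if "F f \<noteq> 0" for f i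
    proof -
      have "e $ i < rho K (n i) i f" using *(5)[OF that] by (simp add: Uwin_def)
      then have "\<exists>t\<in>K (n i). e $ i < \<bar>fval f t $ i\<bar>"
        by (subst (asm) less_rho_iff) (use *(3) in simp_all)
      then show ?thesis by auto
    qed
  qed (simp add: assms(1))
qed

text \<open>In the non-discrete case finitely many positions exhaust the window only in the limit; the
  upper bound on the total mass of the window excludes an escape of mass.\<close>

lemma dense_RV_limit:
  assumes cD: "countable D" and dense: "\<And>n. n \<ge> 1 \<Longrightarrow> K n \<subseteq> closure (D \<inter> K n)"
    and Limsup: "\<And>n. n \<ge> 1 \<Longrightarrow> Limsup to_infty (\<lambda>u. emeasure (\<mu> u) (Owin K n)) \<le> emeasure \<nu> (Owin K n)"
    and F: "F \<in> test_functions K"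
  shows "((\<lambda>u. integral\<^sup>L (\<mu> u) F) \<longlongrightarrow> integral\<^sup>L \<nu> F) to_infty"
proof -
  obtain B n e where *: "continuous_on UNIV F" "\<And>f. \<bar>F f\<bar> \<le> B" "B > 0" "\<forall>i. n i \<ge> 1" "e \<in> posG"
    "\<And>f. F f \<noteq> 0 \<Longrightarrow> f \<in> Uwin K n e" using F by (elim test_functionsE) blast
  obtain m where m: "m \<ge> 1" "Uwin K n e \<subseteq> (Owin K m :: ('t, 'q) cfield set)"
    using ex_Uwin_subset_Owin[OF *(4,5)] by blast
  define w where "w = 1 / real m"
  have w: "w > 0" "(\<chi> i. w) \<in> (posG :: (real ^ 'q) set)" using m(1) by (simp_all add: w_def posG_def)
  define O' where "O' = (Owin K m :: ('t, 'q) cfield set)"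
  have O'_iff: "f \<in> O' \<longleftrightarrow> (\<forall>i. \<exists>t\<in>K m. w < \<bar>fval f t $ i\<bar>)" for f
    unfolding O'_def Owin_eq[OF m(1)] Uwin_def by (simp add: less_rho_iff[OF m(1)] w_def)
  have O'_meas [measurable]: "O' \<in> sets borel" unfolding O'_def by (rule Owin_borel[OF m(1)])
  have F_O': "f \<in> O'" if "F f \<noteq> 0" for f using *(6)[OF that] m(2) by (auto simp: O'_def)
  \<comment> \<open>The first k + 1 terms of an enumeration of the available positions; repetitions,
    if there are only finitely many positions, do no harm.\<close>
  define E where "E k = from_nat_into (D \<inter> K m) ` {..k}" for k
  have ne: "D \<inter> K m \<noteq> {}" using dense[OF m(1)] K_nonempty[OF m(1)] by auto
  have E: "finite (E k)" "E k \<subseteq> D" "E k \<subseteq> K m" for k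
    using from_nat_into[OF ne] by (auto simp: E_def)
  \<comment> \<open>The set \<open>E k\<close> reaches every position of \<open>D\<close> in
    \<open>K m\<close> eventually, and the factor k lifts any strict excess over w to 1. Thus \<eta>
    tends to the indicator of the whole window while never being positive outside it.\<close>
  define \<eta> where "\<eta> k f = (\<Prod>i\<in>UNIV. clamp (\<Sum>t\<in>E k. real k * max 0 (\<bar>fval f t $ i\<bar> - w)))"
    for k and f :: "('t, 'q) cfield"
  have \<eta>_cont: "continuous_on UNIV (\<eta> k)" for k unfolding \<eta>_def by (intro continuous_intros)
  have \<eta>_meas [measurable]: "\<eta> k \<in> borel_measurable borel" for k
    by (rule borel_measurable_continuous_onI[OF \<eta>_cont])
  have F_meas [measurable]: "F \<in> borel_measurable borel" by (rule borel_measurable_continuous_onI[OF *(1)])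
  have \<eta>_bounds: "0 \<le> \<eta> k f" "\<eta> k f \<le> 1" for k f unfolding \<eta>_def by (rule prod_clamp_bounds)+
  have \<eta>_supp: "\<exists>t\<in>E k. w < \<bar>fval f t $ i\<bar>" if "\<eta> k f \<noteq> 0" for k f i
  proof (rule ccontr)
    assume "\<not> ?thesis"
    then have "(\<Sum>t\<in>E k. real k * max 0 (\<bar>fval f t $ i\<bar> - w)) = 0"
      by (intro sum.neutral) (auto simp: max_def not_less)
    moreover have "0 < (\<Sum>t\<in>E k. real k * max 0 (\<bar>fval f t $ i\<bar> - w))"
      using that unfolding \<eta>_def prod_clamp_nonzero_iff[OF finite_class.finite_UNIV] by blast
    ultimately show False by simp
  qed
  have \<eta>_O': "f \<in> O'" if "\<eta> k f \<noteq> 0" for k f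
    unfolding O'_iff using \<eta>_supp[OF that] E(3)[of k] by blast
  have \<eta>_lim: "(\<lambda>k. \<eta> k f) \<longlonglongrightarrow> indicator O' f" for f
  proof (cases "f \<in> O'")
    case True
    have "\<forall>\<^sub>F k in sequentially. clamp (\<Sum>t\<in>E k. real k * max 0 (\<bar>fval f t $ i\<bar> - w)) = 1" for i
    proof -
      obtain x where x: "x \<in> K m" "w < \<bar>fval f x $ i\<bar>" using True unfolding O'_iff by blast
      \<comment> \<open>A strict excess persists nearby, so the position can be moved into
        \<open>D\<close>. It must stay in \<open>K m\<close>, which is why density is assumed within
        each \<open>K n\<close>.\<close>
      have "open {t. w < \<bar>fval f t $ i\<bar>}"
        using fval[of f] by (intro open_Collect_less continuous_intros) auto
      then obtain y where y: "y \<in> D \<inter> K m" "w < \<bar>fval f y $ i\<bar>"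
        using dense[OF m(1)] x open_Int_closure_eq_empty[of "{t. w < \<bar>fval f t $ i\<bar>}" "D \<inter> K m"] by blast
      have "countable (D \<inter> K m)" using cD by auto
      then obtain j where j: "from_nat_into (D \<inter> K m) j = y" using from_nat_into_surj y(1) by metis
      define d where "d = \<bar>fval f y $ i\<bar> - w"
      have d: "d > 0" using y(2) by (simp add: d_def)
      have "filterlim (\<lambda>k. d * real k) at_top sequentially"
        by (rule filterlim_tendsto_pos_mult_at_top[OF tendsto_const d filterlim_real_sequentially])
      then have "\<forall>\<^sub>F k in sequentially. 1 \<le> d * real k"
        unfolding filterlim_at_top by blast
      moreover have "\<forall>\<^sub>F k in sequentially. j \<le> k" by (rule eventually_ge_at_top)
      ultimately show ?thesis
      proof eventually_elim
        case (elim k)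
        have "y \<in> E k" using elim(2) j unfolding E_def by blast
        have "d * real k = real k * max 0 (\<bar>fval f y $ i\<bar> - w)" using d by (simp add: d_def max_def)
        also have "\<dots> \<le> (\<Sum>t\<in>E k. real k * max 0 (\<bar>fval f t $ i\<bar> - w))"
          by (rule member_le_sum[OF \<open>y \<in> E k\<close>]) (auto simp: E(1))
        finally show ?case using elim(1) by (intro clamp_eq_1) linarith
      qed
    qed
    then have "\<forall>\<^sub>F k in sequentially. \<forall>i. clamp (\<Sum>t\<in>E k. real k * max 0 (\<bar>fval f t $ i\<bar> - w)) = 1"
      by (rule eventually_all_finite)
    then have "\<forall>\<^sub>F k in sequentially. \<eta> k f = indicator O' f"
      by eventually_elim (simp add: \<eta>_def True)
    then show ?thesis by (rule tendsto_eventually)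
  next
    case False
    then have "\<eta> k f = 0" for k using \<eta>_O' by blast
    then show ?thesis using False by simp
  qed
  have fin_O': "emeasure \<nu> O' < \<infinity>" unfolding O'_def by (rule emeasure_Owin_finite[OF m(1)])
  have int_O': "integrable \<nu> (\<lambda>f. c * indicator O' f :: real)" for c
    using fin_O' by (intro integrable_mult_right integrable_real_indicator) auto
  have lim_\<eta>: "(\<lambda>k. \<integral>f. \<eta> k f \<partial>\<nu>) \<longlonglongrightarrow> measure \<nu> O'"
  proof -
    have "(\<lambda>k. \<integral>f. \<eta> k f \<partial>\<nu>) \<longlonglongrightarrow> (\<integral>f. indicator O' f \<partial>\<nu>)"
    proof (rule integral_dominated_convergence[OF _ _ int_O'[of 1]])
      show "AE f in \<nu>. (\<lambda>k. \<eta> k f) \<longlonglongrightarrow> indicator O' f" by (intro AE_I2 \<eta>_lim)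
      show "AE f in \<nu>. norm (\<eta> k f) \<le> 1 * indicator O' f" for k
      proof (rule AE_I2)
        fix f
        show "norm (\<eta> k f) \<le> 1 * indicator O' f"
          using \<eta>_O'[of k f] \<eta>_bounds[of k f] by (cases "\<eta> k f = 0") simp_all
      qed
    qed measurable
    then show ?thesis by simp
  qed
  show ?thesis
  proof (rule tendsto_approx)
    fix k
    show "((\<lambda>u. \<integral>f. F f * \<eta> k f \<partial>\<mu> u) \<longlongrightarrow> (\<integral>f. F f * \<eta> k f \<partial>\<nu>)) to_infty"
    proof (rule finite_positions_limit[OF E(1,2) w(2), where B = B])
      show "continuous_on UNIV (\<lambda>f. F f * \<eta> k f)" by (intro continuous_intros *(1) \<eta>_cont)
      show "\<bar>F f * \<eta> k f\<bar> \<le> B" for f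
        using mult_mono[OF *(2)[of f] \<eta>_bounds(2)[of k f]] \<eta>_bounds(1)[of k f] *(3) by (simp add: abs_mult)
      show "\<exists>t\<in>E k. (\<chi> i. w) $ i < \<bar>fval f t $ i\<bar>" if "F f * \<eta> k f \<noteq> 0" for f i
        using \<eta>_supp[of k f i] that by simp
    qed
    \<comment> \<open>Convergence for \<eta> itself supplies the matching lower bound on the mass of
      the window.\<close>
    have "((\<lambda>u. \<integral>f. \<eta> k f \<partial>\<mu> u) \<longlongrightarrow> (\<integral>f. \<eta> k f \<partial>\<nu>)) to_infty"
      by (rule finite_positions_limit[OF E(1,2) w(2) \<eta>_cont, where B = 1])
        (use \<eta>_supp \<eta>_bounds in auto)
    then show "((\<lambda>u. B * (measure \<nu> O' + 1 / real (Suc k) - (\<integral>f. \<eta> k f \<partial>\<mu> u)))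
        \<longlongrightarrow> B * (measure \<nu> O' + 1 / real (Suc k) - (\<integral>f. \<eta> k f \<partial>\<nu>))) to_infty"
      by (intro tendsto_intros)
    \<comment> \<open>The slack 1/(k + 1) makes the inequality strict, so that it holds eventually
      in u; it vanishes as k grows.\<close>
    have "Limsup to_infty (\<lambda>u. emeasure (\<mu> u) O') < ennreal (measure \<nu> O' + 1 / real (Suc k))"
    proof -
      have "Limsup to_infty (\<lambda>u. emeasure (\<mu> u) O') \<le> emeasure \<nu> O'"
        unfolding O'_def by (rule Limsup[OF m(1)])
      also have "\<dots> = ennreal (measure \<nu> O')" using fin_O' by (simp add: emeasure_eq_ennreal_measure)
      also have "\<dots> < ennreal (measure \<nu> O' + 1 / real (Suc k))"
        by (subst ennreal_less_iff) auto
      finally show ?thesis .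
    qed
    then have "\<forall>\<^sub>F u in to_infty. emeasure (\<mu> u) O' < ennreal (measure \<nu> O' + 1 / real (Suc k))"
      by (rule Limsup_lessD)
    then show "\<forall>\<^sub>F u in to_infty. \<bar>integral\<^sup>L (\<mu> u) F - (\<integral>f. F f * \<eta> k f \<partial>\<mu> u)\<bar>
        \<le> B * (measure \<nu> O' + 1 / real (Suc k) - (\<integral>f. \<eta> k f \<partial>\<mu> u))"
    proof eventually_elim
      case (elim u)
      interpret finite_measure "\<mu> u" by (rule finite_measure_mu')
      have mO: "measure (\<mu> u) O' < measure \<nu> O' + 1 / real (Suc k)"
        using elim unfolding emeasure_eq_measure by (subst (asm) ennreal_less_iff) auto
      have i1: "integrable (\<mu> u) F" by (rule integrable_mu[OF F_meas *(2)])
      have i2: "integrable (\<mu> u) (\<lambda>f. F f * \<eta> k f)"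
        by (rule integrable_mu[where B = B])
          (use mult_mono[OF *(2) \<eta>_bounds(2)[of k]] \<eta>_bounds(1)[of k] *(3) in \<open>auto simp: abs_mult\<close>)
      have i3: "integrable (\<mu> u) (\<eta> k)"
        by (rule integrable_mu[where B = 1]) (use \<eta>_bounds in auto)
      have i4: "integrable (\<mu> u) (indicator O' :: _ \<Rightarrow> real)"
        by (rule integrable_mu[where B = 1]) (auto simp: indicator_def)
      have "\<bar>integral\<^sup>L (\<mu> u) F - (\<integral>f. F f * \<eta> k f \<partial>\<mu> u)\<bar> = \<bar>\<integral>f. F f - F f * \<eta> k f \<partial>\<mu> u\<bar>"
        by (simp add: Bochner_Integration.integral_diff[OF i1 i2])
      also have "\<dots> \<le> (\<integral>f. \<bar>F f - F f * \<eta> k f\<bar> \<partial>\<mu> u)" by (rule integral_abs_bound)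
      \<comment> \<open>Both F and \<eta> vanish off the window and \<eta> <= 1, so what the
        finitely many positions miss is weighted by 1_O' - \<eta>.\<close>
      also have "\<dots> \<le> (\<integral>f. B * (indicator O' f - \<eta> k f) \<partial>\<mu> u)"
      proof (rule integral_mono)
        show "integrable (\<mu> u) (\<lambda>f. \<bar>F f - F f * \<eta> k f\<bar>)"
          by (intro integrable_abs Bochner_Integration.integrable_diff i1 i2)
        show "integrable (\<mu> u) (\<lambda>f. B * (indicator O' f - \<eta> k f))"
          by (intro integrable_mult_right Bochner_Integration.integrable_diff i3 i4)
        show "\<bar>F f - F f * \<eta> k f\<bar> \<le> B * (indicator O' f - \<eta> k f)" for f
        proof (cases "f \<in> O'")
          case True
          have "F f - F f * \<eta> k f = F f * (1 - \<eta> k f)" by (simp add: algebra_simps)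
          then have "\<bar>F f - F f * \<eta> k f\<bar> = \<bar>F f\<bar> * (1 - \<eta> k f)" using \<eta>_bounds(2)[of k f] by (simp add: abs_mult)
          also have "\<dots> \<le> B * (1 - \<eta> k f)" using \<eta>_bounds(2)[of k f] *(2) by (intro mult_right_mono) auto
          finally show ?thesis using True by simp
        next
          case False
          then have "F f = 0" "\<eta> k f = 0" using F_O' \<eta>_O' by blast+
          then show ?thesis using False by simp
        qed
      qed
      also have "\<dots> = B * (measure (\<mu> u) O' - (\<integral>f. \<eta> k f \<partial>\<mu> u))"
        using Bochner_Integration.integral_diff[OF i4 i3] by simp
      also have "\<dots> \<le> B * (measure \<nu> O' + 1 / real (Suc k) - (\<integral>f. \<eta> k f \<partial>\<mu> u))"
        using mO *(3) by (intro mult_left_mono) auto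
      finally show ?case .
    qed
  next
    show "(\<lambda>k. \<integral>f. F f * \<eta> k f \<partial>\<nu>) \<longlonglongrightarrow> integral\<^sup>L \<nu> F"
    proof (rule integral_dominated_convergence[OF _ _ int_O'[of B]])
      show "AE f in \<nu>. (\<lambda>k. F f * \<eta> k f) \<longlonglongrightarrow> F f"
      proof (rule AE_I2)
        fix f
        have "(\<lambda>k. F f * \<eta> k f) \<longlonglongrightarrow> F f * indicator O' f" by (intro tendsto_intros \<eta>_lim)
        moreover have "F f * indicator O' f = F f" using F_O'[of f] by (auto simp: indicator_def)
        ultimately show "(\<lambda>k. F f * \<eta> k f) \<longlonglongrightarrow> F f" by simp
      qed
      show "AE f in \<nu>. norm (F f * \<eta> k f) \<le> B * indicator O' f" for k
      proof (rule AE_I2)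
        fix f
        show "norm (F f * \<eta> k f) \<le> B * indicator O' f"
          using mult_mono[OF *(2)[of f] \<eta>_bounds(2)[of k f]] \<eta>_bounds(1)[of k f] \<eta>_O'[of k f] *(3)
          by (cases "\<eta> k f = 0") (auto simp: abs_mult indicator_def)
      qed
    qed measurable
    have "(\<lambda>k. 1 / real (Suc k)) \<longlonglongrightarrow> 0" by (rule LIMSEQ_Suc[OF lim_const_over_n])
    then have "(\<lambda>k. B * (measure \<nu> O' + 1 / real (Suc k) - (\<integral>f. \<eta> k f \<partial>\<nu>)))
        \<longlonglongrightarrow> B * (measure \<nu> O' + 0 - measure \<nu> O')"
      by (intro tendsto_intros lim_\<eta>)
    then show "(\<lambda>k. B * (measure \<nu> O' + 1 / real (Suc k) - (\<integral>f. \<eta> k f \<partial>\<nu>))) \<longlonglongrightarrow> 0" by simp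
  qed
qed

end

section \<open>The equivalences for discrete and for densely sampled index groups\<close>

lemma RV_Pi_iff:
  "RV_Pi K \<nu> b M X \<longleftrightarrow>
    (\<forall>F\<in>test_functions K. ((\<lambda>u. integral\<^sup>L (\<mu> u) F) \<longlongrightarrow> integral\<^sup>L \<nu> F) to_infty)"
  unfolding RV_Pi_def using measure_on_CPi_nuZ nuZ_nonzero boundedly_finite_nuZ by blast

lemma discrete_RV_Pi_iff:
  assumes "\<And>C :: 't set. compact C \<Longrightarrow> finite C"
  shows "RV_Pi K \<nu> b M X \<longleftrightarrow> shift_invariant \<nu> \<and> anchored_convergence p UNIV \<mu> \<nu>"
  unfolding RV_Pi_iff
  using RV_imp_shift_invariant RV_imp_anchored_convergence[of p UNIV]
    discrete_RV_limit[of p UNIV, OF _ _ _ refl assms] by blast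

lemma dense_RV_Pi_iff:
  assumes "\<And>x y. x \<in> D \<Longrightarrow> y \<in> D \<Longrightarrow> x - y \<in> D" "countable D"
    and "\<And>n. n \<ge> 1 \<Longrightarrow> K n \<subseteq> closure (D \<inter> K n)"
  shows "RV_Pi K \<nu> b M X \<longleftrightarrow> shift_invariant \<nu> \<and> anchored_convergence p D \<mu> \<nu> \<and>
    (\<forall>n\<ge>1. Limsup to_infty (\<lambda>u. emeasure (\<mu> u) (Owin K n)) \<le> emeasure \<nu> (Owin K n))"
  (is "_ \<longleftrightarrow> ?R")
proof
  assume "RV_Pi K \<nu> b M X"
  then have conv: "F \<in> test_functions K \<Longrightarrow> ((\<lambda>u. integral\<^sup>L (\<mu> u) F) \<longlongrightarrow> integral\<^sup>L \<nu> F) to_infty" for F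
    unfolding RV_Pi_iff by simp
  show ?R
    by (intro conjI allI impI RV_imp_shift_invariant RV_imp_anchored_convergence RV_imp_Limsup_Owin conv)
next
  assume R: ?R
  show "RV_Pi K \<nu> b M X"
    unfolding RV_Pi_iff
    by (intro ballI dense_RV_limit[where D = D and p = p]) (use R assms in simp_all)
qed

end

section \<open>Index groups\<close>

lemma exhaustion_cube: "exhaustion (cube :: nat \<Rightarrow> (real ^ 'm::finite) set)"
  unfolding exhaustion_def
proof (intro conjI allI impI)
  have eq: "(cube n :: (real ^ 'm) set) = cbox (\<chi> j. - real n) (\<chi> j. real n)" for n :: nat
    by (auto simp: cube_def mem_box_cart abs_le_iff minus_le_iff)
  show "compact (cube n :: (real ^ 'm) set)" for n unfolding eq by (rule compact_cbox)
  show "cube n \<noteq> ({} :: (real ^ 'm) set)" for n by (auto simp: cube_def intro!: exI[of _ 0])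
  show "cube m \<subseteq> (cube n :: (real ^ 'm) set)" if "m \<le> n" for m n
    using that by (auto simp: cube_def intro: order_trans)
  fix C :: "(real ^ 'm) set" assume "compact C"
  then obtain R where R: "\<And>x. x \<in> C \<Longrightarrow> norm x \<le> R"
    using compact_imp_bounded bounded_iff by metis
  have "C \<subseteq> cube (Suc (nat \<lceil>R\<rceil>))"
  proof
    fix x assume "x \<in> C"
    have "\<bar>x $ j\<bar> \<le> real (Suc (nat \<lceil>R\<rceil>))" for j
      using component_le_norm_cart[of x j] R[OF \<open>x \<in> C\<close>] real_nat_ceiling_ge[of R]
      unfolding of_nat_Suc by linarith
    then show "x \<in> cube (Suc (nat \<lceil>R\<rceil>))" by (simp add: cube_def)
  qed
  then show "\<exists>n\<ge>1. C \<subseteq> cube n" by (intro exI[of _ "Suc (nat \<lceil>R\<rceil>)"]) simp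
qed

lemma countable_rational_vec: "countable {t :: real ^ 'm::finite. \<forall>j. t $ j \<in> \<rat>}"
proof (rule countable_subset)
  show "{t :: real ^ 'm. \<forall>j. t $ j \<in> \<rat>} \<subseteq> vec_lambda ` (PiE UNIV (\<lambda>_. \<rat>))"
    by (auto simp: PiE_iff intro!: image_eqI[of _ vec_lambda, OF vec_nth_inverse[symmetric]])
  show "countable (vec_lambda ` (PiE (UNIV :: 'm set) (\<lambda>_. \<rat> :: real set)))"
    by (intro countable_image countable_PiE countable_rat) auto
qed

text \<open>Approximation that never increases the absolute value, so that rational approximants of
  a point of a cube remain in the cube, including at its boundary.\<close>

lemma Rats_approx_abs_le:
  fixes x :: real
  assumes "d > 0"
  shows "\<exists>q\<in>\<rat>. \<bar>q\<bar> \<le> \<bar>x\<bar> \<and> \<bar>q - x\<bar> < d"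
proof (cases "x = 0")
  case False
  then have "max 0 (\<bar>x\<bar> - d) < \<bar>x\<bar>" using assms by simp
  then obtain q where q: "q \<in> \<rat>" "max 0 (\<bar>x\<bar> - d) < q" "q < \<bar>x\<bar>"
    using Rats_dense_in_real by blast
  show ?thesis
  proof (rule bexI[of _ "if x > 0 then q else - q"])
    show "\<bar>if x > 0 then q else - q\<bar> \<le> \<bar>x\<bar> \<and> \<bar>(if x > 0 then q else - q) - x\<bar> < d"
      using q(2,3) False by (auto simp: abs_if split: if_splits)
  qed (use q(1) in auto)
qed (use assms in \<open>auto intro!: bexI[of _ 0]\<close>)

lemma cube_subset_closure_rational:
  "cube n \<subseteq> closure ({t :: real ^ 'm::finite. \<forall>j. t $ j \<in> \<rat>} \<inter> cube n)"
proof
  fix x :: "real ^ 'm" assume x: "x \<in> cube n"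
  show "x \<in> closure ({t. \<forall>j. t $ j \<in> \<rat>} \<inter> cube n)"
    unfolding closure_approachable
  proof (intro allI impI)
    fix e :: real assume "e > 0"
    \<comment> \<open>The distance is bounded by the sum of coordinate errors, hence one share of e
      for each coordinate.\<close>
    define d where "d = e / real CARD('m)"
    have "d > 0" using \<open>e > 0\<close> by (simp add: d_def)
    then have "\<forall>j. \<exists>q. q \<in> \<rat> \<and> \<bar>q\<bar> \<le> \<bar>x $ j\<bar> \<and> \<bar>q - x $ j\<bar> < d"
      using Rats_approx_abs_le by blast
    then obtain q where q: "\<And>j. q j \<in> \<rat>" "\<And>j. \<bar>q j\<bar> \<le> \<bar>x $ j\<bar>" "\<And>j. \<bar>q j - x $ j\<bar> < d"
      by metis
    have "dist (vec_lambda q) x \<le> (\<Sum>j\<in>UNIV. \<bar>q j - x $ j\<bar>)"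
      unfolding dist_norm using norm_le_l1_cart[of "vec_lambda q - x"] by simp
    also have "\<dots> < (\<Sum>j\<in>(UNIV :: 'm set). d)" by (intro sum_strict_mono q) auto
    also have "\<dots> = e" by (simp add: d_def)
    finally have "dist (vec_lambda q) x < e" .
    moreover have "vec_lambda q \<in> cube n"
      using x q(2) by (auto simp: cube_def intro: order_trans)
    ultimately show "\<exists>y\<in>{t. \<forall>j. t $ j \<in> \<rat>} \<inter> cube n. dist y x < e"
      using q(1) by (intro bexI[of _ "vec_lambda q"]) auto
  qed
qed

lemma discrete_countable_basis:
  "\<exists>B :: 'd::{countable, discrete_topology} set set. countable B \<and> topological_basis B"
proof (intro exI conjI)
  show "countable (range (\<lambda>x :: 'd. {x}))" by simp
  show "topological_basis (range (\<lambda>x :: 'd. {x}))"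
    by (rule topological_basisI) (auto intro: discrete_topology_class.open_discrete)
qed

lemma discrete_compact_imp_finite:
  fixes C :: "'d::discrete_topology set"
  assumes "compact C"
  shows "finite C"
proof -
  obtain T where "T \<subseteq> C" "finite T" "C \<subseteq> (\<Union>t\<in>T. {t})"
    using compactE_image[OF assms, of C "\<lambda>x. {x}"] by (auto simp: discrete_topology_class.open_discrete)
  then show ?thesis by (auto intro: finite_subset)
qed

text \<open>The type classes on \<open>'d\<close> encode a finite or countably infinite discrete
  abelian group, with an arbitrary exhaustion; over \<open>real ^ 'm\<close> the exhaustion is the
  fixed one by cubes. Any coordinate \<open>p\<close> may take the role of the first.\<close>

theorem corollary3p7:
  fixes p :: "'q::finite" and \<alpha> :: "real ^ 'q" and b :: "'q \<Rightarrow> real \<Rightarrow> real"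
    and M :: "'w measure" and N :: "'v measure"
  assumes "prob_space M" and "prob_space N"
    and "\<And>i. \<alpha> $ i > 0"
    and "\<And>i x. x > 0 \<Longrightarrow> b i x > 0"
    and "\<And>i. regularly_varying (\<alpha> $ i) (b i)"
  shows
    "(\<forall>(K :: nat \<Rightarrow> 'd::{countable, discrete_topology, topological_ab_group_add} set)
        (X :: 'w \<Rightarrow> ('d, 'q) cfield) (Z :: 'v \<Rightarrow> ('d, 'q) cfield).
        exhaustion K \<longrightarrow> X \<in> borel_measurable M \<longrightarrow> strictly_stationary M X \<longrightarrow>
        representer K \<alpha> N Z \<longrightarrow>
        (RV_Pi K (nuZ \<alpha> N Z) b M X \<longleftrightarrow>
           shift_invariant (nuZ \<alpha> N Z) \<and>
           anchored_convergence p UNIV (mu b M X) (nuZ \<alpha> N Z)))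
     \<and>
     (\<forall>(X :: 'w \<Rightarrow> (real ^ 'm::finite, 'q) cfield) (Z :: 'v \<Rightarrow> (real ^ 'm, 'q) cfield).
        X \<in> borel_measurable M \<longrightarrow> strictly_stationary M X \<longrightarrow>
        representer cube \<alpha> N Z \<longrightarrow>
        (RV_Pi cube (nuZ \<alpha> N Z) b M X \<longleftrightarrow>
           shift_invariant (nuZ \<alpha> N Z) \<and>
           anchored_convergence p {t. \<forall>j. t $ j \<in> \<rat>} (mu b M X) (nuZ \<alpha> N Z) \<and>
           (\<forall>n\<ge>1. Limsup to_infty (\<lambda>u. emeasure (mu b M X u) (Owin cube n))
                     \<le> emeasure (nuZ \<alpha> N Z) (Owin cube n))))"
proof (intro conjI allI impI)
  fix K :: "nat \<Rightarrow> 'd set" and X :: "'w \<Rightarrow> ('d, 'q) cfield" and Z :: "'v \<Rightarrow> ('d, 'q) cfield"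
  assume *: "exhaustion K" "X \<in> borel_measurable M" "strictly_stationary M X" "representer K \<alpha> N Z"
  interpret stationary_field K \<alpha> N Z b M X
  proof (intro stationary_field.intro representer_measure.intro index_space.intro
      representer_measure_axioms.intro stationary_field_axioms.intro)
    show "\<exists>B :: 'd set set. countable B \<and> topological_basis B" by (fact discrete_countable_basis)
    show "prob_space M" "prob_space N" by (fact assms)+
    show "0 < \<alpha> $ i" for i by (fact assms)
    show "0 < b i x" if "0 < x" for i x using that by (fact assms)
    show "regularly_varying (\<alpha> $ i) (b i)" for i by (fact assms)
  qed (fact *)+
  show "RV_Pi K (nuZ \<alpha> N Z) b M X \<longleftrightarrow>
      shift_invariant (nuZ \<alpha> N Z) \<and> anchored_convergence p UNIV (mu b M X) (nuZ \<alpha> N Z)"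
    by (rule discrete_RV_Pi_iff[OF discrete_compact_imp_finite])
next
  fix X :: "'w \<Rightarrow> (real ^ 'm, 'q) cfield" and Z :: "'v \<Rightarrow> (real ^ 'm, 'q) cfield"
  assume *: "X \<in> borel_measurable M" "strictly_stationary M X" "representer cube \<alpha> N Z"
  interpret stationary_field "cube :: nat \<Rightarrow> (real ^ 'm) set" \<alpha> N Z b M X
  proof (intro stationary_field.intro representer_measure.intro index_space.intro
      representer_measure_axioms.intro stationary_field_axioms.intro)
    show "exhaustion (cube :: nat \<Rightarrow> (real ^ 'm) set)" by (fact exhaustion_cube)
    show "\<exists>B :: (real ^ 'm) set set. countable B \<and> topological_basis B" by (fact ex_countable_basis)
    show "prob_space M" "prob_space N" by (fact assms)+
    show "0 < \<alpha> $ i" for i by (fact assms)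
    show "0 < b i x" if "0 < x" for i x using that by (fact assms)
    show "regularly_varying (\<alpha> $ i) (b i)" for i by (fact assms)
  qed (fact *)+
  show "RV_Pi cube (nuZ \<alpha> N Z) b M X \<longleftrightarrow>
      shift_invariant (nuZ \<alpha> N Z) \<and>
      anchored_convergence p {t. \<forall>j. t $ j \<in> \<rat>} (mu b M X) (nuZ \<alpha> N Z) \<and>
      (\<forall>n\<ge>1. Limsup to_infty (\<lambda>u. emeasure (mu b M X u) (Owin cube n))
          \<le> emeasure (nuZ \<alpha> N Z) (Owin cube n))"
    by (rule dense_RV_Pi_iff) (simp_all add: countable_rational_vec cube_subset_closure_rational)
qed

end
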